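(* Let $M$ be a countable transitive $\aleph_0$-categorical structure with no algebraicity that admits weak elimination of imaginaries, and $G=\operatorname{Aut}(M)$. Consider the action $G\curvearrowright\mathrm{LO}(M)$. Then exactly one of the following holds: (1) the action has a fixed point (i.e. there is a $G$-invariant linear order on $M$); (2) $\mu_u$ is the unique $G$-invariant Borel probability measure on $\mathrm{LO}(M)$ (so the action is uniquely ergodic).
   Context: $\mathrm{LO}(M)\subseteq 2^{M\times M}$ is the compact space of linear orders on $M$, with $a<_{g\cdot x}b\iff g^{-1}a<_x g^{-1}b$. The uniform measure $\mu_u$ is the Borel probability measure on $\mathrm{LO}(M)$ with $\mu_u(\{x: a_0<_x\dots<_x a_{k-1}\})=1/k!$ for all distinct $a_0,\dots,a_{k-1}\in M$. Transitive: $G$ acts transitively on $M$. $\aleph_0$-categorical: $G$ has finitely many orbits on each $M^k$. No algebraicity: for finite $A\subseteq M$, all orbits of the pointwise stabilizer $G_A$ on $M\setminus A$ are infinite. Weak elimination of imaginaries: for every proper open subgroup $V<G$ (pointwise convergence topology) there is a finite tuple $\bar a$ with $G_{\bar a}\le V$ and $[V:G_{\bar a}]<\infty$. *)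

theory Defs
  imports "HOL-Probability.Probability"
begin

text \<open>A (relational) structure with universe the type 'a: a family of relations,
  each relation being a set of finite tuples (lists) of elements.\<close>

definition Aut :: "('i \<Rightarrow> 'a list set) \<Rightarrow> ('a \<Rightarrow> 'a) set" where
  "Aut R = {g. bij g \<and> (\<forall>i xs. xs \<in> R i \<longleftrightarrow> map g xs \<in> R i)}"

definition transitive_on :: "('a \<Rightarrow> 'a) set \<Rightarrow> bool" where
  "transitive_on G \<longleftrightarrow> (\<forall>a b. \<exists>g\<in>G. g a = b)"

definition tuple_orbit :: "('a \<Rightarrow> 'a) set \<Rightarrow> 'a list \<Rightarrow> 'a list set" where
  "tuple_orbit G xs = {map g xs | g. g \<in> G}"

definition aleph0_categorical :: "('a \<Rightarrow> 'a) set \<Rightarrow> bool" where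
  "aleph0_categorical G \<longleftrightarrow> (\<forall>k. finite (tuple_orbit G ` {xs. length xs = k}))"

definition stab :: "('a \<Rightarrow> 'a) set \<Rightarrow> 'a set \<Rightarrow> ('a \<Rightarrow> 'a) set" where
  "stab G A = {g \<in> G. \<forall>a\<in>A. g a = a}"

definition no_algebraicity :: "('a \<Rightarrow> 'a) set \<Rightarrow> bool" where
  "no_algebraicity G \<longleftrightarrow>
     (\<forall>A b. finite A \<longrightarrow> b \<notin> A \<longrightarrow> infinite {g b | g. g \<in> stab G A})"

definition pw_open :: "('a \<Rightarrow> 'a) set \<Rightarrow> ('a \<Rightarrow> 'a) set \<Rightarrow> bool" where
  "pw_open G U \<longleftrightarrow> U \<subseteq> G \<and>
     (\<forall>g\<in>U. \<exists>A. finite A \<and> {h \<in> G. \<forall>a\<in>A. h a = g a} \<subseteq> U)"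

definition is_subgroup :: "('a \<Rightarrow> 'a) set \<Rightarrow> ('a \<Rightarrow> 'a) set \<Rightarrow> bool" where
  "is_subgroup V G \<longleftrightarrow> V \<subseteq> G \<and> id \<in> V \<and>
     (\<forall>g\<in>V. \<forall>h\<in>V. g \<circ> h \<in> V) \<and> (\<forall>g\<in>V. inv g \<in> V)"

definition finite_index :: "('a \<Rightarrow> 'a) set \<Rightarrow> ('a \<Rightarrow> 'a) set \<Rightarrow> bool" where
  "finite_index V H \<longleftrightarrow> finite {(\<lambda>h. g \<circ> h) ` H | g. g \<in> V}"

definition weak_EI :: "('a \<Rightarrow> 'a) set \<Rightarrow> bool" where
  "weak_EI G \<longleftrightarrow> (\<forall>V. is_subgroup V G \<and> pw_open G V \<and> V \<noteq> G \<longrightarrow>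
     (\<exists>as. stab G (set as) \<subseteq> V \<and> finite_index V (stab G (set as))))"

text \<open>Linear orders on 'a, coded as points of 2^(M x M): x (a,b) means a <_x b.\<close>
definition LO :: "('a \<times> 'a \<Rightarrow> bool) set" where
  "LO = {x. (\<forall>a. \<not> x (a, a)) \<and> (\<forall>a b c. x (a, b) \<longrightarrow> x (b, c) \<longrightarrow> x (a, c))
            \<and> (\<forall>a b. a \<noteq> b \<longrightarrow> x (a, b) \<or> x (b, a))}"

definition lo_act :: "('a \<Rightarrow> 'a) \<Rightarrow> ('a \<times> 'a \<Rightarrow> bool) \<Rightarrow> ('a \<times> 'a \<Rightarrow> bool)" where
  "lo_act g x = (\<lambda>(a, b). x (inv g a, inv g b))"

definition LO_borel :: "('a \<times> 'a \<Rightarrow> bool) measure" where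
  "LO_borel = restrict_space borel LO"

definition borel_prob_LO :: "('a \<times> 'a \<Rightarrow> bool) measure \<Rightarrow> bool" where
  "borel_prob_LO \<mu> \<longleftrightarrow> prob_space \<mu> \<and> sets \<mu> = sets LO_borel \<and> space \<mu> = LO"

definition invariant_measure :: "('a \<Rightarrow> 'a) set \<Rightarrow> ('a \<times> 'a \<Rightarrow> bool) measure \<Rightarrow> bool" where
  "invariant_measure G \<mu> \<longleftrightarrow> borel_prob_LO \<mu> \<and> (\<forall>g\<in>G. distr \<mu> \<mu> (lo_act g) = \<mu>)"

definition uniform_measure_LO :: "('a \<times> 'a \<Rightarrow> bool) measure \<Rightarrow> bool" where
  "uniform_measure_LO \<mu> \<longleftrightarrow> borel_prob_LO \<mu> \<and>
     (\<forall>as. distinct as \<longrightarrow>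
        measure \<mu> {x \<in> LO. sorted_wrt (\<lambda>a b. x (a, b)) as} = 1 / fact (length as))"

end

theory Submission
  imports Defs "HOL-Library.Ramsey" "HOL-Combinatorics.Multiset_Permutations"
begin

text \<open>
  For an invariant measure \<open>\<mu>\<close> let \<open>F A\<close> be the sigma-algebra of events that are almost surely
  invariant under the stabiliser of the finite set \<open>A\<close>. The first step is that \<open>F A\<close> and \<open>F B\<close> are
  conditionally independent over \<open>F (A \<inter> B)\<close>. Averages of translates of an \<open>F B\<close>-measurable function
  by elements of \<open>stab G A\<close> converge to a function whose stabiliser is open, because by categoricity
  only finitely many correlations occur; no algebraicity and weak elimination of imaginaries then
  force this limit to be \<open>F (A \<inter> B)\<close>-measurable. It follows as in de Finetti's theorem that an
  equivariant family \<open>Y\<close> with \<open>Y a\<close> measurable over \<open>F {a}\<close> is exchangeable.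

  Apply this to the profile of \<open>a\<close>, which consists of the conditional probabilities \<open>\<eta> a c\<close> of
  \<open>a < c\<close> over \<open>F {a}\<close>. Almost surely \<open>a < b\<close> implies \<open>\<eta> a c \<ge> \<eta> b c\<close> for all other \<open>c\<close>, and the
  profiles of distinct points differ, so the order can be read off the profiles. Transported to a
  base point, any two profiles are comparable pointwise, so they are ordered by a real score \<open>s a\<close>.
  If scores tie with positive probability, or if the order disagrees with the scores with positive
  probability, then exchangeability gives orders that depend only on the type of a pair on arbitrarily
  large finite sets, whence an invariant order by compactness. Otherwise the order is almost surely the
  order of the exchangeable and distinct scores, so \<open>\<mu>\<close> is uniform.
\<close>

subsection \<open>Permutation groups without algebraicity\<close>

text \<open>Profiles are compared in two ways, and the gap between them shapes the second half. The
  order compares \<open>\<eta> a c\<close> with \<open>\<eta> b c\<close> at a common point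
  \<open>c\<close>. Exchangeability needs coordinates at the base point, and there a common
  coordinate \<open>d\<close> stands for two points, \<open>\<gamma> a d\<close> and
  \<open>\<gamma> b d\<close>. Hence a high score of \<open>a\<close> does not by itself place
  \<open>a\<close> before \<open>b\<close>; the outcome may also depend on the type of the pair.
  When it does, weak elimination of imaginaries is used a second time, through primitivity of
  \<open>G\<close>, to show that the resulting pattern of types decides every pair. The first half
  is about vectors fixed by stabilisers in the unitary representation of \<open>G\<close> on L^2.
  Cesaro averages over a sequence with constant Gram matrix make the limit explicit: only second
  moments enter, and the distance from an average to the limit is known exactly.\<close>

locale perm_group =
  fixes G :: "('a \<Rightarrow> 'a) set"
  assumes bij_G: "g \<in> G \<Longrightarrow> bij g"
    and id_G: "id \<in> G"
    and comp_G: "g \<in> G \<Longrightarrow> h \<in> G \<Longrightarrow> g \<circ> h \<in> G"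
    and inv_G: "g \<in> G \<Longrightarrow> inv g \<in> G"
begin

lemma inv_apply [simp]: "g \<in> G \<Longrightarrow> inv g (g a) = a"
  using bij_G by (simp add: bij_is_inj)

lemma apply_inv: "g \<in> G \<Longrightarrow> g (inv g a) = a"
  using bij_G by (simp add: bij_is_surj surj_f_inv_f)

lemma inv_comp_G [simp]: "g \<in> G \<Longrightarrow> inv g \<circ> g = id" "g \<in> G \<Longrightarrow> g \<circ> inv g = id"
  by (auto simp: fun_eq_iff apply_inv)

lemma inv_inv_G [simp]: "g \<in> G \<Longrightarrow> inv (inv g) = g"
  by (simp add: bij_G inv_inv_eq)

lemma inj_G: "g \<in> G \<Longrightarrow> inj g"
  using bij_G bij_is_inj by blast

lemma apply_eq_iff_G: "g \<in> G \<Longrightarrow> g a = g b \<longleftrightarrow> a = b"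
  using inj_G by (auto simp: inj_eq)

lemma inv_eq_iff_G: "g \<in> G \<Longrightarrow> inv g a = b \<longleftrightarrow> a = g b"
  by (metis apply_inv inv_apply)

lemma stab_G: "g \<in> stab G A \<Longrightarrow> g \<in> G"
  by (simp add: stab_def)

lemma stab_fix: "g \<in> stab G A \<Longrightarrow> a \<in> A \<Longrightarrow> g a = a"
  by (simp add: stab_def)

lemma id_stab: "id \<in> stab G A"
  by (simp add: stab_def id_G)

lemma comp_stab: "g \<in> stab G A \<Longrightarrow> h \<in> stab G A \<Longrightarrow> g \<circ> h \<in> stab G A"
  by (simp add: stab_def comp_G)

lemma stab_mono: "A \<subseteq> B \<Longrightarrow> stab G B \<subseteq> stab G A"
  by (auto simp: stab_def)

lemma stab_empty [simp]: "stab G {} = G"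
  by (simp add: stab_def)

lemma conj_stab:
  assumes "g \<in> G" "h \<in> stab G A"
  shows "g \<circ> h \<circ> inv g \<in> stab G (g ` A)"
  using assms by (auto simp: stab_def intro!: comp_G inv_G)

definition ty :: "'a \<Rightarrow> 'a \<Rightarrow> 'a list set" where
  "ty a b = tuple_orbit G [a, b]"

lemma tuple_orbit_eq_iff:
  "tuple_orbit G xs = tuple_orbit G ys \<longleftrightarrow> (\<exists>g\<in>G. map g xs = ys)"
proof
  assume "tuple_orbit G xs = tuple_orbit G ys"
  moreover have "ys \<in> tuple_orbit G ys"
    using id_G unfolding tuple_orbit_def by (metis (mono_tags, lifting) list.map_id mem_Collect_eq)
  ultimately have "ys \<in> tuple_orbit G xs" by simp
  then show "\<exists>g\<in>G. map g xs = ys"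
    by (auto simp: tuple_orbit_def)
next
  assume "\<exists>g\<in>G. map g xs = ys"
  then obtain g where g: "g \<in> G" "map g xs = ys" by blast
  show "tuple_orbit G xs = tuple_orbit G ys"
  proof (rule antisym; rule subsetI)
    fix zs assume "zs \<in> tuple_orbit G xs"
    then obtain h where h: "h \<in> G" "zs = map h xs" by (auto simp: tuple_orbit_def)
    have "zs = map (h \<circ> inv g) ys"
      unfolding g(2)[symmetric] h(2) using g(1) by simp
    moreover have "h \<circ> inv g \<in> G" using g h comp_G inv_G by blast
    ultimately show "zs \<in> tuple_orbit G ys" unfolding tuple_orbit_def by blast
  next
    fix zs assume "zs \<in> tuple_orbit G ys"
    then obtain h where h: "h \<in> G" "zs = map h ys" by (auto simp: tuple_orbit_def)
    then have "zs = map (h \<circ> g) xs" using g by auto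
    moreover have "h \<circ> g \<in> G" using g h comp_G by blast
    ultimately show "zs \<in> tuple_orbit G xs" unfolding tuple_orbit_def by blast
  qed
qed

lemma ty_eq_iff: "ty a b = ty c d \<longleftrightarrow> (\<exists>g\<in>G. g a = c \<and> g b = d)"
  by (simp add: ty_def tuple_orbit_eq_iff)

lemma ty_apply: "g \<in> G \<Longrightarrow> ty (g a) (g b) = ty a b"
  by (metis ty_eq_iff)

end

section \<open>Finite supports of open subgroups, and primitivity\<close>

locale tame_group = perm_group G for G :: "('a \<Rightarrow> 'a) set" +
  assumes transitive: "transitive_on G"
    and categorical: "aleph0_categorical G"
    and no_alg: "no_algebraicity G"
    and wEI: "weak_EI G"
begin

lemma infinite_orbit: "finite A \<Longrightarrow> b \<notin> A \<Longrightarrow> infinite {g b | g. g \<in> stab G A}"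
  using no_alg by (simp add: no_algebraicity_def)

lemma infinite_universe: "infinite (UNIV :: 'a set)"
  using infinite_orbit[of "{}"] by (meson finite.emptyI empty_iff infinite_super subset_UNIV)

lemma finite_types: "finite (range (\<lambda>(a, b). ty a b))"
proof -
  have "range (\<lambda>(a, b). ty a b) \<subseteq> tuple_orbit G ` {xs. length xs = 2}"
    by (auto simp: ty_def)
  with categorical show ?thesis
    unfolding aleph0_categorical_def by (meson finite_subset)
qed

text \<open>Points are moved off \<open>F\<close> one at a time; no algebraicity over the points already moved
  makes each step possible.\<close>

lemma ex_stab_avoiding:
  assumes "finite A" "finite F" "finite B"
  shows "\<exists>h\<in>stab G A. h ` (B - A) \<inter> F = {}"
  using \<open>finite B\<close>
proof (induction B rule: finite_induct)
  case empty
  then show ?case using id_stab by auto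
next
  case (insert b B)
  then obtain h where h: "h \<in> stab G A" "h ` (B - A) \<inter> F = {}" by blast
  show ?case
  proof (cases "b \<in> A")
    case True
    then show ?thesis using h by (metis insert_Diff1)
  next
    case False
    let ?A = "A \<union> h ` B"
    have hG: "h \<in> G" using h stab_G by blast
    have "h b \<notin> A" using False h hG by (metis apply_eq_iff_G stab_fix)
    moreover have "h b \<notin> h ` B" using insert.hyps hG by (auto simp: apply_eq_iff_G)
    ultimately have "infinite {g (h b) | g. g \<in> stab G ?A}"
      by (intro infinite_orbit) (use assms insert in auto)
    then have "\<not> {g (h b) | g. g \<in> stab G ?A} \<subseteq> F"
      using \<open>finite F\<close> finite_subset by blast
    then obtain k where k: "k \<in> stab G ?A" "k (h b) \<notin> F" by blast
    have "k \<circ> h \<in> stab G A"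
      using h k by (intro comp_stab) (use stab_mono[of A ?A] in auto)
    moreover have "(k \<circ> h) ` (insert b B - A) \<inter> F = {}"
      using h k by (auto simp: stab_fix[OF k(1)])
    ultimately show ?thesis by blast
  qed
qed

text \<open>Each \<open>h n\<close> moves \<open>B - A\<close> off the finite union of all earlier
  translates of \<open>B\<close>, while the points of \<open>A \<inter> B\<close> stay fixed; these
  are the only points that two translates can share.\<close>

lemma ex_stab_sequence:
  assumes "finite A" "finite B"
  obtains h :: "nat \<Rightarrow> 'a \<Rightarrow> 'a" where "\<And>i. h i \<in> stab G A"
    "\<And>i j. i \<noteq> j \<Longrightarrow> h i ` B \<inter> h j ` B \<subseteq> A \<inter> B"
proof -
  define P where "P F k \<longleftrightarrow> k \<in> stab G A \<and> k ` (B - A) \<inter> F = {}" for F k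
  have ex: "finite F \<Longrightarrow> \<exists>k. P F k" for F
    unfolding P_def using ex_stab_avoiding[OF assms(1) _ assms(2)] by blast
  have "\<exists>h :: nat \<Rightarrow> 'a \<Rightarrow> 'a. \<forall>n. P (\<Union>i<n. h i ` B) (h n)"
  proof -
    define rec where "rec = (\<lambda>(h :: nat \<Rightarrow> 'a \<Rightarrow> 'a) n. SOME k. P (\<Union>i<n. h i ` B) k)"
    define h where "h = wfrec less_than rec"
    have adm: "adm_wf less_than rec"
      unfolding adm_wf_def rec_def by (auto intro!: arg_cong[where f=Eps] ext)
    have h: "h n = (SOME k. P (\<Union>i<n. h i ` B) k)" for n
      unfolding h_def by (subst wfrec_fixpoint[OF wf_less_than adm]) (simp add: rec_def)
    have "P (\<Union>i<n. h i ` B) (SOME k. P (\<Union>i<n. h i ` B) k)" for n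
      by (rule someI_ex[OF ex]) (use assms in auto)
    then have "P (\<Union>i<n. h i ` B) (h n)" for n
      by (simp only: h[symmetric])
    then show ?thesis by blast
  qed
  then obtain h :: "nat \<Rightarrow> 'a \<Rightarrow> 'a" where h: "\<And>n. P (\<Union>i<n. h i ` B) (h n)" by blast
  have *: "h i ` B \<inter> h j ` B \<subseteq> A \<inter> B" if "i < j" for i j
  proof
    fix y assume y: "y \<in> h i ` B \<inter> h j ` B"
    then obtain b where b: "b \<in> B" "y = h j b" by blast
    have "b \<in> A"
      using h[of j] y b that unfolding P_def by blast
    then show "y \<in> A \<inter> B" using b h[of j] unfolding P_def by (metis IntI stab_fix)
  qed
  show ?thesis
  proof
    show "h i \<in> stab G A" for i using h[of i] unfolding P_def by blast
    show "h i ` B \<inter> h j ` B \<subseteq> A \<inter> B" if "i \<noteq> j" for i j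
      using *[of i j] *[of j i] that by (metis Int_commute linorder_neqE_nat)
  qed
qed

text \<open>An element outside \<open>F\<close> has an infinite orbit under \<open>stab G F\<close>, which is incompatible with
  finite index.\<close>

lemma support_subset:
  assumes V: "is_subgroup V G" and fi: "finite_index V (stab G (set as))"
    and F: "finite F" "stab G F \<subseteq> V"
  shows "set as \<subseteq> F"
proof
  fix b assume b: "b \<in> set as"
  show "b \<in> F"
  proof (rule ccontr)
    assume "b \<notin> F"
    then have inf: "infinite {g b | g. g \<in> stab G F}" using F infinite_orbit by blast
    \<comment> \<open>All members of a coset of \<open>stab G (set as)\<close> send \<open>b\<close>
      to the same point, so the orbit of \<open>b\<close> under \<open>V\<close> has at most as many
      points as there are cosets.\<close>
    have "{g b | g. g \<in> V} \<subseteq> (\<lambda>K. (SOME k. k \<in> K) b) ` {(\<lambda>h. g \<circ> h) ` stab G (set as) | g. g \<in> V}"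
    proof
      fix y assume "y \<in> {g b | g. g \<in> V}"
      then obtain g where g: "g \<in> V" "y = g b" by blast
      define K where "K = (\<lambda>h. g \<circ> h) ` stab G (set as)"
      have "g \<circ> id \<in> K" unfolding K_def using id_stab by blast
      then have "(SOME k. k \<in> K) \<in> K" by (metis someI)
      then have "(SOME k. k \<in> K) b = y"
        unfolding K_def using g b by (auto simp: stab_fix)
      then show "y \<in> (\<lambda>K. (SOME k. k \<in> K) b) ` {(\<lambda>h. g \<circ> h) ` stab G (set as) | g. g \<in> V}"
        using g(1) unfolding K_def by blast
    qed
    then have "finite {g b | g. g \<in> V}"
      using fi unfolding finite_index_def by (meson finite_imageI finite_subset)
    moreover have "{g b | g. g \<in> stab G F} \<subseteq> {g b | g. g \<in> V}" using F by blast
    ultimately show False using inf finite_subset by blast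
  qed
qed

text \<open>\<open>V\<close> is open because it contains the stabiliser of a finite set. The tuple
  supplied by weak elimination of imaginaries lies in every finite set whose stabiliser is contained
  in \<open>V\<close>, by \<open>support_subset\<close>, hence in
  \<open>F \<inter> F'\<close>.\<close>

lemma stab_Int_subset:
  assumes V: "is_subgroup V G" and F: "finite F" "stab G F \<subseteq> V" and F': "finite F'" "stab G F' \<subseteq> V"
  shows "stab G (F \<inter> F') \<subseteq> V"
proof (cases "V = G")
  case False
  have "pw_open G V"
    unfolding pw_open_def
  proof (intro conjI ballI)
    show "V \<subseteq> G" using V by (simp add: is_subgroup_def)
    fix g assume g: "g \<in> V"
    then have gG: "g \<in> G" using V by (auto simp: is_subgroup_def)
    have "h \<in> V" if "h \<in> G" "\<forall>a\<in>F. h a = g a" for h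
    proof -
      have "inv g \<circ> h \<in> stab G F"
        using that gG by (auto simp: stab_def intro!: comp_G inv_G)
      then have "g \<circ> (inv g \<circ> h) \<in> V"
        using g V F by (auto simp: is_subgroup_def)
      then show ?thesis using gG by (simp add: o_assoc)
    qed
    then show "\<exists>A. finite A \<and> {h \<in> G. \<forall>a\<in>A. h a = g a} \<subseteq> V" using F by blast
  qed
  with False wEI V obtain as where as: "stab G (set as) \<subseteq> V" "finite_index V (stab G (set as))"
    unfolding weak_EI_def by blast
  have "set as \<subseteq> F \<inter> F'" using support_subset[OF V as(2)] F F' by blast
  then show ?thesis using as(1) stab_mono by blast
qed (auto simp: stab_def)

text \<open>The stabiliser of the class of \<open>a\<close> contains both \<open>stab G {a}\<close>
  and \<open>stab G {b}\<close>. Two disjoint supports leave only the empty one, so it is all of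
  \<open>G\<close>, and by transitivity the class is everything.\<close>

lemma primitive:
  assumes E: "equivp E" and inv: "\<And>g a b. g \<in> G \<Longrightarrow> E a b \<Longrightarrow> E (g a) (g b)"
    and ab: "E a b" "a \<noteq> b"
  shows "E c d"
proof -
  define V where "V = {g \<in> G. E (g a) a}"
  have V: "is_subgroup V G"
    unfolding is_subgroup_def V_def
  proof (intro conjI ballI; clarsimp simp: id_G comp_G inv_G equivp_reflp[OF E])
    fix g h assume "g \<in> G" "E (g a) a" "h \<in> G" "E (h a) a"
    then show "E (g (h a)) a" using inv[of g "h a" a] E by (meson equivp_transp)
  next
    fix g assume g: "g \<in> G" "E (g a) a"
    then show "E (inv g a) a" using inv[of "inv g" "g a" a] inv_G E by (metis equivp_symp inv_apply)
  qed
  have "h \<in> V" if "h \<in> stab G {a}" for h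
    using that E by (auto simp: V_def stab_def equivp_reflp)
  moreover have "h \<in> V" if h: "h \<in> stab G {b}" for h
  proof -
    have "E (h a) (h b)" using inv h ab stab_G by blast
    then show ?thesis using h ab E by (auto simp: V_def stab_def) (meson equivp_symp equivp_transp)
  qed
  ultimately have "stab G ({a} \<inter> {b}) \<subseteq> V" by (intro stab_Int_subset[OF V]) auto
  then have "G \<subseteq> V" using ab by simp
  then have "E x a" for x
    using transitive[unfolded transitive_on_def, rule_format, of a x] unfolding V_def by auto
  then show ?thesis using E by (meson equivp_symp equivp_transp)
qed

end

lemma perm_group_Aut: "perm_group (Aut R)"
proof
  show "bij g" if "g \<in> Aut R" for g using that by (simp add: Aut_def)
  show "id \<in> Aut R" by (simp add: Aut_def)
  show "g \<circ> h \<in> Aut R" if "g \<in> Aut R" "h \<in> Aut R" for g h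
    using that by (auto simp: Aut_def bij_comp simp flip: map_map)
  show "inv g \<in> Aut R" if g: "g \<in> Aut R" for g
  proof -
    have b: "bij g" using g by (simp add: Aut_def)
    have "map g (map (inv g) xs) = xs" for xs
      using b by (simp add: bij_is_surj surj_f_inv_f map_idI)
    moreover have "xs \<in> R i \<longleftrightarrow> map g xs \<in> R i" for i xs using g by (simp add: Aut_def)
    ultimately have "xs \<in> R i \<longleftrightarrow> map (inv g) xs \<in> R i" for i xs by metis
    then show ?thesis using b by (simp add: Aut_def bij_imp_bij_inv)
  qed
qed

subsection \<open>Bounded functions on a probability space\<close>

lemma Ramsey_pairs_nat:
  fixes y :: "nat \<Rightarrow> nat \<Rightarrow> 'c"
  assumes "finite \<Phi>" "\<And>i j. y i j \<in> \<Phi>" "\<And>i j. y i j = y j i" "infinite Z"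
  obtains H e where "H \<subseteq> Z" "infinite H" "\<And>i j. i \<in> H \<Longrightarrow> j \<in> H \<Longrightarrow> i \<noteq> j \<Longrightarrow> y i j = e"
proof -
  obtain n and idx :: "'c \<Rightarrow> nat" where idx: "idx ` \<Phi> = {i. i < n}" "inj_on idx \<Phi>"
    using finite_imp_nat_seg_image_inj_on[OF \<open>finite \<Phi>\<close>]
    by (metis finite_imp_inj_to_nat_seg assms(1))
  \<comment> \<open>Ramsey's theorem colours two-element sets; since \<open>y\<close> is symmetric,
    reading it at the minimum and the maximum loses nothing.\<close>
  define f where "f X = idx (y (Min X) (Max X))" for X
  have f: "f {i, j} = idx (y i j)" for i j
    using assms(3)[of i j] by (auto simp: f_def min_def max_def)
  have "\<forall>i\<in>Z. \<forall>j\<in>Z. i \<noteq> j \<longrightarrow> f {i, j} < n"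
    using idx assms(2) unfolding f by blast
  from Ramsey2[OF \<open>infinite Z\<close> this] obtain H t where
    H: "H \<subseteq> Z" "infinite H" "\<forall>i\<in>H. \<forall>j\<in>H. i \<noteq> j \<longrightarrow> idx (y i j) = t"
    unfolding f by blast
  show ?thesis
  proof
    show "H \<subseteq> Z" "infinite H" by fact+
    show "y i j = inv_into \<Phi> idx t" if "i \<in> H" "j \<in> H" "i \<noteq> j" for i j
      using H(3) that idx(2) assms(2) by (metis inv_into_f_f)
  qed
qed

context prob_space
begin

text \<open>The bound holds at every point, not just almost everywhere, so that it survives
  composition with the action and no null sets have to be carried along.\<close>

definition bm :: "('a \<Rightarrow> real) \<Rightarrow> bool" where
  "bm f \<longleftrightarrow> f \<in> borel_measurable M \<and> (\<exists>K. \<forall>x. \<bar>f x\<bar> \<le> K)"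

lemma bmI: "f \<in> borel_measurable M \<Longrightarrow> (\<And>x. \<bar>f x\<bar> \<le> K) \<Longrightarrow> bm f"
  by (auto simp: bm_def)

lemma bm_meas [measurable_dest]: "bm f \<Longrightarrow> f \<in> borel_measurable M"
  by (simp add: bm_def)

lemma bm_integrable: "bm f \<Longrightarrow> integrable M f"
  unfolding bm_def using integrable_const_bound[of f] by (metis AE_I2 real_norm_def)

lemma bm_const: "bm (\<lambda>x. c)"
  by (auto simp: bm_def)

lemma bm_mult: assumes "bm f" "bm g" shows "bm (\<lambda>x. f x * g x)"
proof -
  obtain K L where "\<And>x. \<bar>f x\<bar> \<le> K" "\<And>x. \<bar>g x\<bar> \<le> L" using assms by (auto simp: bm_def)
  then have "\<bar>f x * g x\<bar> \<le> K * L" for x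
    by (simp add: abs_mult mult_mono' )
  then show ?thesis using assms by (intro bmI[where K="K * L"]) auto
qed

lemma bm_add: assumes "bm f" "bm g" shows "bm (\<lambda>x. f x + g x)"
proof -
  obtain K L where "\<And>x. \<bar>f x\<bar> \<le> K" "\<And>x. \<bar>g x\<bar> \<le> L" using assms by (auto simp: bm_def)
  then have "\<bar>f x + g x\<bar> \<le> K + L" for x
    using abs_triangle_ineq[of "f x" "g x"] by (smt (verit))
  then show ?thesis using assms by (intro bmI[where K="K + L"]) auto
qed

lemma bm_cmult: "bm f \<Longrightarrow> bm (\<lambda>x. c * f x)"
  by (rule bm_mult[OF bm_const])

lemma bm_diff: "bm f \<Longrightarrow> bm g \<Longrightarrow> bm (\<lambda>x. f x - g x)"
  using bm_add[OF _ bm_cmult[of g "-1"]] by simp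

lemma bm_sum: "(\<And>i. i \<in> S \<Longrightarrow> bm (f i)) \<Longrightarrow> bm (\<lambda>x. \<Sum>i\<in>S. f i x)"
  by (induction S rule: infinite_finite_induct) (auto intro: bm_add bm_const)

lemma bm_prod: "(\<And>i. i \<in> S \<Longrightarrow> bm (f i)) \<Longrightarrow> bm (\<lambda>x. \<Prod>i\<in>S. f i x)"
  by (induction S rule: infinite_finite_induct) (auto intro: bm_mult bm_const)

lemma bm_power2: "bm f \<Longrightarrow> bm (\<lambda>x. (f x)\<^sup>2)"
  using bm_mult[of f f] by (simp add: power2_eq_square)

lemmas bm_intros = bm_const bm_mult bm_add bm_cmult bm_diff bm_sum bm_power2

lemma square_integral_le: assumes "bm f" shows "(\<integral>x. f x \<partial>M)\<^sup>2 \<le> (\<integral>x. (f x)\<^sup>2 \<partial>M)"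
proof -
  have "0 \<le> (\<integral>x. (f x - (\<integral>x. f x \<partial>M))\<^sup>2 \<partial>M)" by simp
  also have "\<dots> = (\<integral>x. (f x)\<^sup>2 \<partial>M) - (\<integral>x. f x \<partial>M)\<^sup>2"
    using assms by (intro variance_eq) (auto intro: bm_integrable bm_intros)
  finally show ?thesis by simp
qed

lemma square_integral_mult_le:
  assumes "bm f" "bm g" "\<And>x. \<bar>g x\<bar> \<le> K"
  shows "(\<integral>x. f x * g x \<partial>M)\<^sup>2 \<le> K\<^sup>2 * (\<integral>x. (f x)\<^sup>2 \<partial>M)"
proof -
  have "(\<integral>x. f x * g x \<partial>M)\<^sup>2 \<le> (\<integral>x. (f x * g x)\<^sup>2 \<partial>M)"
    using assms by (intro square_integral_le bm_intros)
  also have "\<dots> \<le> (\<integral>x. K\<^sup>2 * (f x)\<^sup>2 \<partial>M)"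
  proof (rule integral_mono)
    fix x show "(f x * g x)\<^sup>2 \<le> K\<^sup>2 * (f x)\<^sup>2"
      using mult_right_mono[OF power_mono[OF assms(3), of x 2], of "(f x)\<^sup>2"]
      by (simp add: power_mult_distrib mult.commute)
  qed (use assms in \<open>auto intro!: bm_integrable bm_intros\<close>)
  finally show ?thesis by simp
qed

lemma integral_square_diff:
  assumes "bm f" "bm g"
  shows "(\<integral>x. (f x - g x)\<^sup>2 \<partial>M) = (\<integral>x. f x * f x \<partial>M) - 2 * (\<integral>x. f x * g x \<partial>M) + (\<integral>x. g x * g x \<partial>M)"
proof -
  have i: "integrable M (\<lambda>x. f x * f x)" "integrable M (\<lambda>x. f x * g x)" "integrable M (\<lambda>x. g x * g x)"
    using assms by (auto intro!: bm_integrable bm_mult)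
  have "(\<integral>x. (f x - g x)\<^sup>2 \<partial>M) = (\<integral>x. f x * f x - 2 * (f x * g x) + g x * g x \<partial>M)"
    by (rule Bochner_Integration.integral_cong) (auto simp: power2_eq_square algebra_simps)
  also have "\<dots> = (\<integral>x. f x * f x \<partial>M) - 2 * (\<integral>x. f x * g x \<partial>M) + (\<integral>x. g x * g x \<partial>M)"
    using i by simp
  finally show ?thesis .
qed

lemma AE_eq_of_integral_zero:
  assumes "bm f" "(\<integral>x. (f x)\<^sup>2 \<partial>M) = 0"
  shows "AE x in M. f x = 0"
proof -
  have "AE x in M. (f x)\<^sup>2 = 0"
    using integral_nonneg_eq_0_iff_AE[of M "\<lambda>x. (f x)\<^sup>2"] assms by (auto intro!: bm_integrable bm_intros)
  then show ?thesis by simp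
qed

text \<open>A summable sequence of increments in \<open>L\<^sup>1\<close>; \<open>L\<^sup>2\<close> bounds are turned into \<open>L\<^sup>1\<close> bounds by
  \<open>2\<bar>t\<bar> \<le> 2\<^sup>k t\<^sup>2 + 2\<^sup>-\<^sup>k\<close>.\<close>

lemma AE_convergent_of_L2_increments:
  fixes W :: "nat \<Rightarrow> 'a \<Rightarrow> real"
  assumes W: "\<And>k. bm (W k)" and C: "\<And>k. (\<integral>x. (W (Suc k) x - W k x)\<^sup>2 \<partial>M) \<le> C * (1/4) ^ k"
  shows "AE x in M. convergent (\<lambda>k. W k x)"
proof -
  have [measurable]: "W k \<in> borel_measurable M" for k using W by (rule bm_meas)
  have C0: "C \<ge> 0"
  proof -
    have "0 \<le> (\<integral>x. (W (Suc 0) x - W 0 x)\<^sup>2 \<partial>M)" by simp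
    also have "\<dots> \<le> C" using C[of 0] by simp
    finally show ?thesis .
  qed
  have L1: "(\<integral>x. \<bar>W (Suc k) x - W k x\<bar> \<partial>M) \<le> (C + 1) * (1/2) ^ k" for k
  proof -
    define D where "D x = W (Suc k) x - W k x" for x
    have D: "bm D" unfolding D_def using W by (intro bm_intros)
    have "(\<integral>x. \<bar>D x\<bar> \<partial>M) \<le> (\<integral>x. 2 ^ k * (D x)\<^sup>2 + (1/2) ^ k \<partial>M)"
    proof (rule integral_mono)
      show "integrable M (\<lambda>x. \<bar>D x\<bar>)" using D bm_integrable by auto
      show "integrable M (\<lambda>x. 2 ^ k * (D x)\<^sup>2 + (1/2) ^ k)" using D by (intro bm_integrable bm_intros)
      fix x
      define s :: real where "s = 2 ^ k"
      have s: "s > 0" "(1/2) ^ k = 1 / s" by (auto simp: s_def power_divide)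
      have "0 \<le> (s * \<bar>D x\<bar> - 1)\<^sup>2" by simp
      then have "2 * (s * \<bar>D x\<bar>) \<le> s\<^sup>2 * (D x)\<^sup>2 + 1" by (simp add: power2_eq_square algebra_simps)
      moreover have "s * \<bar>D x\<bar> \<ge> 0" using s by simp
      ultimately have "s * \<bar>D x\<bar> \<le> s\<^sup>2 * (D x)\<^sup>2 + 1" by linarith
      then have "\<bar>D x\<bar> \<le> (s\<^sup>2 * (D x)\<^sup>2 + 1) / s" using s by (simp add: field_simps)
      also have "\<dots> = s * (D x)\<^sup>2 + 1 / s" using s by (simp add: field_simps power2_eq_square)
      finally show "\<bar>D x\<bar> \<le> 2 ^ k * (D x)\<^sup>2 + (1/2) ^ k" unfolding s(2) by (simp add: s_def)
    qed
    also have "\<dots> = 2 ^ k * (\<integral>x. (D x)\<^sup>2 \<partial>M) + (1/2) ^ k"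
      using D by (subst Bochner_Integration.integral_add) (auto intro!: bm_integrable bm_intros simp: prob_space)
    also have "\<dots> \<le> 2 ^ k * (C * (1/4) ^ k) + (1/2) ^ k"
      using C[of k] unfolding D_def by (intro add_right_mono mult_left_mono) auto
    also have "\<dots> = (C + 1) * (1/2) ^ k"
    proof -
      have "2 ^ k * (1/4) ^ k = (1/2 :: real) ^ k" by (simp flip: power_mult_distrib)
      then show ?thesis by (simp add: algebra_simps)
    qed
    finally show ?thesis unfolding D_def .
  qed
  define N where "N k x = ennreal \<bar>W (Suc k) x - W k x\<bar>" for k x
  have [measurable]: "N k \<in> borel_measurable M" for k unfolding N_def by measurable
  have "(\<integral>\<^sup>+x. (\<Sum>k. N k x) \<partial>M) = (\<Sum>k. \<integral>\<^sup>+x. N k x \<partial>M)"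
    by (rule nn_integral_suminf) measurable
  also have "\<dots> \<le> (\<Sum>k. ennreal ((C + 1) * (1/2) ^ k))"
  proof (rule suminf_le)
    fix k show "(\<integral>\<^sup>+x. N k x \<partial>M) \<le> ennreal ((C + 1) * (1/2) ^ k)"
      unfolding N_def using L1[of k] W
      by (subst nn_integral_eq_integral) (auto intro!: ennreal_leI bm_integrable bm_intros integrable_abs)
  qed auto
  also have "\<dots> = ennreal (\<Sum>k. (C + 1) * (1/2) ^ k)"
    using C0 by (intro suminf_ennreal2) (auto intro!: summable_mult summable_geometric)
  also have "\<dots> < \<infinity>" by simp
  finally have "(\<integral>\<^sup>+x. (\<Sum>k. N k x) \<partial>M) \<noteq> \<infinity>" by simp
  then have "AE x in M. (\<Sum>k. N k x) \<noteq> \<infinity>"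
    by (intro nn_integral_PInf_AE) measurable
  then show ?thesis
  proof eventually_elim
    case (elim x)
    then have "summable (\<lambda>k. \<bar>W (Suc k) x - W k x\<bar>)"
      unfolding N_def by (intro summable_suminf_not_top) auto
    then have "summable (\<lambda>k. W (Suc k) x - W k x)" by (rule summable_rabs_cancel)
    then have "convergent (\<lambda>n. \<Sum>k<n. W (Suc k) x - W k x)" by (simp add: summable_iff_convergent)
    then have "convergent (\<lambda>n. W n x - W 0 x)"
      by (simp add: sum_lessThan_telescope[of "\<lambda>k. W k x"])
    from convergent_add[OF this convergent_const[of "W 0 x"]]
    show ?case by simp
  qed
qed

end

subsection \<open>Families with constant correlations\<close>

text \<open>A sequence with constant Gram matrix: \<open>q\<close> on the diagonal and
  \<open>c\<close> off it. Inner products between averages over nested index sets can then be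
  computed exactly, so explicit rates take the place of weak compactness.\<close>

locale equicorrelated = prob_space M for M :: "'x measure" +
  fixes v :: "nat \<Rightarrow> 'x \<Rightarrow> real" and K c q :: real
  assumes v_meas [measurable]: "\<And>i. v i \<in> borel_measurable M"
    and v_bound: "\<And>i x. \<bar>v i x\<bar> \<le> K"
    and corr: "\<And>i j. i \<noteq> j \<Longrightarrow> (\<integral>x. v i x * v j x \<partial>M) = c"
    and norm: "\<And>i. (\<integral>x. v i x * v i x \<partial>M) = q"
begin

definition avg :: "nat set \<Rightarrow> 'x \<Rightarrow> real" where
  "avg S x = (\<Sum>i\<in>S. v i x) / card S"

lemma bm_v: "bm (v i)"
  using v_meas v_bound by (rule bmI)

lemma avg_eq: "avg S = (\<lambda>x. (1 / card S) * (\<Sum>i\<in>S. v i x))"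
  by (simp add: avg_def fun_eq_iff)

lemma bm_avg: "bm (avg S)"
  unfolding avg_eq by (intro bm_intros bm_v)

lemma K_nonneg: "K \<ge> 0"
  using v_bound[of 0 undefined] by linarith

lemma avg_bound: "\<bar>avg S x\<bar> \<le> K"
proof (cases "card S = 0")
  case False
  have "\<bar>\<Sum>i\<in>S. v i x\<bar> \<le> (\<Sum>i\<in>S. \<bar>v i x\<bar>)" by (rule sum_abs)
  also have "\<dots> \<le> (\<Sum>i\<in>S. K)" by (rule sum_mono) (rule v_bound)
  finally show ?thesis using False by (simp add: avg_def field_simps)
qed (simp add: avg_def K_nonneg)

lemma integral_avg_mult:
  assumes "bm w"
  shows "(\<integral>x. avg S x * w x \<partial>M) = (\<Sum>i\<in>S. \<integral>x. v i x * w x \<partial>M) / card S"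
proof -
  have "(\<integral>x. avg S x * w x \<partial>M) = (\<integral>x. (1 / card S) * (\<Sum>i\<in>S. v i x * w x) \<partial>M)"
    by (simp add: avg_def sum_distrib_right)
  also have "\<dots> = (1 / card S) * (\<Sum>i\<in>S. \<integral>x. v i x * w x \<partial>M)"
    using assms by (subst integral_mult_right_zero, subst Bochner_Integration.integral_sum)
      (auto intro!: bm_integrable bm_intros bm_v)
  finally show ?thesis by simp
qed

lemma integral_v_avg:
  assumes "finite S" "S \<noteq> {}"
  shows "(\<integral>x. v i x * avg S x \<partial>M) = c + (if i \<in> S then (q - c) / card S else 0)"
proof -
  have n: "real (card S) > 0" using assms by (simp add: card_gt_0_iff)
  have "(\<integral>x. v i x * avg S x \<partial>M) = (\<Sum>j\<in>S. \<integral>x. v j x * v i x \<partial>M) / card S"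
    using integral_avg_mult[OF bm_v, of S i] by (simp add: mult.commute)
  also have "(\<Sum>j\<in>S. \<integral>x. v j x * v i x \<partial>M) = (\<Sum>j\<in>S. c + (if j = i then q - c else 0))"
    by (rule sum.cong) (auto simp: corr norm)
  also have "\<dots> = card S * c + (if i \<in> S then q - c else 0)"
    using assms by (simp add: sum.distrib)
  finally show ?thesis using n by (auto simp: field_simps)
qed

lemma integral_avg_avg:
  assumes "finite S" "S \<noteq> {}" "finite S'" "S \<subseteq> S'"
  shows "(\<integral>x. avg S x * avg S' x \<partial>M) = c + (q - c) / card S'"
proof -
  have n: "real (card S) > 0" using assms by (simp add: card_gt_0_iff)
  have "(\<integral>x. avg S x * avg S' x \<partial>M) = (\<Sum>i\<in>S. c + (q - c) / card S') / card S"
  proof (subst integral_avg_mult[OF bm_avg], intro arg_cong2[where f="(/)"] sum.cong refl)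
    fix i assume "i \<in> S"
    then show "(\<integral>x. v i x * avg S' x \<partial>M) = c + (q - c) / card S'"
      using assms by (subst integral_v_avg) auto
  qed
  then show ?thesis using n by simp
qed

lemma ex_limit:
  obtains u where "u \<in> borel_measurable M" "\<And>x. \<bar>u x\<bar> \<le> K"
    "\<And>i. (\<integral>x. v i x * u x \<partial>M) = c" "(\<integral>x. u x * u x \<partial>M) = c"
proof -
  \<comment> \<open>Block lengths \<open>4 ^ k\<close> give squared increments of order
    \<open>(1/4) ^ k\<close>, the rate that \<open>AE_convergent_of_L2_increments\<close> asks
    for.\<close>
  define W where "W k = avg {..<4 ^ k}" for k :: nat
  have W: "bm (W k)" for k unfolding W_def by (rule bm_avg)
  then have [measurable]: "W k \<in> borel_measurable M" for k by (rule bm_meas)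
  have Wb: "\<bar>W k x\<bar> \<le> K" for k x unfolding W_def by (rule avg_bound)
  have ne: "{..<4 ^ k} \<noteq> ({} :: nat set)" for k using lessThan_empty_iff by force
  have WW: "(\<integral>x. W k x * W l x \<partial>M) = c + (q - c) * (1/4) ^ l" if "k \<le> l" for k l
    unfolding W_def using that ne
    by (subst integral_avg_avg) (auto simp: power_one_over field_simps)
  have "AE x in M. convergent (\<lambda>k. W k x)"
  proof (rule AE_convergent_of_L2_increments[OF W])
    fix k
    have "(\<integral>x. (W (Suc k) x - W k x)\<^sup>2 \<partial>M) = (\<integral>x. (W k x - W (Suc k) x)\<^sup>2 \<partial>M)"
      by (simp add: power2_commute)
    also have "\<dots> = (\<integral>x. W k x * W k x \<partial>M) - 2 * (\<integral>x. W k x * W (Suc k) x \<partial>M)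
        + (\<integral>x. W (Suc k) x * W (Suc k) x \<partial>M)"
      using W by (intro integral_square_diff)
    also have "\<dots> = (q - c) * (1/4) ^ k - (q - c) * (1/4) ^ Suc k"
      by (subst (1 2 3) WW) auto
    also have "\<dots> \<le> \<bar>q - c\<bar> * (1/4) ^ k"
    proof -
      have "(q - c) * (1/4) ^ k - (q - c) * (1/4) ^ Suc k = (q - c) * (3/4 * (1/4) ^ k)" by simp
      also have "\<dots> \<le> \<bar>q - c\<bar> * (3/4 * (1/4) ^ k)" by (intro mult_right_mono) auto
      also have "\<dots> \<le> \<bar>q - c\<bar> * (1/4) ^ k" by (intro mult_left_mono) auto
      finally show ?thesis .
    qed
    finally show "(\<integral>x. (W (Suc k) x - W k x)\<^sup>2 \<partial>M) \<le> \<bar>q - c\<bar> * (1/4) ^ k" .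
  qed
  \<comment> \<open>Truncation changes the limit only on a null set, but gives the bound
    \<open>K\<close> at every point, including those where there is no limit.\<close>
  define u where "u x = max (- K) (min K (lim (\<lambda>k. W k x)))" for x
  have [measurable]: "(\<lambda>x. lim (\<lambda>k. W k x)) \<in> borel_measurable M"
    by (rule borel_measurable_lim_metric) measurable
  have u [measurable]: "u \<in> borel_measurable M" unfolding u_def by measurable
  have ub: "\<bar>u x\<bar> \<le> K" for x using K_nonneg by (auto simp: u_def)
  have lim: "AE x in M. (\<lambda>k. W k x) \<longlonglongrightarrow> u x"
    using \<open>AE x in M. convergent (\<lambda>k. W k x)\<close>
  proof eventually_elim
    case (elim x)
    then have l: "(\<lambda>k. W k x) \<longlonglongrightarrow> lim (\<lambda>k. W k x)" by (simp add: convergent_LIMSEQ_iff)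
    have "lim (\<lambda>k. W k x) \<le> K" by (rule LIMSEQ_le_const2[OF l]) (use Wb in \<open>auto simp: abs_le_iff\<close>)
    moreover have "- K \<le> lim (\<lambda>k. W k x)"
      by (rule LIMSEQ_le_const[OF l]) (use Wb in \<open>auto simp: abs_le_iff minus_le_iff\<close>)
    ultimately show ?case using l by (simp add: u_def)
  qed
  have KK: "\<bar>a * b\<bar> \<le> K * K" if "\<bar>a\<bar> \<le> K" "\<bar>b\<bar> \<le> K" for a b
    using that K_nonneg by (simp add: abs_mult mult_mono)
  have pow0: "(\<lambda>k. (1/4) ^ k) \<longlonglongrightarrow> (0 :: real)" by (rule LIMSEQ_power_zero) auto
  show ?thesis
  proof
    show "u \<in> borel_measurable M" "\<And>x. \<bar>u x\<bar> \<le> K" using u ub by auto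
    fix i
    have "(\<lambda>k. \<integral>x. v i x * W k x \<partial>M) \<longlonglongrightarrow> (\<integral>x. v i x * u x \<partial>M)"
      by (rule integral_dominated_convergence[where w="\<lambda>_. K * K"])
        (use lim in \<open>auto elim!: eventually_mono intro!: tendsto_intros\<close>,
         use v_bound Wb KK in auto)
    moreover have "(\<lambda>k. \<integral>x. v i x * W k x \<partial>M) \<longlonglongrightarrow> c"
    proof (rule tendsto_sandwich)
      show "\<forall>\<^sub>F k in sequentially. c - \<bar>q - c\<bar> * (1/4) ^ k \<le> (\<integral>x. v i x * W k x \<partial>M)"
        unfolding W_def using ne
        by (intro always_eventually allI, subst integral_v_avg)
          (auto simp: power_one_over field_simps abs_if)
      show "\<forall>\<^sub>F k in sequentially. (\<integral>x. v i x * W k x \<partial>M) \<le> c + \<bar>q - c\<bar> * (1/4) ^ k"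
        unfolding W_def using ne
        by (intro always_eventually allI, subst integral_v_avg)
          (auto simp: power_one_over field_simps abs_if)
      show "(\<lambda>k. c - \<bar>q - c\<bar> * (1/4) ^ k) \<longlonglongrightarrow> c"
        using tendsto_diff[OF tendsto_const tendsto_mult_left[OF pow0, of "\<bar>q - c\<bar>"], of c] by simp
      show "(\<lambda>k. c + \<bar>q - c\<bar> * (1/4) ^ k) \<longlonglongrightarrow> c"
        using tendsto_add[OF tendsto_const tendsto_mult_left[OF pow0, of "\<bar>q - c\<bar>"], of c] by simp
    qed
    ultimately show "(\<integral>x. v i x * u x \<partial>M) = c" using LIMSEQ_unique by blast
  next
    have "(\<lambda>k. \<integral>x. W k x * W k x \<partial>M) \<longlonglongrightarrow> (\<integral>x. u x * u x \<partial>M)"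
    proof (rule integral_dominated_convergence[where w="\<lambda>_. K * K"])
      show "AE x in M. (\<lambda>k. W k x * W k x) \<longlonglongrightarrow> u x * u x"
        using lim by eventually_elim (intro tendsto_mult)
      show "AE x in M. norm (W k x * W k x) \<le> K * K" for k
        by (intro AE_I2) (simp only: real_norm_def KK[OF Wb Wb])
    qed auto
    moreover have "(\<lambda>k. \<integral>x. W k x * W k x \<partial>M) \<longlonglongrightarrow> c"
      using tendsto_add[OF tendsto_const tendsto_mult_left[OF pow0, of "q - c"], of c] by (simp add: WW)
    ultimately show "(\<integral>x. u x * u x \<partial>M) = c" using LIMSEQ_unique by blast
  qed
qed

text \<open>The limit is found along initial segments, but the average over any finite index set
  approximates it, at a rate depending only on the size. This permits averaging over a Ramsey subset
  in \<open>limit_correlations\<close> and over disjoint blocks in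
  \<open>orthogonal\<close>.\<close>

lemma integral_avg_limit:
  assumes u: "bm u" "\<And>i. (\<integral>x. v i x * u x \<partial>M) = c" "(\<integral>x. u x * u x \<partial>M) = c"
    and S: "finite S" "S \<noteq> {}"
  shows "(\<integral>x. (avg S x - u x)\<^sup>2 \<partial>M) = (q - c) / card S"
proof -
  have "(\<integral>x. (avg S x - u x)\<^sup>2 \<partial>M) =
      (\<integral>x. avg S x * avg S x \<partial>M) - 2 * (\<integral>x. avg S x * u x \<partial>M) + (\<integral>x. u x * u x \<partial>M)"
    using u(1) by (intro integral_square_diff bm_avg)
  also have "\<dots> = (q - c) / card S"
    using S u by (simp add: integral_avg_avg integral_avg_mult)
  finally show ?thesis .
qed

end

subsection \<open>Invariant sigma-algebras of a measure-preserving action\<close>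

locale pmp_action = tame_group G + prob_space M
  for G :: "('a \<Rightarrow> 'a) set" and M :: "'x measure" +
  fixes T :: "('a \<Rightarrow> 'a) \<Rightarrow> 'x \<Rightarrow> 'x"
  assumes T_meas: "g \<in> G \<Longrightarrow> T g \<in> measurable M M"
    and T_distr: "g \<in> G \<Longrightarrow> distr M M (T g) = M"
    and T_comp: "g \<in> G \<Longrightarrow> h \<in> G \<Longrightarrow> x \<in> space M \<Longrightarrow> T (g \<circ> h) x = T g (T h x)"
    and T_id: "x \<in> space M \<Longrightarrow> T id x = x"
begin

lemma T_space: "g \<in> G \<Longrightarrow> x \<in> space M \<Longrightarrow> T g x \<in> space M"
  using T_meas measurable_space by metis

lemma T_inv: "g \<in> G \<Longrightarrow> x \<in> space M \<Longrightarrow> T (inv g) (T g x) = x"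
  "g \<in> G \<Longrightarrow> x \<in> space M \<Longrightarrow> T g (T (inv g) x) = x"
  using T_comp[of "inv g" g x] T_comp[of g "inv g" x] inv_G T_id by auto

lemma AE_T:
  assumes "g \<in> G" "AE x in M. P x"
  shows "AE x in M. P (T g x)"
proof -
  have "AE x in distr M M (T g). P x" unfolding T_distr[OF assms(1)] by (rule assms(2))
  then show ?thesis by (rule AE_distrD[OF T_meas[OF assms(1)]])
qed

lemma meas_T: "g \<in> G \<Longrightarrow> f \<in> measurable M N \<Longrightarrow> (\<lambda>x. f (T g x)) \<in> measurable M N"
  using measurable_compose[OF T_meas] by blast

lemma bm_T: "bm f \<Longrightarrow> g \<in> G \<Longrightarrow> bm (\<lambda>x. f (T g x))"
  by (auto simp: bm_def meas_T)

lemma integral_T: "g \<in> G \<Longrightarrow> f \<in> borel_measurable M \<Longrightarrow> (\<integral>x. f (T g x) \<partial>M :: real) = (\<integral>x. f x \<partial>M)"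
  using integral_distr[OF T_meas, of g f] T_distr by simp

text \<open>The null set may depend on \<open>g\<close>. As \<open>G\<close> can be uncountable,
  this is weaker than invariance off a single null set; it is the form of invariance that L^2
  arguments deliver.\<close>

definition invf :: "'a set \<Rightarrow> ('x \<Rightarrow> 'b) \<Rightarrow> bool" where
  "invf A f \<longleftrightarrow> (\<forall>g\<in>stab G A. AE x in M. f (T g x) = f x)"

definition F :: "'a set \<Rightarrow> 'x measure" where
  "F A = sigma (space M) {E \<in> sets M. invf A (\<lambda>x. x \<in> E)}"

abbreviation cexp :: "'a set \<Rightarrow> ('x \<Rightarrow> real) \<Rightarrow> 'x \<Rightarrow> real" where
  "cexp A \<equiv> real_cond_exp M (F A)"

lemma invfD: "invf A f \<Longrightarrow> g \<in> stab G A \<Longrightarrow> AE x in M. f (T g x) = f x"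
  by (simp add: invf_def)

lemma invf_mono: "invf A f \<Longrightarrow> A \<subseteq> B \<Longrightarrow> invf B f"
  unfolding invf_def using stab_mono[of A B] by blast

lemma space_F [simp]: "space (F A) = space M"
  unfolding F_def by (rule space_measure_of) (auto dest: sets.sets_into_space)

lemma sets_F: "sets (F A) = {E \<in> sets M. invf A (\<lambda>x. x \<in> E)}" (is "_ = ?S")
proof -
  have "sigma_algebra (space M) ?S"
  proof (rule sigma_algebra_iff2[THEN iffD2], intro conjI ballI allI impI)
    show "?S \<subseteq> Pow (space M)" using sets.sets_into_space by auto
    show "{} \<in> ?S" by (auto simp: invf_def)
    show "space M - E \<in> ?S" if "E \<in> ?S" for E
    proof -
      have "AE x in M. (T g x \<in> space M - E) = (x \<in> space M - E)" if g: "g \<in> stab G A" for g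
        using invfD[OF _ g, of "\<lambda>x. x \<in> E"] \<open>E \<in> ?S\<close> AE_space
        by (auto elim!: AE_mp intro!: AE_I2 simp: T_space[OF stab_G[OF g]])
      then show ?thesis using that by (auto simp: invf_def)
    qed
    show "(\<Union>i. E i) \<in> ?S" if E: "range E \<subseteq> ?S" for E :: "nat \<Rightarrow> 'x set"
    proof -
      have "AE x in M. (T g x \<in> (\<Union>i. E i)) = (x \<in> (\<Union>i. E i))" if g: "g \<in> stab G A" for g
      proof -
        have "AE x in M. \<forall>i. (T g x \<in> E i) = (x \<in> E i)"
          unfolding AE_all_countable using E g by (auto dest: invfD)
        then show ?thesis by eventually_elim auto
      qed
      then show ?thesis using E by (auto simp: invf_def)
    qed
  qed
  then show ?thesis unfolding F_def by (rule sigma_algebra.sets_measure_of_eq)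
qed

lemma subalg_F: "subalgebra M (F A)"
  by (auto simp: subalgebra_def sets_F)

lemma sfs: "sigma_finite_subalgebra M (F A)"
  by (intro finite_measure_subalgebra_is_sigma_finite finite_measure_subalgebra.intro
      finite_measure_subalgebra_axioms.intro subalg_F finite_measure_axioms)

lemma meas_FI:
  assumes "f \<in> measurable M N" "invf A f"
  shows "f \<in> measurable (F A) N"
proof (rule measurableI)
  show "f x \<in> space N" if "x \<in> space (F A)" for x using that measurable_space[OF assms(1)] by simp
  fix B assume B: "B \<in> sets N"
  have "AE x in M. (T g x \<in> f -` B \<inter> space M) = (x \<in> f -` B \<inter> space M)" if g: "g \<in> stab G A" for g
    using invfD[OF assms(2) g] AE_space
    by eventually_elim (auto simp: T_space[OF stab_G[OF g]])
  then have "invf A (\<lambda>x. x \<in> f -` B \<inter> space M)" unfolding invf_def by blast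
  then show "f -` B \<inter> space (F A) \<in> sets (F A)"
    using measurable_sets[OF assms(1) B] unfolding sets_F space_F by blast
qed

lemma meas_F_M: "f \<in> measurable (F A) N \<Longrightarrow> f \<in> measurable M N"
  using measurable_from_subalg[OF subalg_F] .

lemma F_mono: "A \<subseteq> B \<Longrightarrow> sets (F A) \<subseteq> sets (F B)"
  by (auto simp: sets_F intro: invf_mono)

lemma meas_F_mono: "f \<in> measurable (F A) N \<Longrightarrow> A \<subseteq> B \<Longrightarrow> f \<in> measurable (F B) N"
  using F_mono[of A B] by (auto simp: measurable_def)

text \<open>Countably many rational sublevel sets separate the values of a real function, so for a
  fixed \<open>g\<close> their exceptional sets can be united.\<close>

lemma invf_of_meas:
  fixes f :: "'x \<Rightarrow> real"
  assumes "f \<in> borel_measurable (F A)"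
  shows "invf A f"
  unfolding invf_def
proof
  fix g assume g: "g \<in> stab G A"
  have "AE x in M. \<forall>r::rat. (f (T g x) < real_of_rat r) = (f x < real_of_rat r)"
    unfolding AE_all_countable
  proof
    fix r :: rat
    have "{x \<in> space (F A). f x < real_of_rat r} \<in> sets (F A)" using assms by measurable
    then have "AE x in M. (T g x \<in> {x \<in> space M. f x < real_of_rat r}) = (x \<in> {x \<in> space M. f x < real_of_rat r})"
      using g by (auto simp: sets_F dest: invfD)
    then show "AE x in M. (f (T g x) < real_of_rat r) = (f x < real_of_rat r)"
      using AE_space by eventually_elim (auto simp: T_space[OF stab_G[OF g]])
  qed
  then show "AE x in M. f (T g x) = f x"
  proof eventually_elim
    case (elim x)
    show ?case
    proof (rule ccontr)
      assume "f (T g x) \<noteq> f x"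
      then obtain r where "f (T g x) < real_of_rat r \<and> real_of_rat r < f x \<or> f x < real_of_rat r \<and> real_of_rat r < f (T g x)"
        using of_rat_dense by (metis linorder_neqE_linordered_idom)
      then show False using elim by (meson less_asym order_less_trans)
    qed
  qed
qed

lemma invf_comp_T:
  assumes g: "g \<in> G" and f: "invf (g ` A) f"
  shows "invf A (\<lambda>x. f (T g x))"
  unfolding invf_def
proof
  fix h assume h: "h \<in> stab G A"
  have hG: "h \<in> G" using h stab_G by blast
  let ?k = "g \<circ> h \<circ> inv g"
  have k: "?k \<in> stab G (g ` A)" using conj_stab g h by blast
  have "AE x in M. f (T ?k (T g x)) = f (T g x)"
    by (rule AE_T[OF g]) (rule invfD[OF f k])
  then show "AE x in M. f (T g (T h x)) = f (T g x)"
    using AE_space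
  proof eventually_elim
    case (elim x)
    have "T ?k (T g x) = T (?k \<circ> g) x" using elim g stab_G[OF k] by (simp add: T_comp)
    also have "?k \<circ> g = g \<circ> h" using g by (simp add: fun_eq_iff)
    also have "T (g \<circ> h) x = T g (T h x)" using elim g hG by (simp add: T_comp)
    finally have "T ?k (T g x) = T g (T h x)" .
    then show ?case using elim(1) by (simp only:)
  qed
qed

text \<open>The correlation depends only on the double coset of \<open>g\<close> modulo \<open>stab G B\<close>, and by
  categoricity there are finitely many of those.\<close>

lemma finite_correlations:
  assumes B: "finite B" and f: "bm f" "invf B f"
  shows "finite {\<integral>x. f (T g x) * f x \<partial>M | g. g \<in> G}"
proof -
  obtain bs where bs: "set bs = B" using finite_list[OF B] by blast
  define \<phi> where "\<phi> g = (\<integral>x. f (T g x) * f x \<partial>M)" for g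
  define orb where "orb g = tuple_orbit G (bs @ map g bs)" for g
  have fm [measurable]: "f \<in> borel_measurable M" using f bm_meas by blast
  have eq: "\<phi> g = \<phi> g'" if g: "g \<in> G" "g' \<in> G" and o: "orb g = orb g'" for g g'
  proof -
    obtain k where k: "k \<in> G" "map k (bs @ map g bs) = bs @ map g' bs"
      using o unfolding orb_def tuple_orbit_eq_iff by blast
    have "map k bs = map id bs" "map (k \<circ> g) bs = map g' bs" using k(2) by auto
    then have kb: "k b = b" "k (g b) = g' b" if "b \<in> B" for b
      unfolding map_eq_conv using that bs by auto
    have ks: "k \<in> stab G B" using k kb by (auto simp: stab_def)
    \<comment> \<open>This \<open>l\<close> completes an equality of double cosets:
      \<open>g' \<circ> l = k \<circ> g\<close> with \<open>k\<close> and \<open>l\<close> in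
      \<open>stab G B\<close>, and \<open>f\<close> absorbs both.\<close>
    define l where "l = inv g' \<circ> (k \<circ> g)"
    have lG: "l \<in> G" unfolding l_def using g k by (intro comp_G inv_G)
    have l: "l \<in> stab G B" using kb lG g by (auto simp: l_def stab_def inv_eq_iff_G)
    have kg: "g' \<circ> l = k \<circ> g" using g by (simp add: l_def fun_eq_iff apply_inv[OF g(2)])
    have "\<phi> g' = (\<integral>x. f (T g' (T l x)) * f (T l x) \<partial>M)"
      unfolding \<phi>_def by (rule integral_T[symmetric, OF lG]) (use g in \<open>auto intro!: borel_measurable_times meas_T\<close>)
    also have "\<dots> = \<phi> g" unfolding \<phi>_def
    proof (rule integral_cong_AE)
      have "AE x in M. f (T k (T g x)) = f (T g x)"
        by (rule AE_T[OF g(1)]) (rule invfD[OF f(2) ks])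
      then show "AE x in M. f (T g' (T l x)) * f (T l x) = f (T g x) * f x"
        using invfD[OF f(2) l] AE_space
      proof eventually_elim
        case (elim x)
        have "T g' (T l x) = T (g' \<circ> l) x" using elim g lG by (simp add: T_comp)
        also have "\<dots> = T k (T g x)" unfolding kg using elim g k by (simp add: T_comp)
        finally show ?case using elim by simp
      qed
    qed (use g lG in \<open>auto intro!: borel_measurable_times meas_T\<close>)
    finally show ?thesis by simp
  qed
  have "finite (orb ` G)"
  proof (rule finite_subset)
    show "orb ` G \<subseteq> tuple_orbit G ` {xs. length xs = 2 * length bs}" by (auto simp: orb_def)
    show "finite (tuple_orbit G ` {xs. length xs = 2 * length bs})"
      using categorical by (simp add: aleph0_categorical_def)
  qed
  moreover have "\<phi> ` G \<subseteq> (\<lambda>c. \<phi> (SOME g. g \<in> G \<and> orb g = c)) ` (orb ` G)"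
  proof
    fix y assume "y \<in> \<phi> ` G"
    then obtain g where g: "g \<in> G" "y = \<phi> g" by blast
    have "(SOME h. h \<in> G \<and> orb h = orb g) \<in> G \<and> orb (SOME h. h \<in> G \<and> orb h = orb g) = orb g"
      by (rule someI[of _ g]) (use g in auto)
    then have "y = \<phi> (SOME h. h \<in> G \<and> orb h = orb g)" using eq g by metis
    then show "y \<in> (\<lambda>c. \<phi> (SOME g. g \<in> G \<and> orb g = c)) ` (orb ` G)" using g by blast
  qed
  ultimately have "finite (\<phi> ` G)" by (meson finite_imageI finite_subset)
  moreover have "{\<integral>x. f (T g x) * f x \<partial>M | g. g \<in> G} = \<phi> ` G" by (auto simp: \<phi>_def)
  ultimately show ?thesis by simp
qed

end

lemma tendsto_zero_of_square_le:
  fixes a :: "nat \<Rightarrow> real"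
  assumes "\<And>n. n > 0 \<Longrightarrow> (a n)\<^sup>2 \<le> C / real n"
  shows "a \<longlonglongrightarrow> 0"
proof -
  have "(\<lambda>n. (a n)\<^sup>2) \<longlonglongrightarrow> 0"
  proof (rule tendsto_sandwich[where f="\<lambda>_. 0" and h="\<lambda>n. C / real n"])
    show "\<forall>\<^sub>F n in sequentially. (a n)\<^sup>2 \<le> C / real n"
      using assms by (intro eventually_sequentiallyI[of 1]) auto
    show "(\<lambda>n. C / real n) \<longlonglongrightarrow> 0" by (rule lim_const_over_n)
  qed auto
  then have "(\<lambda>n. sqrt ((a n)\<^sup>2)) \<longlonglongrightarrow> sqrt 0" by (rule tendsto_real_sqrt)
  then show ?thesis by (simp add: tendsto_rabs_zero_iff)
qed

subsection \<open>Orthogonality of invariant functions\<close>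

context pmp_action
begin

lemma integral_T_shift:
  fixes f w :: "'x \<Rightarrow> real"
  assumes g: "g \<in> G" and fw: "f \<in> borel_measurable M" "w \<in> borel_measurable M"
  shows "(\<integral>x. f (T (inv g) x) * w x \<partial>M) = (\<integral>x. f x * w (T g x) \<partial>M)"
proof -
  have "(\<integral>x. f (T (inv g) x) * w x \<partial>M) = (\<integral>x. f (T (inv g) (T g x)) * w (T g x) \<partial>M)"
    by (rule integral_T[symmetric, OF g]) (use fw inv_G[OF g] in \<open>auto intro!: borel_measurable_times meas_T\<close>)
  also have "\<dots> = (\<integral>x. f x * w (T g x) \<partial>M)"
    by (rule Bochner_Integration.integral_cong) (auto simp: T_inv g)
  finally show ?thesis .
qed

lemma correlation_shift:
  fixes f :: "'x \<Rightarrow> real"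
  assumes ab: "a \<in> G" "b \<in> G" and f: "f \<in> borel_measurable M"
  shows "(\<integral>x. f (T a x) * f (T b x) \<partial>M) = (\<integral>x. f (T (a \<circ> inv b) x) * f x \<partial>M)"
proof -
  have "(\<integral>x. f (T a x) * f (T b x) \<partial>M) = (\<integral>x. f (T a (T (inv b) x)) * f (T b (T (inv b) x)) \<partial>M)"
    by (rule integral_T[symmetric, OF inv_G[OF ab(2)]])
      (use f ab in \<open>auto intro!: borel_measurable_times meas_T\<close>)
  also have "\<dots> = (\<integral>x. f (T (a \<circ> inv b) x) * f x \<partial>M)"
    by (rule Bochner_Integration.integral_cong) (auto simp: T_inv ab inv_G T_comp)
  finally show ?thesis .
qed

lemma invf_sum:
  assumes "finite S" "\<And>i. i \<in> S \<Longrightarrow> invf A (f i :: 'x \<Rightarrow> real)"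
  shows "invf A (\<lambda>x. \<Sum>i\<in>S. f i x)"
  unfolding invf_def
proof
  fix g assume g: "g \<in> stab G A"
  have "AE x in M. \<forall>i\<in>S. f i (T g x) = f i x"
    using assms g by (intro AE_finite_allI) (auto dest: invfD)
  then show "AE x in M. (\<Sum>i\<in>S. f i (T g x)) = (\<Sum>i\<in>S. f i x)"
    by eventually_elim (auto intro: sum.cong)
qed

text \<open>Along a subset on which the symmetrised correlations are constant, the correlations of the
  averages converge to half of that constant.\<close>

lemma limit_correlations:
  assumes eq: "equicorrelated M v K c q"
    and u: "bm u" "\<And>x. \<bar>u x\<bar> \<le> K" "\<And>i. (\<integral>x. v i x * u x \<partial>M) = c" "(\<integral>x. u x * u x \<partial>M) = c"
    and g: "g \<in> G" and \<Phi>: "finite \<Phi>" "\<And>i j. (\<integral>x. v i (T g x) * v j x \<partial>M) \<in> \<Phi>"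
  shows "(\<integral>x. u (T g x) * u x \<partial>M) \<in> (\<lambda>(a, b). (a + b) / 2) ` (\<Phi> \<times> \<Phi>)"
proof -
  interpret equicorrelated M v K c q by fact
  define z where "z i j = (\<integral>x. v i (T g x) * v j x \<partial>M)" for i j
  \<comment> \<open>\<open>z\<close> need not be symmetric, whereas Ramsey's theorem needs a
    symmetric colouring. Symmetrising costs only a factor 2, because the full double sums of
    \<open>z i j\<close> and \<open>z j i\<close> coincide.\<close>
  define y where "y i j = z i j + z j i" for i j
  define \<Psi> where "\<Psi> = (\<lambda>(a, b). a + b) ` (\<Phi> \<times> \<Phi>)"
  have \<Psi>: "finite \<Psi>" using \<Phi> by (simp add: \<Psi>_def)
  have y\<Psi>: "y i j \<in> \<Psi>" for i j using \<Phi>(2) by (force simp: \<Psi>_def y_def z_def)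
  have ysym: "y i j = y j i" for i j by (simp add: y_def)
  obtain H e where H: "infinite (H :: nat set)" "\<And>i j. i \<in> H \<Longrightarrow> j \<in> H \<Longrightarrow> i \<noteq> j \<Longrightarrow> y i j = e"
    using Ramsey_pairs_nat[where y=y and Z=UNIV, OF \<Psi> y\<Psi> ysym] by (metis infinite_UNIV_nat)
  define S where "S n = enumerate H ` {..<n}" for n
  have SH: "S n \<subseteq> H" for n using H enumerate_in_set by (auto simp: S_def)
  have Scard: "card (S n) = n" for n
    unfolding S_def by (subst card_image) (auto intro: inj_on_subset[OF inj_enumerate[OF H(1)]])
  have Sfin: "finite (S n)" for n by (simp add: S_def)
  define L where "L n = (\<integral>x. avg (S n) (T g x) * avg (S n) x \<partial>M)" for n
  obtain C where C: "\<And>s. s \<in> \<Psi> \<Longrightarrow> \<bar>s - e\<bar> \<le> C"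
  proof -
    have "finite ((\<lambda>s. \<bar>s - e\<bar>) ` \<Psi>)" using \<Psi> by simp
    then show ?thesis using that Max_ge by (metis imageI)
  qed
  have "(\<lambda>n. L n - e / 2) \<longlonglongrightarrow> 0"
  proof (rule tendsto_sandwich)
    have Leq: "L n = (\<Sum>i\<in>S n. \<Sum>j\<in>S n. z i j) / (real n * real n)" for n
    proof -
      have "L n = (\<integral>x. (1 / (real n * real n)) * (\<Sum>i\<in>S n. \<Sum>j\<in>S n. v i (T g x) * v j x) \<partial>M)"
        unfolding L_def by (rule Bochner_Integration.integral_cong) (auto simp: avg_def sum_product Scard)
      also have "\<dots> = (1 / (real n * real n)) * (\<Sum>i\<in>S n. \<integral>x. (\<Sum>j\<in>S n. v i (T g x) * v j x) \<partial>M)"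
        by (subst integral_mult_right_zero, subst Bochner_Integration.integral_sum)
          (auto intro!: bm_integrable bm_intros bm_v bm_T g)
      also have "(\<Sum>i\<in>S n. \<integral>x. (\<Sum>j\<in>S n. v i (T g x) * v j x) \<partial>M) = (\<Sum>i\<in>S n. \<Sum>j\<in>S n. z i j)"
        unfolding z_def by (rule sum.cong[OF refl], subst Bochner_Integration.integral_sum)
          (auto intro!: bm_integrable bm_intros bm_v bm_T g)
      finally show ?thesis by simp
    qed
    \<comment> \<open>Off the diagonal every symmetrised correlation is \<open>e\<close>; the
      \<open>n\<close> diagonal terms are negligible against \<open>n * n\<close>.\<close>
    have bound: "\<bar>L n - e / 2\<bar> \<le> C / real n" if n: "n > 0" for n
    proof -
      have "(\<Sum>i\<in>S n. \<Sum>j\<in>S n. z j i) = (\<Sum>i\<in>S n. \<Sum>j\<in>S n. z i j)" by (rule sum.swap)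
      then have "2 * (\<Sum>i\<in>S n. \<Sum>j\<in>S n. z i j) = (\<Sum>i\<in>S n. \<Sum>j\<in>S n. y i j)"
        by (simp add: y_def sum.distrib)
      also have "\<dots> = (\<Sum>i\<in>S n. \<Sum>j\<in>S n. e + (if j = i then y i i - e else 0))"
        using H(2) SH by (intro sum.cong refl) (auto simp: subset_iff)
      also have "\<dots> = (\<Sum>i\<in>S n. n * e + (y i i - e))"
        using Sfin by (intro sum.cong refl) (simp add: sum.distrib Scard)
      also have "\<dots> = n * n * e + (\<Sum>i\<in>S n. y i i - e)" by (simp add: sum.distrib Scard)
      finally have *: "2 * (\<Sum>i\<in>S n. \<Sum>j\<in>S n. z i j) = n * n * e + (\<Sum>i\<in>S n. y i i - e)" .
      have "L n - e / 2 = (\<Sum>i\<in>S n. y i i - e) / (2 * (real n * real n))"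
        unfolding Leq using * n by (simp add: field_simps)
      also have "\<bar>\<dots>\<bar> \<le> (\<Sum>i\<in>S n. C) / (2 * (real n * real n))"
      proof -
        have "\<bar>\<Sum>i\<in>S n. y i i - e\<bar> \<le> (\<Sum>i\<in>S n. C)"
          by (rule order_trans[OF sum_abs sum_mono]) (rule C[OF y\<Psi>])
        then show ?thesis by (simp add: divide_right_mono del: sum_constant)
      qed
      also have "\<dots> = (C / real n) / 2" using n by (simp add: Scard)
      also have "\<dots> \<le> C / real n"
      proof -
        have "0 \<le> C" using C[OF y\<Psi>] by (meson abs_ge_zero order_trans)
        then have "0 \<le> C / real n" by simp
        moreover have "t / 2 \<le> t" if "0 \<le> t" for t :: real using that by simp
        ultimately show ?thesis by blast
      qed
      finally show ?thesis .
    qed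
    show "\<forall>\<^sub>F n in sequentially. - (C / real n) \<le> L n - e / 2"
      using eventually_gt_at_top[of 0]
      by eventually_elim (rule minus_le_iff[THEN iffD1, OF abs_le_D2[OF bound]])
    show "\<forall>\<^sub>F n in sequentially. L n - e / 2 \<le> C / real n"
      using eventually_gt_at_top[of 0] by eventually_elim (rule abs_le_D1[OF bound])
    show "(\<lambda>n. C / real n) \<longlonglongrightarrow> 0" by (rule lim_const_over_n)
    from tendsto_minus[OF this] show "(\<lambda>n. - (C / real n)) \<longlonglongrightarrow> 0" by simp
  qed
  then have lim1: "L \<longlonglongrightarrow> e / 2" by (simp add: LIM_zero_iff)
  \<comment> \<open>The difference of the two correlations splits into two terms, each with a factor
    \<open>avg (S n) - u\<close> or its translate, so both squares are O(1/n).\<close>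
  have "(\<lambda>n. L n - (\<integral>x. u (T g x) * u x \<partial>M)) \<longlonglongrightarrow> 0 + 0"
  proof (rule Lim_transform_eventually[OF tendsto_add])
    show "(\<lambda>n. \<integral>x. (avg (S n) (T g x) - u (T g x)) * avg (S n) x \<partial>M) \<longlonglongrightarrow> 0"
    proof (rule tendsto_zero_of_square_le)
      fix n :: nat assume n: "n > 0"
      then have ne: "S n \<noteq> {}" by (auto simp: S_def)
      have "(\<integral>x. (avg (S n) (T g x) - u (T g x)) * avg (S n) x \<partial>M)\<^sup>2
          \<le> K\<^sup>2 * (\<integral>x. (avg (S n) (T g x) - u (T g x))\<^sup>2 \<partial>M)"
        by (intro square_integral_mult_le bm_intros bm_T bm_avg avg_bound u g)
      also have "(\<integral>x. (avg (S n) (T g x) - u (T g x))\<^sup>2 \<partial>M) = (\<integral>x. (avg (S n) x - u x)\<^sup>2 \<partial>M)"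
        by (rule integral_T[OF g]) (intro bm_meas bm_intros bm_avg u)
      also have "\<dots> = (q - c) / n" using integral_avg_limit[OF u(1,3,4) Sfin ne] by (simp add: Scard)
      finally show "(\<integral>x. (avg (S n) (T g x) - u (T g x)) * avg (S n) x \<partial>M)\<^sup>2 \<le> (K\<^sup>2 * (q - c)) / n" by simp
    qed
    show "(\<lambda>n. \<integral>x. (avg (S n) x - u x) * u (T g x) \<partial>M) \<longlonglongrightarrow> 0"
    proof (rule tendsto_zero_of_square_le)
      fix n :: nat assume n: "n > 0"
      then have ne: "S n \<noteq> {}" by (auto simp: S_def)
      have "(\<integral>x. (avg (S n) x - u x) * u (T g x) \<partial>M)\<^sup>2 \<le> K\<^sup>2 * (\<integral>x. (avg (S n) x - u x)\<^sup>2 \<partial>M)"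
        by (intro square_integral_mult_le bm_intros bm_T bm_avg u g)
      also have "(\<integral>x. (avg (S n) x - u x)\<^sup>2 \<partial>M) = (q - c) / n"
        using integral_avg_limit[OF u(1,3,4) Sfin ne] by (simp add: Scard)
      finally show "(\<integral>x. (avg (S n) x - u x) * u (T g x) \<partial>M)\<^sup>2 \<le> (K\<^sup>2 * (q - c)) / n" by simp
    qed
    show "\<forall>\<^sub>F n in sequentially. (\<integral>x. (avg (S n) (T g x) - u (T g x)) * avg (S n) x \<partial>M)
        + (\<integral>x. (avg (S n) x - u x) * u (T g x) \<partial>M) = L n - (\<integral>x. u (T g x) * u x \<partial>M)"
    proof (intro always_eventually allI)
      fix n
      have "(\<integral>x. (avg (S n) (T g x) - u (T g x)) * avg (S n) x \<partial>M) + (\<integral>x. (avg (S n) x - u x) * u (T g x) \<partial>M)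
        = (\<integral>x. (avg (S n) (T g x) - u (T g x)) * avg (S n) x + (avg (S n) x - u x) * u (T g x) \<partial>M)"
        by (rule Bochner_Integration.integral_add[symmetric]; intro bm_integrable bm_intros bm_T bm_avg u g)
      also have "\<dots> = (\<integral>x. avg (S n) (T g x) * avg (S n) x - u (T g x) * u x \<partial>M)"
        by (rule Bochner_Integration.integral_cong) (auto simp: algebra_simps)
      also have "\<dots> = L n - (\<integral>x. u (T g x) * u x \<partial>M)" unfolding L_def
        by (rule Bochner_Integration.integral_diff; intro bm_integrable bm_intros bm_T bm_avg u g)
      finally show "(\<integral>x. (avg (S n) (T g x) - u (T g x)) * avg (S n) x \<partial>M)
        + (\<integral>x. (avg (S n) x - u x) * u (T g x) \<partial>M) = L n - (\<integral>x. u (T g x) * u x \<partial>M)" .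
    qed
  qed
  then have "L \<longlonglongrightarrow> (\<integral>x. u (T g x) * u x \<partial>M)" by (simp add: LIM_zero_iff)
  with lim1 have e: "(\<integral>x. u (T g x) * u x \<partial>M) = e / 2" using LIMSEQ_unique by blast
  have "e \<in> \<Psi>"
  proof -
    have "enumerate H 0 \<in> H" "enumerate H 1 \<in> H" "enumerate H 0 \<noteq> enumerate H 1"
      using H enumerate_in_set inj_enumerate[OF H(1)] by (auto simp: inj_eq)
    then show ?thesis using H(2) y\<Psi> by metis
  qed
  then show ?thesis unfolding e \<Psi>_def by force
qed

text \<open>Translates of \<open>f\<close> by elements of \<open>stab G A\<close> that move \<open>B\<close> to sets meeting only in
  \<open>A \<inter> B\<close> have, after thinning, constant correlations. Their averages converge to a vector \<open>u\<close>
  whose correlations take finitely many values, so its stabiliser is open. It is supported on any two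
  disjoint blocks of the sequence, hence on \<open>A \<inter> B\<close> by weak elimination of imaginaries.\<close>

lemma orthogonal:
  assumes fin: "finite A" "finite B" and f: "bm f" "invf B f"
    and perp: "\<And>w. bm w \<Longrightarrow> invf (A \<inter> B) w \<Longrightarrow> (\<integral>x. f x * w x \<partial>M) = 0"
    and w: "bm w" "invf A w"
  shows "(\<integral>x. f x * w x \<partial>M) = 0"
proof -
  obtain h :: "nat \<Rightarrow> 'a \<Rightarrow> 'a" where h: "\<And>i. h i \<in> stab G A" "\<And>i j. i \<noteq> j \<Longrightarrow> h i ` B \<inter> h j ` B \<subseteq> A \<inter> B"
    by (rule ex_stab_sequence[OF fin], rule that)
  obtain K where K: "\<And>x. \<bar>f x\<bar> \<le> K" using f by (auto simp: bm_def)
  have fm: "f \<in> borel_measurable M" and wm: "w \<in> borel_measurable M" using f w bm_meas by auto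
  define \<Phi> where "\<Phi> = {\<integral>x. f (T g x) * f x \<partial>M | g. g \<in> G}"
  have \<Phi>: "finite \<Phi>" unfolding \<Phi>_def by (rule finite_correlations[OF fin(2) f])
  have corr\<Phi>: "(\<integral>x. f (T a x) * f (T b x) \<partial>M) \<in> \<Phi>" if "a \<in> G" "b \<in> G" for a b
    unfolding \<Phi>_def correlation_shift[OF that fm] using comp_G inv_G that by blast
  have hG: "h i \<in> G" "inv (h i) \<in> G" for i using h(1) stab_G inv_G by auto
  define y where "y i j = (\<integral>x. f (T (inv (h i)) x) * f (T (inv (h j)) x) \<partial>M)" for i j
  have y\<Phi>: "y i j \<in> \<Phi>" for i j unfolding y_def using corr\<Phi> hG by blast
  have ysym: "y i j = y j i" for i j by (simp add: y_def mult.commute)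
  obtain H c where H: "infinite (H :: nat set)" "\<And>i j. i \<in> H \<Longrightarrow> j \<in> H \<Longrightarrow> i \<noteq> j \<Longrightarrow> y i j = c"
    using Ramsey_pairs_nat[where y=y and Z=UNIV, OF \<Phi> y\<Phi> ysym] by (metis infinite_UNIV_nat)
  define k where "k i = h (enumerate H i)" for i
  have kA: "k i \<in> stab G A" for i using h by (simp add: k_def)
  have kG: "k i \<in> G" "inv (k i) \<in> G" for i using hG by (auto simp: k_def)
  have en: "enumerate H i = enumerate H j \<longleftrightarrow> i = j" for i j using inj_enumerate[OF H(1)] by (simp add: inj_eq)
  have kB: "k i ` B \<inter> k j ` B \<subseteq> A \<inter> B" if "i \<noteq> j" for i j unfolding k_def using h(2) that en by blast
  define v where "v i x = f (T (inv (k i)) x)" for i x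
  define q where "q = (\<integral>x. f x * f x \<partial>M)"
  have shift: "(\<integral>x. v i x * w' x \<partial>M) = (\<integral>x. f x * w' (T (k i) x) \<partial>M)" if "w' \<in> borel_measurable M" for i w'
    unfolding v_def by (rule integral_T_shift[OF kG(1) fm that])
  have eq: "equicorrelated M v K c q"
  proof
    show "v i \<in> borel_measurable M" for i unfolding v_def using meas_T kG fm by blast
    show "\<bar>v i x\<bar> \<le> K" for i x unfolding v_def by (rule K)
    show "(\<integral>x. v i x * v j x \<partial>M) = c" if "i \<noteq> j" for i j
      using H enumerate_in_set[OF H(1)] en that unfolding v_def k_def y_def by blast
    show "(\<integral>x. v i x * v i x \<partial>M) = q" for i
      unfolding q_def v_def
      using integral_T[OF kG(2), of "\<lambda>x. f x * f x" i] fm by (simp add: borel_measurable_times)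
  qed
  interpret equicorrelated M v K c q by fact
  obtain u where u: "u \<in> borel_measurable M" "\<And>x. \<bar>u x\<bar> \<le> K"
    "\<And>i. (\<integral>x. v i x * u x \<partial>M) = c" "(\<integral>x. u x * u x \<partial>M) = c" using ex_limit by blast
  have bu: "bm u" using u bmI by blast
  define V where "V = {g \<in> G. AE x in M. u (T g x) = u x}"
  have V: "is_subgroup V G"
    unfolding is_subgroup_def
  proof (intro conjI ballI)
    show "V \<subseteq> G" by (auto simp: V_def)
    show "id \<in> V" using id_G T_id by (auto simp: V_def)
    fix g assume g: "g \<in> V"
    then have gG: "g \<in> G" and gu: "AE x in M. u (T g x) = u x" by (auto simp: V_def)
    show "inv g \<in> V"
    proof -
      have "AE x in M. u (T g (T (inv g) x)) = u (T (inv g) x)"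
        by (rule AE_T[OF inv_G[OF gG] gu])
      then have "AE x in M. u (T (inv g) x) = u x"
        using AE_space by eventually_elim (simp add: T_inv gG)
      then show ?thesis using inv_G gG by (auto simp: V_def)
    qed
    fix h assume "h \<in> V"
    then have hG: "h \<in> G" and hu: "AE x in M. u (T h x) = u x" by (auto simp: V_def)
    have "AE x in M. u (T (g \<circ> h) x) = u x"
      using AE_T[OF hG gu] hu AE_space by eventually_elim (simp add: T_comp gG hG)
    then show "g \<circ> h \<in> V" using comp_G gG hG by (auto simp: V_def)
  qed
  define \<Psi> where "\<Psi> = (\<lambda>(a, b). (a + b) / 2) ` (\<Phi> \<times> \<Phi>)"
  have "finite \<Psi>" using \<Phi> by (simp add: \<Psi>_def)
  \<comment> \<open>\<open>\<delta>\<close> isolates \<open>c\<close> among the finitely many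
    possible correlations. As \<open>c\<close> is the squared norm of \<open>u\<close>, a
    correlation within \<open>\<delta>\<close> of \<open>c\<close> equals \<open>c\<close> and makes
    \<open>u\<close> invariant under \<open>g\<close>.\<close>
  from finite_set_avoid[OF this, of c] obtain \<delta> where \<delta>: "\<delta> > 0" "\<And>t. t \<in> \<Psi> \<Longrightarrow> t \<noteq> c \<Longrightarrow> \<delta> \<le> \<bar>c - t\<bar>"
    by (auto simp: dist_real_def)
  have inV: "g \<in> V" if g: "g \<in> G" and close: "\<bar>(\<integral>x. u (T g x) * u x \<partial>M) - c\<bar> < \<delta>" for g
  proof -
    have "(\<integral>x. v i (T g x) * v j x \<partial>M) \<in> \<Phi>" for i j
    proof -
      have "(\<integral>x. v i (T g x) * v j x \<partial>M) = (\<integral>x. f (T (inv (k i) \<circ> g) x) * f (T (inv (k j)) x) \<partial>M)"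
        unfolding v_def by (rule Bochner_Integration.integral_cong) (auto simp: T_comp g kG)
      then show ?thesis using corr\<Phi> comp_G g kG by metis
    qed
    from limit_correlations[OF eq bu u(2-4) g \<Phi> this]
    have "(\<integral>x. u (T g x) * u x \<partial>M) \<in> \<Psi>" unfolding \<Psi>_def .
    then have ug: "(\<integral>x. u (T g x) * u x \<partial>M) = c" using \<delta> close by (smt (verit))
    have "(\<integral>x. (u (T g x) - u x)\<^sup>2 \<partial>M) =
      (\<integral>x. u (T g x) * u (T g x) \<partial>M) - 2 * (\<integral>x. u (T g x) * u x \<partial>M) + (\<integral>x. u x * u x \<partial>M)"
      by (rule integral_square_diff[OF bm_T[OF bu g] bu])
    also have "(\<integral>x. u (T g x) * u (T g x) \<partial>M) = (\<integral>x. u x * u x \<partial>M)"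
      using integral_T[OF g, of "\<lambda>x. u x * u x"] u(1) by (simp add: borel_measurable_times)
    finally have "(\<integral>x. (u (T g x) - u x)\<^sup>2 \<partial>M) = 0" using ug u(4) by simp
    from AE_eq_of_integral_zero[OF bm_diff[OF bm_T[OF bu g] bu] this]
    show ?thesis using g by (auto simp: V_def)
  qed
  have invv: "invf (k i ` B) (v i)" for i
    unfolding v_def using invf_comp_T[OF kG(2), of i "k i ` B" f] f(2) kG by (simp add: image_image)
  \<comment> \<open>\<open>avg S\<close> is invariant under the stabiliser of its support, so the
    change in the correlation of \<open>u\<close> comes entirely from the error \<open>D\<close> and
    its translate; each contributes less than \<open>\<delta> / 2\<close>.\<close>
  have suppV: "stab G (\<Union>i\<in>S. k i ` B) \<subseteq> V"
    if S: "finite S" "S \<noteq> {}" and small: "K\<^sup>2 * ((q - c) / card S) < (\<delta> / 2)\<^sup>2" for S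
  proof
    fix g assume g: "g \<in> stab G (\<Union>i\<in>S. k i ` B)"
    have gG: "g \<in> G" using g stab_G by blast
    have "invf (\<Union>i\<in>S. k i ` B) (\<lambda>x. \<Sum>i\<in>S. v i x)"
      using S invv by (intro invf_sum) (auto intro: invf_mono)
    then have "AE x in M. avg S (T g x) = avg S x"
      using invfD[OF _ g] unfolding avg_def by fastforce
    define D where "D x = avg S x - u x" for x
    have bD: "bm D" unfolding D_def by (intro bm_intros bm_avg bu)
    have D: "(\<integral>x. (D x)\<^sup>2 \<partial>M) = (q - c) / card S"
      unfolding D_def using integral_avg_limit[OF bu u(3,4) S] .
    have "\<bar>\<integral>x. D (T g x) * u x \<partial>M\<bar> < \<delta> / 2"
    proof (rule power2_less_imp_less)
      have "(\<integral>x. D (T g x) * u x \<partial>M)\<^sup>2 \<le> K\<^sup>2 * (\<integral>x. (D (T g x))\<^sup>2 \<partial>M)"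
        by (rule square_integral_mult_le[OF bm_T[OF bD gG] bu u(2)])
      also have "(\<integral>x. (D (T g x))\<^sup>2 \<partial>M) = (\<integral>x. (D x)\<^sup>2 \<partial>M)"
        by (rule integral_T[OF gG]) (intro bm_meas bm_intros bD)
      finally show "\<bar>\<integral>x. D (T g x) * u x \<partial>M\<bar>\<^sup>2 < (\<delta> / 2)\<^sup>2" using small D by simp
    qed (use \<delta> in simp)
    moreover have "\<bar>\<integral>x. D x * u x \<partial>M\<bar> < \<delta> / 2"
    proof (rule power2_less_imp_less)
      have "(\<integral>x. D x * u x \<partial>M)\<^sup>2 \<le> K\<^sup>2 * (\<integral>x. (D x)\<^sup>2 \<partial>M)"
        by (rule square_integral_mult_le[OF bD bu u(2)])
      then show "\<bar>\<integral>x. D x * u x \<partial>M\<bar>\<^sup>2 < (\<delta> / 2)\<^sup>2" using small D by simp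
    qed (use \<delta> in simp)
    moreover have "(\<integral>x. u (T g x) * u x \<partial>M) - c = (\<integral>x. D x * u x \<partial>M) - (\<integral>x. D (T g x) * u x \<partial>M)"
    proof -
      have "(\<integral>x. u (T g x) * u x \<partial>M) - c = (\<integral>x. u (T g x) * u x - u x * u x \<partial>M)"
        unfolding u(4)[symmetric]
        by (rule Bochner_Integration.integral_diff[symmetric]; intro bm_integrable bm_intros bm_T bu gG)
      also have "\<dots> = (\<integral>x. D x * u x - D (T g x) * u x \<partial>M)"
      proof (rule integral_cong_AE)
        show "AE x in M. u (T g x) * u x - u x * u x = D x * u x - D (T g x) * u x"
          using \<open>AE x in M. avg S (T g x) = avg S x\<close> by eventually_elim (simp add: D_def algebra_simps)
      qed (intro bm_meas bm_intros bm_T bu bD gG)+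
      also have "\<dots> = (\<integral>x. D x * u x \<partial>M) - (\<integral>x. D (T g x) * u x \<partial>M)"
        by (rule Bochner_Integration.integral_diff; intro bm_integrable bm_intros bm_T bu bD gG)
      finally show ?thesis .
    qed
    ultimately show "g \<in> V" by (intro inV[OF gG]) linarith
  qed
  obtain n :: nat where n: "n > 0" "K\<^sup>2 * ((q - c) / n) < (\<delta> / 2)\<^sup>2"
  proof -
    have "(\<lambda>n. (K\<^sup>2 * (q - c)) / real n) \<longlonglongrightarrow> 0" by (rule lim_const_over_n)
    then have "\<forall>\<^sub>F n in sequentially. (K\<^sup>2 * (q - c)) / real n < (\<delta> / 2)\<^sup>2"
      using \<delta> by (intro order_tendstoD(2)) auto
    then have "\<forall>\<^sub>F n in sequentially. n > 0 \<and> (K\<^sup>2 * (q - c)) / real n < (\<delta> / 2)\<^sup>2"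
      using eventually_gt_at_top[of 0] by eventually_elim simp
    then show ?thesis using that by (auto dest: eventually_happens)
  qed
  have "stab G ((\<Union>i\<in>{..<n}. k i ` B) \<inter> (\<Union>i\<in>{n..<2 * n}. k i ` B)) \<subseteq> V"
    by (intro stab_Int_subset[OF V] suppV) (use n fin in \<open>auto simp: lessThan_empty_iff\<close>)
  moreover have "(\<Union>i\<in>{..<n}. k i ` B) \<inter> (\<Union>i\<in>{n..<2 * n}. k i ` B) \<subseteq> A \<inter> B"
  proof
    fix y assume "y \<in> (\<Union>i\<in>{..<n}. k i ` B) \<inter> (\<Union>i\<in>{n..<2 * n}. k i ` B)"
    then obtain i j where "i \<in> {..<n}" "y \<in> k i ` B" "j \<in> {n..<2 * n}" "y \<in> k j ` B" by blast
    then show "y \<in> A \<inter> B" using kB[of i j] by auto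
  qed
  ultimately have "stab G (A \<inter> B) \<subseteq> V" using stab_mono by blast
  then have "invf (A \<inter> B) u" by (auto simp: invf_def V_def)
  \<comment> \<open>Now \<open>u\<close> itself is a test function for \<open>perp\<close>, so its
    squared norm \<open>c\<close> vanishes.\<close>
  have "c = (\<integral>x. v 0 x * u x \<partial>M)" using u(3) by simp
  also have "\<dots> = (\<integral>x. f x * u (T (k 0) x) \<partial>M)" by (rule shift[OF u(1)])
  also have "\<dots> = (\<integral>x. f x * u x \<partial>M)"
  proof (rule integral_cong_AE)
    have "k 0 \<in> stab G (A \<inter> B)" using kA stab_mono[of "A \<inter> B" A] by blast
    from invfD[OF \<open>invf (A \<inter> B) u\<close> this]
    show "AE x in M. f x * u (T (k 0) x) = f x * u x" by eventually_elim simp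
  qed (intro bm_meas bm_intros f bm_T bu kG)+
  also have "\<dots> = 0" by (rule perp[OF bu \<open>invf (A \<inter> B) u\<close>])
  finally have c0: "c = 0" .
  have vw: "(\<integral>x. v i x * w x \<partial>M) = (\<integral>x. f x * w x \<partial>M)" for i
  proof -
    have "(\<integral>x. v i x * w x \<partial>M) = (\<integral>x. f x * w (T (k i) x) \<partial>M)" by (rule shift[OF wm])
    also have "\<dots> = (\<integral>x. f x * w x \<partial>M)"
    proof (rule integral_cong_AE)
      from invfD[OF w(2) kA[of i]]
      show "AE x in M. f x * w (T (k i) x) = f x * w x" by eventually_elim simp
    qed (intro bm_meas bm_intros f bm_T w kG)+
    finally show ?thesis .
  qed
  obtain Kw where Kw: "\<And>x. \<bar>w x\<bar> \<le> Kw" using w by (auto simp: bm_def)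
  \<comment> \<open>Each \<open>k i\<close> fixes \<open>A\<close> pointwise, so replacing
    \<open>f\<close> by \<open>avg {..<n}\<close> does not change the integral against
    \<open>w\<close>; with \<open>c = 0\<close> the squared norm of that average is
    \<open>q / n\<close>.\<close>
  have "(\<lambda>n. \<integral>x. f x * w x \<partial>M) \<longlonglongrightarrow> 0"
  proof (rule tendsto_zero_of_square_le)
    fix n :: nat assume n: "n > 0"
    then have ne: "{..<n} \<noteq> {}" by auto
    have "(\<integral>x. f x * w x \<partial>M) = (\<integral>x. avg {..<n} x * w x \<partial>M)"
      using n by (simp add: integral_avg_mult[OF w(1)] vw)
    also have "\<dots>\<^sup>2 \<le> Kw\<^sup>2 * (\<integral>x. (avg {..<n} x)\<^sup>2 \<partial>M)"
      by (rule square_integral_mult_le[OF bm_avg w(1) Kw])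
    also have "(\<integral>x. (avg {..<n} x)\<^sup>2 \<partial>M) = q / n"
      using integral_avg_avg[OF _ ne, of "{..<n}"] c0 by (simp add: power2_eq_square)
    finally show "(\<integral>x. f x * w x \<partial>M)\<^sup>2 \<le> (Kw\<^sup>2 * q) / n" by simp
  qed
  then show ?thesis by (simp add: LIMSEQ_const_iff)
qed

end

subsection \<open>Conditional independence and exchangeability\<close>

context pmp_action
begin

lemma cexp_bounded_version:
  assumes "bm f"
  obtains e where "bm e" "e \<in> borel_measurable (F A)" "AE x in M. cexp A f x = e x"
proof -
  interpret S: sigma_finite_subalgebra M "F A" by (rule sfs)
  obtain K where K: "\<And>x. \<bar>f x\<bar> \<le> K" using assms by (auto simp: bm_def)
  have i: "integrable M f" using assms bm_integrable by blast
  have "AE x in M. cexp A f x \<ge> - K"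
    by (rule S.real_cond_exp_ge_c[OF i]) (use K in \<open>auto simp: abs_le_iff minus_le_iff\<close>)
  moreover have "AE x in M. cexp A f x \<le> K"
    by (rule S.real_cond_exp_le_c[OF i]) (use K in \<open>auto simp: abs_le_iff\<close>)
  ultimately have AE: "AE x in M. cexp A f x = max (- K) (min K (cexp A f x))"
    by eventually_elim auto
  have m: "(\<lambda>x. max (- K) (min K (cexp A f x))) \<in> borel_measurable (F A)" by measurable
  have "0 \<le> K" using K by (meson abs_ge_zero order_trans)
  then have "bm (\<lambda>x. max (- K) (min K (cexp A f x)))"
    by (intro bmI[where K=K] meas_F_M[OF m]) auto
  from that[OF this m AE] show ?thesis .
qed

lemma integral_cexp:
  assumes "bm f" "bm w" "w \<in> borel_measurable (F A)" "bm e" "AE x in M. cexp A f x = e x"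
  shows "(\<integral>x. w x * f x \<partial>M) = (\<integral>x. w x * e x \<partial>M)"
proof -
  interpret S: sigma_finite_subalgebra M "F A" by (rule sfs)
  have "(\<integral>x. w x * f x \<partial>M) = (\<integral>x. w x * cexp A f x \<partial>M)"
    by (rule S.real_cond_exp_intg(2)[symmetric])
      (use assms in \<open>auto intro!: bm_integrable bm_intros bm_meas\<close>)
  also have "\<dots> = (\<integral>x. w x * e x \<partial>M)"
  proof (rule integral_cong_AE)
    show "AE x in M. w x * cexp A f x = w x * e x" using assms(5) by eventually_elim simp
    show "(\<lambda>x. w x * cexp A f x) \<in> borel_measurable M"
      using assms(2) by (intro borel_measurable_times bm_meas meas_F_M[OF borel_measurable_cond_exp])
  qed (use assms in \<open>intro bm_meas bm_intros\<close>)
  finally show ?thesis .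
qed

lemma cexp_eqI:
  assumes "bm f" "bm e" "e \<in> borel_measurable (F A)"
    and "\<And>D. D \<in> sets (F A) \<Longrightarrow> (\<integral>x. indicator D x * f x \<partial>M) = (\<integral>x. indicator D x * e x \<partial>M)"
  shows "AE x in M. cexp A f x = e x"
proof -
  interpret S: sigma_finite_subalgebra M "F A" by (rule sfs)
  show ?thesis
    by (rule S.real_cond_exp_charact)
      (use assms bm_integrable in \<open>auto simp: set_lebesgue_integral_def\<close>)
qed

lemma bm_indicator: "D \<in> sets M \<Longrightarrow> bm (indicator D)"
  by (intro bmI[where K=1]) (auto simp: indicator_def)

lemma sets_F_M: "D \<in> sets (F A) \<Longrightarrow> D \<in> sets M"
  by (simp add: sets_F)

text \<open>Let \<open>e\<close> be a version of the conditional expectation over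
  \<open>F (A \<inter> B)\<close>. Then \<open>f - e\<close> is orthogonal to the bounded functions
  measurable over \<open>F (A \<inter> B)\<close>, hence by \<open>orthogonal\<close> to those over
  \<open>F A\<close>, and this characterises \<open>e\<close> as the conditional expectation over
  \<open>F A\<close>.\<close>

theorem cexp_Int:
  assumes fin: "finite A" "finite B" and f: "bm f" "f \<in> borel_measurable (F B)"
  shows "AE x in M. cexp A f x = cexp (A \<inter> B) f x"
proof -
  obtain e where e: "bm e" "e \<in> borel_measurable (F (A \<inter> B))" "AE x in M. cexp (A \<inter> B) f x = e x"
    using cexp_bounded_version[OF f(1)] .
  have "AE x in M. cexp A f x = e x"
  proof (rule cexp_eqI[OF f(1) e(1)])
    show "e \<in> borel_measurable (F A)" using e(2) by (rule meas_F_mono) simp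
    fix D assume D: "D \<in> sets (F A)"
    have D': "bm (indicator D)" "(indicator D :: _ \<Rightarrow> real) \<in> borel_measurable (F A)"
      using D by (auto intro: bm_indicator sets_F_M)
    have "(\<integral>x. (f x - e x) * indicator D x \<partial>M) = 0"
    proof (rule orthogonal[OF fin])
      show "bm (\<lambda>x. f x - e x)" by (intro bm_intros f e)
      have "(\<lambda>x. f x - e x) \<in> borel_measurable (F B)"
        using f(2) meas_F_mono[OF e(2), of B] by (intro borel_measurable_diff) auto
      then show "invf B (\<lambda>x. f x - e x)" by (rule invf_of_meas)
      show "bm (indicator D)" "invf A (indicator D :: _ \<Rightarrow> real)"
        using D' by (auto intro: invf_of_meas)
      fix w assume w: "bm w" "invf (A \<inter> B) w"
      then have wm: "w \<in> borel_measurable (F (A \<inter> B))" by (intro meas_FI bm_meas)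
      have "(\<integral>x. (f x - e x) * w x \<partial>M) = (\<integral>x. w x * f x - w x * e x \<partial>M)"
        by (rule Bochner_Integration.integral_cong) (auto simp: algebra_simps)
      also have "\<dots> = (\<integral>x. w x * f x \<partial>M) - (\<integral>x. w x * e x \<partial>M)"
        by (rule Bochner_Integration.integral_diff; intro bm_integrable bm_intros w f e)
      also have "\<dots> = 0" using integral_cexp[OF f(1) w(1) wm e(1,3)] by simp
      finally show "(\<integral>x. (f x - e x) * w x \<partial>M) = 0" .
    qed
    also have "(\<integral>x. (f x - e x) * indicator D x \<partial>M) = (\<integral>x. indicator D x * f x - indicator D x * e x \<partial>M)"
      by (rule Bochner_Integration.integral_cong) (auto simp: algebra_simps)
    also have "\<dots> = (\<integral>x. indicator D x * f x \<partial>M) - (\<integral>x. indicator D x * e x \<partial>M)"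
      by (rule Bochner_Integration.integral_diff; intro bm_integrable bm_intros D' f e)
    finally show "(\<integral>x. indicator D x * f x \<partial>M) = (\<integral>x. indicator D x * e x \<partial>M)" by simp
  qed
  with e(3) show ?thesis by eventually_elim simp
qed

lemma cexp_T:
  assumes g: "g \<in> G" and f: "bm f"
  shows "AE x in M. cexp A (\<lambda>x. f (T g x)) x = cexp (g ` A) f (T g x)"
proof -
  obtain e where e: "bm e" "e \<in> borel_measurable (F (g ` A))" "AE x in M. cexp (g ` A) f x = e x"
    using cexp_bounded_version[OF f] .
  have "AE x in M. cexp A (\<lambda>x. f (T g x)) x = e (T g x)"
  proof (rule cexp_eqI)
    show "bm (\<lambda>x. f (T g x))" "bm (\<lambda>x. e (T g x))" using f e g by (auto intro: bm_T)
    show "(\<lambda>x. e (T g x)) \<in> borel_measurable (F A)"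
      by (rule meas_FI[OF meas_T[OF g bm_meas[OF e(1)]] invf_comp_T[OF g invf_of_meas[OF e(2)]]])
    fix D assume D: "D \<in> sets (F A)"
    define w where "w = (indicator D :: 'x \<Rightarrow> real)"
    have w: "bm w" "w \<in> borel_measurable (F A)"
      using D by (auto simp: w_def intro: bm_indicator sets_F_M)
    define w' where "w' x = w (T (inv g) x)" for x
    have bw': "bm w'" unfolding w'_def by (rule bm_T[OF w(1) inv_G[OF g]])
    have "invf (inv g ` (g ` A)) w" using w g by (simp add: image_image invf_of_meas)
    then have "invf (g ` A) w'" unfolding w'_def by (rule invf_comp_T[OF inv_G[OF g]])
    then have mw': "w' \<in> borel_measurable (F (g ` A))" by (rule meas_FI[OF bm_meas[OF bw']])
    have "(\<integral>x. w x * f (T g x) \<partial>M) = (\<integral>x. w' x * f x \<partial>M)"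
      unfolding w'_def by (rule integral_T_shift[OF g, symmetric]) (use w f bm_meas in auto)
    also have "\<dots> = (\<integral>x. w' x * e x \<partial>M)" by (rule integral_cexp[OF f bw' mw' e(1,3)])
    also have "\<dots> = (\<integral>x. w x * e (T g x) \<partial>M)"
      unfolding w'_def by (rule integral_T_shift[OF g]) (use w e bm_meas in auto)
    finally show "(\<integral>x. indicator D x * f (T g x) \<partial>M) = (\<integral>x. indicator D x * e (T g x) \<partial>M)"
      unfolding w_def .
  qed
  with AE_T[OF g e(3)] show ?thesis by eventually_elim simp
qed

text \<open>Elements of \<open>stab G A\<close> preserve the measure and act trivially on
  \<open>F A\<close>, so a function and its translate have the same conditional expectation. This is
  what makes conditional laws independent of the point at which they are evaluated.\<close>

lemma cexp_cong_stab:
  assumes k: "k \<in> stab G A" and f: "bm f" and f': "bm f'" "AE x in M. f (T k x) = f' x"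
  shows "AE x in M. cexp A f x = cexp A f' x"
proof -
  interpret S: sigma_finite_subalgebra M "F A" by (rule sfs)
  have kG: "k \<in> G" "k ` A = A" using k by (auto simp: stab_def image_iff)
  have "AE x in M. cexp A (\<lambda>x. f (T k x)) x = cexp A f' x"
    by (rule S.real_cond_exp_cong[OF f'(2) bm_meas[OF bm_T[OF f kG(1)]] bm_meas[OF f'(1)]])
  moreover have "AE x in M. cexp A (\<lambda>x. f (T k x)) x = cexp A f (T k x)"
    using cexp_T[OF kG(1) f, of A] kG(2) by simp
  moreover have "AE x in M. cexp A f (T k x) = cexp A f x"
    by (rule invfD[OF invf_of_meas[OF borel_measurable_cond_exp] k])
  ultimately show ?thesis by eventually_elim simp
qed

text \<open>The last factor sees the others only through \<open>C\<close>: the set \<open>C\<close>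
  enlarged by the other points meets \<open>insert (b n) C\<close> in \<open>C\<close>, so
  \<open>cexp_Int\<close> replaces \<open>f n\<close> by \<open>e n\<close>, which \<open>h\<close>
  then absorbs. The case \<open>C = {}\<close> serves exchangeability, \<open>C = {a}\<close> the
  separation of profiles.\<close>

lemma integral_prod_cond_indep:
  fixes f e :: "nat \<Rightarrow> 'x \<Rightarrow> real"
  assumes C: "finite C" and b: "inj_on b {..<n}" "\<And>i. i < n \<Longrightarrow> b i \<notin> C"
    and f: "\<And>i. i < n \<Longrightarrow> bm (f i)" "\<And>i. i < n \<Longrightarrow> f i \<in> borel_measurable (F (insert (b i) C))"
    and e: "\<And>i. i < n \<Longrightarrow> bm (e i)" "\<And>i. i < n \<Longrightarrow> e i \<in> borel_measurable (F C)"
      "\<And>i. i < n \<Longrightarrow> AE x in M. cexp C (f i) x = e i x"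
    and h: "bm h" "h \<in> borel_measurable (F C)"
  shows "(\<integral>x. h x * (\<Prod>i<n. f i x) \<partial>M) = (\<integral>x. h x * (\<Prod>i<n. e i x) \<partial>M)"
  using b f e h
proof (induction n arbitrary: h)
  case (Suc n)
  let ?A = "C \<union> b ` {..<n}"
  define W where "W x = h x * (\<Prod>i<n. f i x)" for x
  have bW: "bm W" unfolding W_def using Suc.prems by (intro bm_mult bm_prod) auto
  have mW: "W \<in> borel_measurable (F ?A)" unfolding W_def
  proof (intro borel_measurable_times borel_measurable_prod)
    show "h \<in> borel_measurable (F ?A)" by (rule meas_F_mono[OF Suc.prems(9)]) auto
    fix i assume "i \<in> {..<n}"
    then show "f i \<in> borel_measurable (F ?A)"
      by (intro meas_F_mono[OF Suc.prems(4)]) auto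
  qed
  have "b n \<notin> b ` {..<n}" using Suc.prems(1) by (auto simp: lessThan_Suc)
  then have "?A \<inter> insert (b n) C = C" by auto
  then have "AE x in M. cexp ?A (f n) x = cexp C (f n) x"
    using cexp_Int[of ?A "insert (b n) C" "f n"] Suc.prems(3,4)[of n] C by simp
  with Suc.prems(7)[of n] have ce: "AE x in M. cexp ?A (f n) x = e n x"
    by (auto elim: AE_mp)
  have "(\<integral>x. h x * (\<Prod>i<Suc n. f i x) \<partial>M) = (\<integral>x. W x * f n x \<partial>M)"
    by (rule Bochner_Integration.integral_cong) (auto simp: W_def)
  also have "\<dots> = (\<integral>x. W x * e n x \<partial>M)"
    by (rule integral_cexp[OF _ bW mW _ ce]) (use Suc.prems in auto)
  also have "\<dots> = (\<integral>x. (h x * e n x) * (\<Prod>i<n. f i x) \<partial>M)"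
    by (rule Bochner_Integration.integral_cong) (auto simp: W_def)
  also have "\<dots> = (\<integral>x. (h x * e n x) * (\<Prod>i<n. e i x) \<partial>M)"
    using Suc.prems by (intro Suc.IH bm_mult borel_measurable_times) (auto intro: inj_on_subset)
  also have "\<dots> = (\<integral>x. h x * (\<Prod>i<Suc n. e i x) \<partial>M)"
    by (rule Bochner_Integration.integral_cong) auto
  finally show ?case .
qed simp

end

locale equivariant_family = pmp_action G M T
  for G :: "('a \<Rightarrow> 'a) set" and M :: "'x measure" and T +
  fixes Y :: "'a \<Rightarrow> 'x \<Rightarrow> 'n" and N :: "'n measure"
  assumes Y_meas: "\<And>a. Y a \<in> measurable (F {a}) N"
    and Y_equiv: "\<And>g a. g \<in> G \<Longrightarrow> AE x in M. Y (g a) (T g x) = Y a x"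
begin

definition tuple :: "nat \<Rightarrow> (nat \<Rightarrow> 'a) \<Rightarrow> 'x \<Rightarrow> nat \<Rightarrow> 'n" where
  "tuple n a x = (\<lambda>i\<in>{..<n}. Y (a i) x)"

lemma Y_meas_M [measurable]: "Y a \<in> measurable M N"
  using Y_meas meas_F_M by blast

lemma tuple_meas [measurable]: "tuple n a \<in> measurable M (PiM {..<n} (\<lambda>_. N))"
  unfolding tuple_def by measurable

text \<open>As in de Finetti's theorem, all points share one conditional law over
  \<open>F {}\<close>: the functions \<open>e i\<close> are chosen at one base point, and
  transitivity identifies them with the conditional probabilities at every other. The points then
  disappear from the product formula.\<close>

lemma prob_rectangle_eq:
  fixes a a' :: "nat \<Rightarrow> 'a"
  assumes a: "inj_on a {..<n}" and a': "inj_on a' {..<n}" and Q: "\<And>i. i < n \<Longrightarrow> Q i \<in> sets N"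
  shows "prob {x \<in> space M. \<forall>i<n. Y (a i) x \<in> Q i} = prob {x \<in> space M. \<forall>i<n. Y (a' i) x \<in> Q i}"
proof -
  define o' :: 'a where "o' = undefined"
  define f where "f b i x = (indicator (Q i) (Y b x) :: real)" for b i x
  have bf: "bm (f b i)" if "i < n" for b i
    unfolding f_def using Q[OF that] by (intro bmI[where K=1]) (auto simp: indicator_def)
  have mf: "f b i \<in> borel_measurable (F {b})" if "i < n" for b i
    unfolding f_def using measurable_compose[OF Y_meas[of b], of "indicator (Q i)" borel] Q[OF that] by simp
  define P where "P i e \<longleftrightarrow> bm e \<and> e \<in> borel_measurable (F {}) \<and> (AE x in M. cexp {} (f o' i) x = e x)" for i e
  define e where "e i = (SOME e. P i e)" for i
  have P: "P i (e i)" if i: "i < n" for i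
  proof -
    obtain e' where "bm e'" "e' \<in> borel_measurable (F {})" "AE x in M. cexp {} (f o' i) x = e' x"
      using cexp_bounded_version[OF bf[OF i]] by blast
    then have "P i e'" by (simp add: P_def)
    then show ?thesis unfolding e_def by (rule someI[of "P i"])
  qed
  have e: "bm (e i)" "e i \<in> borel_measurable (F {})" "AE x in M. cexp {} (f o' i) x = e i x" if "i < n" for i
    using P[OF that] unfolding P_def by auto
  have ce: "AE x in M. cexp {} (f b i) x = e i x" if i: "i < n" for b i
  proof -
    obtain g where g: "g \<in> G" "g o' = b" using transitive unfolding transitive_on_def by blast
    have "AE x in M. f b i (T g x) = f o' i x"
      using Y_equiv[OF g(1), of o'] unfolding g(2) by eventually_elim (simp add: f_def)
    then have "AE x in M. cexp {} (f b i) x = cexp {} (f o' i) x"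
      by (intro cexp_cong_stab[OF _ bf[OF i] bf[OF i]]) (use g in simp_all)
    then show ?thesis using e(3)[OF i] by eventually_elim simp
  qed
  have "prob {x \<in> space M. \<forall>i<n. Y (a i) x \<in> Q i} = (\<integral>x. (\<Prod>i<n. e i x) \<partial>M)" if a: "inj_on a {..<n}" for a :: "nat \<Rightarrow> 'a"
  proof -
    define X where "X = {x \<in> space M. \<forall>i<n. Y (a i) x \<in> Q i}"
    have "X \<inter> space M = X" unfolding X_def by blast
    then have "prob X = (\<integral>x. indicator X x \<partial>M)" by simp
    also have "\<dots> = (\<integral>x. 1 * (\<Prod>i<n. f (a i) i x) \<partial>M)"
    proof (rule Bochner_Integration.integral_cong[OF refl])
      fix x assume x: "x \<in> space M"
      show "indicator X x = 1 * (\<Prod>i<n. f (a i) i x)"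
      proof (cases "\<forall>i<n. Y (a i) x \<in> Q i")
        case True
        then show ?thesis using x by (simp add: X_def f_def)
      next
        case False
        then obtain i where "i < n" "f (a i) i x = 0" by (auto simp: f_def)
        then have "(\<Prod>i<n. f (a i) i x) = 0" by (intro prod_zero) auto
        then show ?thesis using False by (simp add: X_def)
      qed
    qed
    also have "\<dots> = (\<integral>x. 1 * (\<Prod>i<n. e i x) \<partial>M)"
      by (rule integral_prod_cond_indep[where C="{}" and b=a]) (use a e ce bf mf bm_const in auto)
    finally show ?thesis by (simp add: X_def)
  qed
  from this[OF a] this[OF a'] show ?thesis by simp
qed

theorem exchangeable:
  assumes a: "inj_on a {..<n}" and a': "inj_on a' {..<n}"
  shows "distr M (PiM {..<n} (\<lambda>_. N)) (tuple n a) = distr M (PiM {..<n} (\<lambda>_. N)) (tuple n a')"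
proof (rule measure_eqI_PiM_finite[where A="\<lambda>_. space (PiM {..<n} (\<lambda>_. N))" and I="{..<n}" and M="\<lambda>_. N"])
  fix Q assume Q: "\<And>i. i \<in> {..<n} \<Longrightarrow> Q i \<in> sets N"
  have *: "Pi\<^sub>E {..<n} Q \<in> sets (PiM {..<n} (\<lambda>_. N))" using Q by (intro sets_PiM_I_finite) auto
  have "emeasure (distr M (PiM {..<n} (\<lambda>_. N)) (tuple n a)) (Pi\<^sub>E {..<n} Q) =
      prob {x \<in> space M. \<forall>i<n. Y (a i) x \<in> Q i}" for a
  proof -
    have "tuple n a x \<in> Pi\<^sub>E {..<n} Q \<longleftrightarrow> (\<forall>i<n. Y (a i) x \<in> Q i)" for x
      by (simp add: tuple_def PiE_iff Ball_def)
    then have "tuple n a -` Pi\<^sub>E {..<n} Q \<inter> space M = {x \<in> space M. \<forall>i<n. Y (a i) x \<in> Q i}"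
      by blast
    then show ?thesis by (simp only: emeasure_distr[OF tuple_meas *] emeasure_eq_measure)
  qed
  then show "emeasure (distr M (PiM {..<n} (\<lambda>_. N)) (tuple n a)) (Pi\<^sub>E {..<n} Q) =
      emeasure (distr M (PiM {..<n} (\<lambda>_. N)) (tuple n a')) (Pi\<^sub>E {..<n} Q)"
    using prob_rectangle_eq[OF a a', of Q] Q by simp
next
  show "range (\<lambda>_::nat. space (PiM {..<n} (\<lambda>_. N))) \<subseteq> prod_algebra {..<n} (\<lambda>_. N)"
    by (auto simp: space_PiM intro!: prod_algebraI_finite)
  show "emeasure (distr M (PiM {..<n} (\<lambda>_. N)) (tuple n a)) (space (PiM {..<n} (\<lambda>_. N))) \<noteq> \<infinity>" for i :: nat
    by (subst emeasure_distr) (auto simp: emeasure_eq_measure)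
qed auto

lemma tuple_event:
  assumes "Q \<in> sets (PiM {..<n} (\<lambda>_. N))"
  shows "{x \<in> space M. tuple n a x \<in> Q} \<in> events"
proof -
  have "tuple n a -` Q \<inter> space M = {x \<in> space M. tuple n a x \<in> Q}" by blast
  then show ?thesis using measurable_sets[OF tuple_meas assms, of a] by simp
qed

corollary prob_tuple_eq:
  assumes "inj_on a {..<n}" "inj_on a' {..<n}" "Q \<in> sets (PiM {..<n} (\<lambda>_. N))"
  shows "prob {x \<in> space M. tuple n a x \<in> Q} = prob {x \<in> space M. tuple n a' x \<in> Q}"
proof -
  have "prob {x \<in> space M. tuple n a x \<in> Q} = measure (distr M (PiM {..<n} (\<lambda>_. N)) (tuple n a)) Q" for a
    using assms(3) by (subst measure_distr) (auto intro!: arg_cong[where f=prob])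
  then show ?thesis using exchangeable[OF assms(1,2)] by simp
qed

end

subsection \<open>The space of linear orders\<close>

text \<open>Second countability of the factors lets measurability into \<open>2^(M x M)\<close>, for
  countable \<open>M\<close>, be checked coordinate by coordinate.\<close>

instance bool :: second_countable_topology
proof
  show "\<exists>B :: bool set set. countable B \<and> open = generate_topology B"
  proof (intro exI[of _ UNIV] conjI ext)
    show "open S = generate_topology UNIV S" for S :: "bool set"
      using discrete_topology_class.open_discrete[of S] generate_topology.Basis[of S UNIV] by simp
  qed simp
qed

lemma LO_irrefl: "x \<in> LO \<Longrightarrow> \<not> x (a, a)"
  and LO_trans: "x \<in> LO \<Longrightarrow> x (a, b) \<Longrightarrow> x (b, c) \<Longrightarrow> x (a, c)"
  and LO_total: "x \<in> LO \<Longrightarrow> a \<noteq> b \<Longrightarrow> x (a, b) \<or> x (b, a)"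
  unfolding LO_def mem_Collect_eq by metis+

lemma LO_asym: "x \<in> LO \<Longrightarrow> x (a, b) \<Longrightarrow> \<not> x (b, a)"
  using LO_irrefl LO_trans by metis

lemma LO_neq: "x \<in> LO \<Longrightarrow> x (a, b) \<Longrightarrow> a \<noteq> b"
  using LO_irrefl by metis

lemma space_LO_borel [simp]: "space LO_borel = LO"
  by (simp add: LO_borel_def space_restrict_space)

lemma pred_LO_borel: "Measurable.pred LO_borel (\<lambda>x. x (a, b))"
proof -
  have "(\<lambda>x. x (a, b)) \<in> measurable (borel :: ('a \<times> 'a \<Rightarrow> bool) measure) borel"
    by (rule measurable_product_coordinates)
  then have "(\<lambda>x. x (a, b)) -` {True} \<inter> space borel \<in> sets (borel :: ('a \<times> 'a \<Rightarrow> bool) measure)"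
    by (rule measurable_sets) (simp add: borel_open discrete_topology_class.open_discrete)
  then have "Measurable.pred borel (\<lambda>x :: 'a \<times> 'a \<Rightarrow> bool. x (a, b))"
    unfolding pred_def by (simp add: vimage_def)
  then show ?thesis unfolding LO_borel_def by (rule measurable_restrict_space1)
qed

lemma lo_act_apply: "lo_act g x (a, b) = x (inv g a, inv g b)"
  by (simp add: lo_act_def)

lemma lo_act_LO:
  assumes "bij g" "x \<in> LO"
  shows "lo_act g x \<in> LO"
  unfolding LO_def mem_Collect_eq lo_act_apply
proof (intro conjI allI impI)
  show "\<not> x (inv g a, inv g a)" for a by (rule LO_irrefl[OF assms(2)])
  show "x (inv g a, inv g c)" if "x (inv g a, inv g b)" "x (inv g b, inv g c)" for a b c
    using LO_trans[OF assms(2) that] .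
  show "x (inv g a, inv g b) \<or> x (inv g b, inv g a)" if "a \<noteq> b" for a b
  proof (rule LO_total[OF assms(2)])
    show "inv g a \<noteq> inv g b" using assms(1) that by (metis bij_inv_eq_iff)
  qed
qed

lemma measurable_into_LO_borel:
  fixes f :: "'x \<Rightarrow> ('a::countable \<times> 'a \<Rightarrow> bool)"
  assumes "\<And>x. x \<in> space M \<Longrightarrow> f x \<in> LO" "\<And>a b. Measurable.pred M (\<lambda>x. f x (a, b))"
  shows "f \<in> measurable M LO_borel"
  unfolding LO_borel_def
proof (rule measurable_restrict_space2)
  show "f \<in> space M \<rightarrow> LO" using assms by auto
  show "f \<in> borel_measurable M"
  proof (rule measurable_coordinatewise_then_product)
    fix i :: "'a \<times> 'a"
    obtain a b where i: "i = (a, b)" by (cases i)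
    show "(\<lambda>x. f x i) \<in> borel_measurable M"
      using assms(2)[of a b] unfolding i
      by (rule measurable_compose) (simp add: measurable_count_space_eq1)
  qed
qed

lemma lo_act_measurable:
  fixes g :: "'a::countable \<Rightarrow> 'a"
  assumes "bij g"
  shows "lo_act g \<in> measurable LO_borel LO_borel"
  by (rule measurable_into_LO_borel) (use assms lo_act_LO in \<open>auto simp: lo_act_apply pred_LO_borel\<close>)

lemma lo_act_comp: "bij g \<Longrightarrow> bij h \<Longrightarrow> lo_act (g \<circ> h) x = lo_act g (lo_act h x)"
  by (auto simp: lo_act_def fun_eq_iff o_inv_distrib)

lemma lo_act_id: "lo_act id x = x"
  by (auto simp: lo_act_def fun_eq_iff)

section \<open>Profiles of points under an invariant measure\<close>

locale LO_action = tame_group G for G :: "('a::countable \<Rightarrow> 'a) set" +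
  fixes \<mu> :: "('a \<times> 'a \<Rightarrow> bool) measure"
  assumes inv_\<mu>: "invariant_measure G \<mu>"

sublocale LO_action \<subseteq> pmp_action G \<mu> lo_act
proof -
  have b: "borel_prob_LO \<mu>" and d: "\<And>g. g \<in> G \<Longrightarrow> distr \<mu> \<mu> (lo_act g) = \<mu>"
    using inv_\<mu> by (auto simp: invariant_measure_def)
  have s: "sets \<mu> = sets LO_borel" using b by (simp add: borel_prob_LO_def)
  interpret prob_space \<mu> using b by (simp add: borel_prob_LO_def)
  show "pmp_action G \<mu> lo_act"
  proof
    show "lo_act g \<in> measurable \<mu> \<mu>" if "g \<in> G" for g
      using lo_act_measurable[OF bij_G[OF that]] unfolding measurable_cong_sets[OF s s] .
    show "lo_act (g \<circ> h) x = lo_act g (lo_act h x)" if "g \<in> G" "h \<in> G" for g h x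
      by (rule lo_act_comp[OF bij_G[OF that(1)] bij_G[OF that(2)]])
  qed (use d lo_act_id in auto)
qed

context LO_action
begin

lemma sets_\<mu> [measurable_cong, simp]: "sets \<mu> = sets LO_borel"
  and space_\<mu> [simp]: "space \<mu> = LO"
  using inv_\<mu> by (auto simp: invariant_measure_def borel_prob_LO_def)

definition lt :: "'a \<Rightarrow> 'a \<Rightarrow> ('a \<times> 'a \<Rightarrow> bool) \<Rightarrow> real" where
  "lt a b x = of_bool (x (a, b))"

definition \<eta> :: "'a \<Rightarrow> 'a \<Rightarrow> ('a \<times> 'a \<Rightarrow> bool) \<Rightarrow> real" where
  "\<eta> a c = cexp {a} (lt a c)"

definition pt :: 'a where "pt = undefined"

definition \<gamma> :: "'a \<Rightarrow> 'a \<Rightarrow> 'a" where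
  "\<gamma> a = (SOME g. g \<in> G \<and> g pt = a)"

text \<open>Reading the profile through \<open>\<gamma> a\<close> puts the profiles of all points
  into one space, as exchangeability requires. The arbitrary choice of \<open>\<gamma> a\<close> is
  harmless almost surely by \<open>\<eta>_eq_Y\<close>.\<close>

definition Y :: "'a \<Rightarrow> ('a \<times> 'a \<Rightarrow> bool) \<Rightarrow> 'a \<Rightarrow> real" where
  "Y a x d = \<eta> a (\<gamma> a d) x"

lemma \<gamma>: "\<gamma> a \<in> G" "\<gamma> a pt = a"
proof -
  have "\<exists>g. g \<in> G \<and> g pt = a" using transitive unfolding transitive_on_def by blast
  from someI_ex[OF this] show "\<gamma> a \<in> G" "\<gamma> a pt = a" unfolding \<gamma>_def by auto
qed

lemma lt_meas [measurable]: "lt a b \<in> borel_measurable \<mu>"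
proof -
  have "lt a b \<in> borel_measurable LO_borel"
    unfolding lt_def using pred_LO_borel by (rule measurable_compose) simp
  then show ?thesis by (simp cong: measurable_cong_sets)
qed

lemma bm_lt: "bm (lt a b)"
  by (rule bmI[OF lt_meas, where K=1]) (simp add: lt_def)

lemma lt_act: "g \<in> G \<Longrightarrow> lt (g a) (g b) (lo_act g x) = lt a b x"
  by (simp add: lt_def lo_act_apply)

lemma lt_meas_F: "lt a b \<in> borel_measurable (F {a, b})"
proof (rule meas_FI[OF lt_meas])
  have "lt a b (lo_act g x) = lt a b x" if "g \<in> stab G {a, b}" for g x
    using lt_act[of g a b x] stab_G[OF that] stab_fix[OF that, of a] stab_fix[OF that, of b] by simp
  then show "invf {a, b} (lt a b)" by (simp add: invf_def)
qed

lemma \<eta>_meas_F: "\<eta> a c \<in> borel_measurable (F {a})"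
  unfolding \<eta>_def by (rule borel_measurable_cond_exp)

lemma \<eta>_meas [measurable]: "\<eta> a c \<in> borel_measurable \<mu>"
  using \<eta>_meas_F meas_F_M by blast

lemma \<eta>_equiv:
  assumes "g \<in> G"
  shows "AE x in \<mu>. \<eta> (g a) (g c) (lo_act g x) = \<eta> a c x"
proof -
  have "(\<lambda>x. lt (g a) (g c) (lo_act g x)) = lt a c" using lt_act[OF assms] by auto
  then have "AE x in \<mu>. \<eta> a c x = \<eta> (g a) (g c) (lo_act g x)"
    using cexp_T[OF assms bm_lt[of "g a" "g c"], of "{a}"] unfolding \<eta>_def by simp
  then show ?thesis by eventually_elim simp
qed

lemma \<eta>_stab:
  assumes k: "k \<in> stab G {a}"
  shows "AE x in \<mu>. \<eta> a (k c) x = \<eta> a c x"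
proof -
  have "AE x in \<mu>. \<eta> a (k c) (lo_act k x) = \<eta> a c x"
    using \<eta>_equiv[OF stab_G[OF k], of a c] stab_fix[OF k, of a] by simp
  moreover have "AE x in \<mu>. \<eta> a (k c) (lo_act k x) = \<eta> a (k c) x"
    by (rule invfD[OF invf_of_meas[OF \<eta>_meas_F] k])
  ultimately show ?thesis by eventually_elim simp
qed

text \<open>Two elements carrying \<open>pt\<close> to \<open>a\<close> differ by an element of
  \<open>stab G {a}\<close>, which \<open>\<eta> a\<close> does not notice.\<close>

lemma \<eta>_eq_Y:
  assumes g: "g \<in> G" "g pt = a" "g d = c"
  shows "AE x in \<mu>. \<eta> a c x = Y a x d"
proof -
  define k where "k = g \<circ> inv (\<gamma> a)"
  have k: "k \<in> stab G {a}" unfolding k_def stab_def using g \<gamma>[of a]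
    by (auto intro!: comp_G inv_G simp: inv_eq_iff_G) (metis \<gamma> inv_apply)
  have "k (\<gamma> a d) = c" unfolding k_def using g \<gamma>[of a] by simp
  with \<eta>_stab[OF k, of "\<gamma> a d"] show ?thesis unfolding Y_def by simp
qed

lemma Y_meas_F: "Y a \<in> borel_measurable (F {a})"
  by (rule measurable_coordinatewise_then_product) (simp add: Y_def \<eta>_meas_F)

lemma Y_equivariant:
  assumes g: "g \<in> G"
  shows "AE x in \<mu>. Y (g a) (lo_act g x) = Y a x"
proof -
  have "AE x in \<mu>. \<forall>d. Y (g a) (lo_act g x) d = Y a x d"
    unfolding AE_all_countable
  proof
    fix d
    have "AE x in \<mu>. \<eta> (g a) (g (\<gamma> a d)) (lo_act g x) = Y (g a) (lo_act g x) d"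
      by (rule AE_T[OF g], rule \<eta>_eq_Y[where g="g \<circ> \<gamma> a"]) (use g \<gamma>[of a] comp_G in auto)
    moreover have "AE x in \<mu>. \<eta> (g a) (g (\<gamma> a d)) (lo_act g x) = \<eta> a (\<gamma> a d) x"
      by (rule \<eta>_equiv[OF g])
    ultimately show "AE x in \<mu>. Y (g a) (lo_act g x) d = Y a x d"
      by eventually_elim (simp add: Y_def)
  qed
  then show ?thesis by eventually_elim auto
qed

end

sublocale LO_action \<subseteq> EF: equivariant_family G \<mu> lo_act Y borel
  by unfold_locales (rule Y_meas_F Y_equivariant, assumption?)+

section \<open>Monotonicity, separation and comparability of profiles\<close>

context LO_action
begin

text \<open>By conditional independence \<open>\<eta> a c\<close> is also the conditional probability of \<open>a < c\<close> over
  the finer sigma-algebra \<open>F {a, b}\<close>, which contains the event \<open>a < b\<close>.\<close>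

lemma cexp_pair:
  assumes "a \<noteq> b" "b \<noteq> c"
  shows "AE x in \<mu>. cexp {a, b} (lt a c) x = \<eta> a c x"
proof -
  have eq: "{a, b} \<inter> {a, c} = {a}" using assms by auto
  show ?thesis unfolding \<eta>_def by (rule cexp_Int[OF _ _ bm_lt lt_meas_F, of "{a, b}" a c, unfolded eq]) auto
qed

text \<open>If \<open>a < b\<close>, then \<open>b < c\<close> implies \<open>a < c\<close>.
  Conditioning over \<open>F {a, b}\<close> keeps the resulting inequality: the event
  \<open>a < b\<close> is measurable there and factors out, and \<open>cexp_pair\<close> identifies
  what remains.\<close>

lemma \<eta>_mono:
  assumes d: "a \<noteq> b" "a \<noteq> c" "b \<noteq> c"
  shows "AE x in \<mu>. x (a, b) \<longrightarrow> \<eta> b c x \<le> \<eta> a c x"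
proof -
  interpret S: sigma_finite_subalgebra \<mu> "F {a, b}" by (rule sfs)
  have i: "integrable \<mu> (\<lambda>x. lt a b x * lt b c x)" "integrable \<mu> (\<lambda>x. lt a b x * lt a c x)"
    by (intro bm_integrable bm_mult bm_lt)+
  have "AE x in \<mu>. cexp {a, b} (\<lambda>x. lt a b x * lt b c x) x \<le> cexp {a, b} (\<lambda>x. lt a b x * lt a c x) x"
    by (rule S.real_cond_exp_mono[OF _ i]) (auto simp: lt_def intro!: AE_I2 dest: LO_trans)
  moreover have "AE x in \<mu>. cexp {a, b} (\<lambda>x. lt a b x * lt b c x) x = lt a b x * cexp {a, b} (lt b c) x"
    by (rule S.real_cond_exp_mult[OF lt_meas_F lt_meas i(1)])
  moreover have "AE x in \<mu>. cexp {a, b} (\<lambda>x. lt a b x * lt a c x) x = lt a b x * cexp {a, b} (lt a c) x"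
    by (rule S.real_cond_exp_mult[OF lt_meas_F lt_meas i(2)])
  moreover have "AE x in \<mu>. cexp {a, b} (lt a c) x = \<eta> a c x" using cexp_pair d by blast
  moreover have "AE x in \<mu>. cexp {a, b} (lt b c) x = \<eta> b c x"
    using cexp_pair[of b a c] d by (simp add: insert_commute)
  ultimately show ?thesis by eventually_elim (auto simp: lt_def)
qed

text \<open>When \<open>a < b\<close>, the indicator of \<open>a < c < b\<close> is
  \<open>lt a c - lt b c\<close>, whose conditional expectation over \<open>F {a, b}\<close> is
  \<open>\<eta> a c - \<eta> b c\<close>. This vanishes on the event \<open>N\<close>, which belongs
  to that sigma-algebra.\<close>

lemma no_point_between:
  assumes d: "a \<noteq> b" "a \<noteq> c" "b \<noteq> c"
  shows "AE x in \<mu>. \<eta> a c x = \<eta> b c x \<longrightarrow> \<not> (x (a, c) \<and> x (c, b))"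
proof -
  interpret S: sigma_finite_subalgebra \<mu> "F {a, b}" by (rule sfs)
  define N where "N = {x \<in> LO. \<eta> a c x = \<eta> b c x}"
  have [measurable]: "\<eta> a c \<in> borel_measurable (F {a, b})" "\<eta> b c \<in> borel_measurable (F {a, b})"
    by (rule meas_F_mono[OF \<eta>_meas_F], simp)+
  have "{x \<in> space (F {a, b}). \<eta> a c x = \<eta> b c x} \<in> sets (F {a, b})" by measurable
  then have NF: "N \<in> sets (F {a, b})" by (simp add: N_def)
  then have N: "N \<in> sets \<mu>" by (rule sets_F_M)
  define w where "w x = indicator N x * lt a b x" for x
  have bw: "bm w" unfolding w_def by (intro bm_mult bm_indicator N bm_lt)
  have wF: "w \<in> borel_measurable (F {a, b})"
    unfolding w_def using NF by (intro borel_measurable_times lt_meas_F) simp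
  define f where "f x = lt a c x * lt c b x" for x
  have eq: "f x = lt a b x * (lt a c x - lt b c x)" if "x \<in> LO" for x
  proof (cases "x (a, b)")
    case True
    have "x (a, c)" if "x (b, c)" using LO_trans[OF \<open>x \<in> LO\<close> True that] .
    moreover have "x (c, b) \<longleftrightarrow> \<not> x (b, c)" using LO_total LO_asym d \<open>x \<in> LO\<close> by metis
    ultimately show ?thesis using True by (auto simp: f_def lt_def)
  next
    case False
    then have "\<not> (x (a, c) \<and> x (c, b))" using LO_trans \<open>x \<in> LO\<close> by metis
    then show ?thesis using False by (auto simp: f_def lt_def)
  qed
  have "(\<integral>x. indicator N x * f x \<partial>\<mu>) = (\<integral>x. w x * lt a c x - w x * lt b c x \<partial>\<mu>)"
    by (rule Bochner_Integration.integral_cong) (auto simp: eq w_def algebra_simps)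
  also have "\<dots> = (\<integral>x. w x * lt a c x \<partial>\<mu>) - (\<integral>x. w x * lt b c x \<partial>\<mu>)"
    by (rule Bochner_Integration.integral_diff; intro bm_integrable bm_mult bw bm_lt)
  also have "(\<integral>x. w x * lt a c x \<partial>\<mu>) = (\<integral>x. w x * cexp {a, b} (lt a c) x \<partial>\<mu>)"
    by (rule S.real_cond_exp_intg(2)[symmetric]) (intro bm_integrable bm_mult bw bm_lt wF lt_meas)+
  also have "(\<integral>x. w x * lt b c x \<partial>\<mu>) = (\<integral>x. w x * cexp {a, b} (lt b c) x \<partial>\<mu>)"
    by (rule S.real_cond_exp_intg(2)[symmetric]) (intro bm_integrable bm_mult bw bm_lt wF lt_meas)+
  also have "(\<integral>x. w x * cexp {a, b} (lt a c) x \<partial>\<mu>) = (\<integral>x. w x * cexp {a, b} (lt b c) x \<partial>\<mu>)"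
  proof (rule integral_cong_AE)
    have "AE x in \<mu>. cexp {a, b} (lt a c) x = \<eta> a c x" using cexp_pair d by blast
    moreover have "AE x in \<mu>. cexp {a, b} (lt b c) x = \<eta> b c x"
      using cexp_pair[of b a c] d by (simp add: insert_commute)
    ultimately show "AE x in \<mu>. w x * cexp {a, b} (lt a c) x = w x * cexp {a, b} (lt b c) x"
      by eventually_elim (auto simp: w_def N_def indicator_def)
  qed (intro borel_measurable_times bm_meas[OF bw] meas_F_M[OF borel_measurable_cond_exp])+
  finally have zero: "(\<integral>x. indicator N x * f x \<partial>\<mu>) = 0" by simp
  have "AE x in \<mu>. indicator N x * f x = 0"
  proof (rule integral_nonneg_eq_0_iff_AE[THEN iffD1, OF _ _ zero])
    show "integrable \<mu> (\<lambda>x. indicator N x * f x)" unfolding f_def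
      by (intro bm_integrable bm_mult bm_indicator N bm_lt)
  qed (auto simp: f_def lt_def)
  then show ?thesis
    using AE_space by eventually_elim (auto simp: N_def f_def lt_def)
qed

definition same_profile :: "'a \<Rightarrow> 'a \<Rightarrow> ('a \<times> 'a \<Rightarrow> bool) \<Rightarrow> bool" where
  "same_profile a b x \<longleftrightarrow> (\<forall>c. c \<noteq> a \<longrightarrow> c \<noteq> b \<longrightarrow> \<eta> a c x = \<eta> b c x)"

lemma same_profile_act:
  assumes k: "k \<in> stab G {a}"
  shows "AE x in \<mu>. same_profile a (k b) (lo_act k x) \<longleftrightarrow> same_profile a b x"
proof -
  have kG: "k \<in> G" and ka: "k a = a" using k by (auto simp: stab_def)
  have "AE x in \<mu>. \<forall>c. \<eta> a (k c) (lo_act k x) = \<eta> a c x \<and> \<eta> (k b) (k c) (lo_act k x) = \<eta> b c x"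
    unfolding AE_all_countable using \<eta>_equiv[OF kG, of a] \<eta>_equiv[OF kG, of b] ka by auto
  then show ?thesis
  proof eventually_elim
    case (elim x)
    have "same_profile a (k b) (lo_act k x) \<longleftrightarrow>
      (\<forall>c. k c \<noteq> a \<longrightarrow> k c \<noteq> k b \<longrightarrow> \<eta> a (k c) (lo_act k x) = \<eta> (k b) (k c) (lo_act k x))"
      unfolding same_profile_def using kG by (metis apply_inv)
    also have "\<dots> \<longleftrightarrow> same_profile a b x"
      unfolding same_profile_def using elim kG by (metis apply_eq_iff_G ka)
    finally show ?case .
  qed
qed

text \<open>Points with the same profile as \<open>a\<close> have no point between themselves and \<open>a\<close>, so there are
  at most two of them; by conditional independence over \<open>a\<close> there are then none.\<close>

lemma different_profiles:
  assumes "a \<noteq> b"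
  shows "AE x in \<mu>. \<exists>c. c \<noteq> a \<and> c \<noteq> b \<and> \<eta> a c x \<noteq> \<eta> b c x"
proof -
  have "infinite {k b | k. k \<in> stab G {a}}" by (rule infinite_orbit) (use assms in auto)
  then obtain \<beta> :: "nat \<Rightarrow> 'a" where \<beta>: "inj \<beta>" "range \<beta> \<subseteq> {k b | k. k \<in> stab G {a}}"
    using infinite_countable_subset by blast
  have ex: "\<exists>k. \<beta> i = k b \<and> k \<in> stab G {a}" for i
  proof -
    have "\<beta> i \<in> {k b | k. k \<in> stab G {a}}" using \<beta>(2) by (rule subsetD) simp
    then show ?thesis unfolding mem_Collect_eq .
  qed
  define k where "k i = (SOME k. \<beta> i = k b \<and> k \<in> stab G {a})" for i
  have k: "k i \<in> stab G {a}" "k i b = \<beta> i" for i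
    using someI_ex[OF ex[of i], folded k_def] by auto
  have \<beta>a: "\<beta> i \<noteq> a" for i
    using apply_eq_iff_G[OF stab_G[OF k(1)], of i b a] stab_fix[OF k(1), of a i] k(2) assms by simp
  have \<beta>i: "\<beta> i = \<beta> j \<longleftrightarrow> i = j" for i j using \<beta>(1) by (simp add: inj_eq)
  define f where "f b x = (of_bool (same_profile a b x) :: real)" for b x
  have [measurable]: "Measurable.pred (F {a, b}) (\<lambda>x. \<eta> a c x = \<eta> b c x)" for b c
  proof -
    have [measurable]: "\<eta> a c \<in> borel_measurable (F {a, b})" "\<eta> b c \<in> borel_measurable (F {a, b})"
      by (rule meas_F_mono[OF \<eta>_meas_F], simp)+
    show ?thesis unfolding pred_def by measurable
  qed
  have fF: "f b \<in> borel_measurable (F {a, b})" for b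
    unfolding f_def same_profile_def by measurable
  have bf: "bm (f b)" for b
    by (rule bmI[OF meas_F_M[OF fF], where K=1]) (simp add: f_def)
  obtain e where e: "bm e" "e \<in> borel_measurable (F {a})" "AE x in \<mu>. cexp {a} (f b) x = e x"
    using cexp_bounded_version[OF bf] by blast
  have ce: "AE x in \<mu>. cexp {a} (f (\<beta> i)) x = e x" for i
  proof -
    have "AE x in \<mu>. f (\<beta> i) (lo_act (k i) x) = f b x"
      using same_profile_act[OF k(1)[of i], of b] unfolding k(2) by eventually_elim (simp add: f_def)
    from cexp_cong_stab[OF k(1) bf bf this] e(3) show ?thesis by eventually_elim simp
  qed
  \<comment> \<open>Three translates force two onto the same side of \<open>a\<close>, and the
    nearer of these lies between \<open>a\<close> and the other. So the product vanishes almost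
    surely, and the nonnegative function \<open>e\<close> has third moment zero.\<close>
  have "(\<integral>x. 1 * (\<Prod>i<3. f (\<beta> i) x) \<partial>\<mu>) = (\<integral>x. 1 * (\<Prod>i<3::nat. e x) \<partial>\<mu>)"
  proof (rule integral_prod_cond_indep[where C="{a}" and b=\<beta>])
    show "inj_on \<beta> {..<3}" using \<beta>(1) by (rule inj_on_subset) simp
    show "f (\<beta> i) \<in> borel_measurable (F {\<beta> i, a})" for i
      unfolding insert_commute[of "\<beta> i" a "{}"] by (rule fF)
  qed (use \<beta>a bf e ce bm_const in auto)
  also have "(\<integral>x. 1 * (\<Prod>i<3. f (\<beta> i) x) \<partial>\<mu>) = (\<integral>x. 0 \<partial>\<mu>)"
  proof (rule integral_cong_AE)
    have "AE x in \<mu>. \<forall>i j. i \<noteq> j \<longrightarrow>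
        (\<eta> a (\<beta> j) x = \<eta> (\<beta> i) (\<beta> j) x \<longrightarrow> \<not> (x (a, \<beta> j) \<and> x (\<beta> j, \<beta> i))) \<and>
        (\<eta> (\<beta> i) (\<beta> j) x = \<eta> a (\<beta> j) x \<longrightarrow> \<not> (x (\<beta> i, \<beta> j) \<and> x (\<beta> j, a)))"
      unfolding AE_all_countable
    proof (intro allI)
      fix i j
      show "AE x in \<mu>. i \<noteq> j \<longrightarrow>
        (\<eta> a (\<beta> j) x = \<eta> (\<beta> i) (\<beta> j) x \<longrightarrow> \<not> (x (a, \<beta> j) \<and> x (\<beta> j, \<beta> i))) \<and>
        (\<eta> (\<beta> i) (\<beta> j) x = \<eta> a (\<beta> j) x \<longrightarrow> \<not> (x (\<beta> i, \<beta> j) \<and> x (\<beta> j, a)))"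
      proof (cases "i = j")
        case False
        then have "a \<noteq> \<beta> i" "a \<noteq> \<beta> j" "\<beta> i \<noteq> \<beta> j" using \<beta>a[of i] \<beta>a[of j] \<beta>i by auto
        then show ?thesis
          using no_point_between[of a "\<beta> i" "\<beta> j"] no_point_between[of "\<beta> i" a "\<beta> j"] by auto
      qed simp
    qed
    then show "AE x in \<mu>. 1 * (\<Prod>i<3. f (\<beta> i) x) = 0"
      using AE_space
    proof eventually_elim
      case (elim x)
      have x: "x \<in> LO" using elim by simp
      have btw: "\<not> (x (a, \<beta> j) \<and> x (\<beta> j, \<beta> i))" "\<not> (x (\<beta> i, \<beta> j) \<and> x (\<beta> j, a))"
        if "same_profile a (\<beta> i) x" "i \<noteq> j" for i j
        using elim(1) that \<beta>a \<beta>i unfolding same_profile_def by metis+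
      have "\<not> (same_profile a (\<beta> 0) x \<and> same_profile a (\<beta> 1) x \<and> same_profile a (\<beta> 2) x)"
      proof
        assume P: "same_profile a (\<beta> 0) x \<and> same_profile a (\<beta> 1) x \<and> same_profile a (\<beta> 2) x"
        have opp: "x (a, \<beta> i) \<longleftrightarrow> x (\<beta> j, a)"
          if ij: "i \<noteq> j" "same_profile a (\<beta> i) x" "same_profile a (\<beta> j) x" for i j
        proof -
          have t: "x (\<beta> i, \<beta> j) \<or> x (\<beta> j, \<beta> i)" using LO_total[OF x] \<beta>i ij by metis
          have "x (a, \<beta> i) \<or> x (\<beta> i, a)" "x (a, \<beta> j) \<or> x (\<beta> j, a)" using LO_total[OF x] \<beta>a by metis+
          then show ?thesis
            using t btw[OF ij(2,1)] btw[OF ij(3) ij(1)[symmetric]] LO_asym[OF x] by blast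
        qed
        have "x (a, \<beta> 0) \<longleftrightarrow> x (\<beta> 1, a)" "x (a, \<beta> 0) \<longleftrightarrow> x (\<beta> 2, a)" "x (a, \<beta> 1) \<longleftrightarrow> x (\<beta> 2, a)"
          using P by (intro opp; simp)+
        then show False using LO_total[OF x, of a "\<beta> 1"] LO_asym[OF x] \<beta>a[of 1] LO_total[OF x, of a "\<beta> 0"] \<beta>a[of 0]
          by metis
      qed
      then show ?case by (auto simp: f_def numeral_3_eq_3 numeral_2_eq_2)
    qed
  qed (use bf bm_meas in \<open>auto intro!: borel_measurable_prod\<close>)
  finally have zero: "(\<integral>x. e x ^ 3 \<partial>\<mu>) = 0" by simp
  interpret S: sigma_finite_subalgebra \<mu> "F {a}" by (rule sfs)
  have "AE x in \<mu>. cexp {a} (f b) x \<ge> 0"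
    by (rule S.real_cond_exp_pos) (use bf bm_meas in \<open>auto simp: f_def\<close>)
  with e(3) have pos: "AE x in \<mu>. e x \<ge> 0" by eventually_elim simp
  have "AE x in \<mu>. e x ^ 3 = 0"
  proof (rule integral_nonneg_eq_0_iff_AE[THEN iffD1, OF _ _ zero])
    show "integrable \<mu> (\<lambda>x. e x ^ 3)"
      unfolding power3_eq_cube by (intro bm_integrable bm_mult e)
    show "AE x in \<mu>. 0 \<le> e x ^ 3" using pos by eventually_elim simp
  qed
  then have e0: "AE x in \<mu>. e x = 0" by simp
  have "(\<integral>x. f b x \<partial>\<mu>) = (\<integral>x. cexp {a} (f b) x \<partial>\<mu>)"
    by (rule S.real_cond_exp_int(2)[symmetric, OF bm_integrable[OF bf]])
  also have "\<dots> = (\<integral>x. 0 \<partial>\<mu>)"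
    by (rule integral_cong_AE) (use e(3) e0 in \<open>auto intro: meas_F_M[OF borel_measurable_cond_exp]\<close>)
  finally have "(\<integral>x. f b x \<partial>\<mu>) = 0" by simp
  then have "AE x in \<mu>. f b x = 0"
    by (rule integral_nonneg_eq_0_iff_AE[THEN iffD1, OF bm_integrable[OF bf], rotated]) (simp add: f_def)
  then show ?thesis by eventually_elim (auto simp: f_def same_profile_def)
qed

text \<open>Choose \<open>h\<close> fixing \<open>c\<close> and \<open>c'\<close> but moving
  \<open>a\<close>. For \<open>a\<close> and \<open>h a\<close> the coordinates \<open>d\<close> and
  \<open>d'\<close> stand for the same points \<open>c\<close> and \<open>c'\<close>, so
  \<open>\<eta>_mono\<close> applies at both, and the order of \<open>a\<close> and
  \<open>h a\<close> excludes a crossing. Exchangeability carries this null event to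
  \<open>(a, b)\<close>, where the coordinates need not belong to common points.\<close>

lemma comparable:
  assumes d: "d \<noteq> pt" "d' \<noteq> pt"
  shows "AE x in \<mu>. \<not> (Y a x d > Y b x d \<and> Y a x d' < Y b x d')"
proof (cases "a = b")
  case False
  define c c' where "c = \<gamma> a d" and "c' = \<gamma> a d'"
  have ca: "c \<noteq> a" "c' \<noteq> a" unfolding c_def c'_def using d \<gamma>[of a] by (metis apply_eq_iff_G)+
  have "infinite {h a | h. h \<in> stab G {c, c'}}" by (rule infinite_orbit) (use ca in auto)
  then have "\<not> {h a | h. h \<in> stab G {c, c'}} \<subseteq> {a}" using finite_subset by blast
  then obtain h where h: "h \<in> stab G {c, c'}" "h a \<noteq> a" by blast
  have hG: "h \<in> G" "h c = c" "h c' = c'" using h by (auto simp: stab_def)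
  have hc: "h a \<noteq> c" "h a \<noteq> c'" using ca hG by (metis apply_eq_iff_G)+
  have Yh: "AE x in \<mu>. \<eta> (h a) c x = Y (h a) x d" "AE x in \<mu>. \<eta> (h a) c' x = Y (h a) x d'"
    by (rule \<eta>_eq_Y[where g="h \<circ> \<gamma> a"]; use hG \<gamma>[of a] comp_G in \<open>auto simp: c_def c'_def\<close>)+
  have m: "AE x in \<mu>. x (a, h a) \<longrightarrow> \<eta> (h a) c x \<le> \<eta> a c x" "AE x in \<mu>. x (h a, a) \<longrightarrow> \<eta> a c x \<le> \<eta> (h a) c x"
    "AE x in \<mu>. x (a, h a) \<longrightarrow> \<eta> (h a) c' x \<le> \<eta> a c' x" "AE x in \<mu>. x (h a, a) \<longrightarrow> \<eta> a c' x \<le> \<eta> (h a) c' x"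
    by (rule \<eta>_mono; use h hc ca in metis)+
  have good: "AE x in \<mu>. \<not> (Y a x d > Y (h a) x d \<and> Y a x d' < Y (h a) x d')"
    using Yh m AE_space
  proof eventually_elim
    case (elim x)
    have Ya: "Y a x d = \<eta> a c x" "Y a x d' = \<eta> a c' x" by (simp_all add: Y_def c_def c'_def)
    have "x (a, h a) \<or> x (h a, a)" using elim h by (intro LO_total) auto
    then show ?case
    proof
      assume "x (a, h a)"
      then have "\<eta> (h a) c' x \<le> \<eta> a c' x" using elim by blast
      then show ?thesis using elim(2) Ya by simp
    next
      assume "x (h a, a)"
      then have "\<eta> a c x \<le> \<eta> (h a) c x" using elim by blast
      then show ?thesis using elim(1) Ya by simp
    qed
  qed
  define Q where "Q = {t \<in> space (PiM {..<2::nat} (\<lambda>_. borel :: ('a \<Rightarrow> real) measure)).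
    t 0 d > t 1 d \<and> t 0 d' < t 1 d'}"
  have [measurable]: "(\<lambda>t. t i e) \<in> borel_measurable (PiM {..<2::nat} (\<lambda>_. borel :: ('a \<Rightarrow> real) measure))"
    if "i < 2" for i e
  proof -
    have "(\<lambda>t. t i) \<in> measurable (PiM {..<2::nat} (\<lambda>_. borel :: ('a \<Rightarrow> real) measure)) borel"
      by (rule measurable_component_singleton) (use that in simp)
    then show ?thesis by (rule measurable_compose) (rule measurable_product_coordinates)
  qed
  have Q: "Q \<in> sets (PiM {..<2::nat} (\<lambda>_. borel))" unfolding Q_def by measurable
  define p where "p z i = (if i = 0 then a else z)" for z :: 'a and i :: nat
  have p: "inj_on (p z) {..<2}" if "z \<noteq> a" for z using that by (auto simp: inj_on_def p_def less_2_cases_iff)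
  have PQ: "{x \<in> LO. EF.tuple 2 (p z) x \<in> Q} = {x \<in> LO. Y a x d > Y z x d \<and> Y a x d' < Y z x d'}" for z
    by (auto simp: Q_def EF.tuple_def p_def space_PiM)
  define X where "X z = {x \<in> LO. Y a x d > Y z x d \<and> Y a x d' < Y z x d'}" for z
  have XM: "X z \<in> events" for z
    using EF.tuple_event[OF Q, of "p z"] unfolding X_def space_\<mu> PQ .
  have "prob {x \<in> space \<mu>. EF.tuple 2 (p b) x \<in> Q} = prob {x \<in> space \<mu>. EF.tuple 2 (p (h a)) x \<in> Q}"
    by (rule EF.prob_tuple_eq[OF p p Q]) (use False h(2) in auto)
  then have "prob (X b) = prob (X (h a))" unfolding X_def PQ[symmetric] space_\<mu> .
  moreover have "AE x in \<mu>. x \<notin> X (h a)" using good by eventually_elim (simp add: X_def)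
  ultimately have "prob (X b) = 0" using prob_eq_0[OF XM] by simp
  then have "AE x in \<mu>. x \<notin> X b" using prob_eq_0[OF XM] by simp
  then show ?thesis using AE_space by eventually_elim (simp add: X_def)
qed simp

end

subsection \<open>Typical orders\<close>

context tame_group
begin

definition homogeneous :: "('a \<times> 'a \<Rightarrow> bool) \<Rightarrow> 'a set \<Rightarrow> bool" where
  "homogeneous x B \<longleftrightarrow>
    (\<forall>a\<in>B. \<forall>b\<in>B. \<forall>a'\<in>B. \<forall>b'\<in>B. ty a b = ty a' b' \<longrightarrow> x (a, b) \<longrightarrow> x (a', b'))"

definition types :: "'a list set set" where
  "types = range (\<lambda>(a, b). ty a b)"

lemma finite_types': "finite types" "finite (Pow types)"
  using finite_types by (auto simp: types_def)

lemma ty_types: "ty a b \<in> types"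
  by (force simp: types_def)

lemma ty_eq_neq: "ty a b = ty a' b' \<Longrightarrow> a \<noteq> b \<Longrightarrow> a' \<noteq> b'"
  by (auto simp: ty_eq_iff apply_eq_iff_G)

text \<open>There are finitely many sets of types, so one of them describes the order on arbitrarily large
  finite sets.\<close>

lemma invariant_order_if_homogeneous:
  fixes e :: "'a \<Rightarrow> nat"
  assumes e: "inj e" and hom: "\<And>B. finite B \<Longrightarrow> \<exists>x\<in>LO. homogeneous x B"
  shows "\<exists>x\<in>LO. \<forall>g\<in>G. lo_act g x = x"
proof -
  define B where "B n = {a. e a < n}" for n
  have "finite (B n)" for n
    unfolding B_def using finite_vimageI[OF finite_lessThan[of n] e] by (simp add: vimage_def)
  then have ex: "\<exists>x. x \<in> LO \<and> homogeneous x (B n)" for n using hom by blast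
  define X where "X n = (SOME x. x \<in> LO \<and> homogeneous x (B n))" for n
  have X: "X n \<in> LO" "homogeneous (X n) (B n)" for n
    using someI_ex[OF ex[of n], folded X_def] by auto
  define r where "r n = {ty a b | a b. a \<in> B n \<and> b \<in> B n \<and> X n (a, b)}" for n
  have "range r \<subseteq> Pow types" using ty_types by (auto simp: r_def)
  then have "finite (range r)" using finite_types'(2) finite_subset by blast
  then obtain n0 where inf: "infinite {n \<in> UNIV. r n = r n0}"
    using pigeonhole_infinite[of UNIV r] by auto
  define x where "x = (\<lambda>(a, b). ty a b \<in> r n0)"
  have agree: "\<exists>n. \<forall>a\<in>A. \<forall>b\<in>A. x (a, b) \<longleftrightarrow> X n (a, b)" if A: "finite A" for A
  proof -
    obtain m where m: "\<And>a. a \<in> A \<Longrightarrow> e a < m"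
      using finite_nat_set_iff_bounded[of "e ` A"] A by auto
    obtain n where n: "n \<ge> m" "r n = r n0"
      using inf unfolding infinite_nat_iff_unbounded_le by blast
    have AB: "a \<in> B n" if "a \<in> A" for a using m[OF that] n by (simp add: B_def)
    have "x (a, b) \<longleftrightarrow> X n (a, b)" if ab: "a \<in> A" "b \<in> A" for a b
    proof
      assume "x (a, b)"
      then have "ty a b \<in> r n" using n by (simp add: x_def)
      then obtain a' b' where "ty a b = ty a' b'" "a' \<in> B n" "b' \<in> B n" "X n (a', b')"
        unfolding r_def by blast
      then show "X n (a, b)" using X(2)[of n] AB ab unfolding homogeneous_def by metis
    next
      assume "X n (a, b)"
      then have "ty a b \<in> r n" unfolding r_def using AB ab by blast
      then show "x (a, b)" using n by (simp add: x_def)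
    qed
    then show ?thesis by blast
  qed
  have "x \<in> LO" unfolding LO_def mem_Collect_eq
  proof (intro conjI allI impI)
    fix a b c
    obtain n where n: "\<forall>u\<in>{a, b, c}. \<forall>v\<in>{a, b, c}. x (u, v) \<longleftrightarrow> X n (u, v)"
      using agree[of "{a, b, c}"] by auto
    show "\<not> x (a, a)" using n LO_irrefl[OF X(1)] by simp
    show "x (a, c)" if "x (a, b)" "x (b, c)" using n that LO_trans[OF X(1)[of n], of a b c] by simp
    show "x (a, b) \<or> x (b, a)" if "a \<noteq> b" using n LO_total[OF X(1)[of n] that] by simp
  qed
  moreover have "lo_act g x = x" if "g \<in> G" for g
    using ty_apply[OF inv_G[OF that]] by (auto simp: lo_act_def x_def fun_eq_iff)
  ultimately show ?thesis by blast
qed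

end

section \<open>Scores and the almost sure properties of an order\<close>

context LO_action
begin

text \<open>Representatives of the orbits of \<open>stab G {pt}\<close> off \<open>pt\<close>;
  categoricity makes finitely many suffice. Typical profiles are constant on these orbits, so a
  finite sum detects every strict increase between comparable profiles.\<close>

definition reps :: "'a set" where
  "reps = (SOME D. finite D \<and> pt \<notin> D \<and> (\<forall>d. d \<noteq> pt \<longrightarrow> (\<exists>d0\<in>D. \<exists>k\<in>stab G {pt}. k d0 = d)))"

definition sc :: "('a \<Rightarrow> real) \<Rightarrow> real" where
  "sc y = (\<Sum>d\<in>reps. y d)"

definition s :: "'a \<Rightarrow> ('a \<times> 'a \<Rightarrow> bool) \<Rightarrow> real" where
  "s a x = sc (Y a x)"

lemma reps: "finite reps" "pt \<notin> reps" "d \<noteq> pt \<Longrightarrow> \<exists>d0\<in>reps. \<exists>k\<in>stab G {pt}. k d0 = d"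
proof -
  have "ty pt ` (- {pt}) \<subseteq> types" using ty_types by auto
  then have "finite (ty pt ` (- {pt}))" using finite_types'(1) finite_subset by blast
  then obtain D where D: "D \<subseteq> - {pt}" "finite D" "ty pt ` (- {pt}) = ty pt ` D"
    by (meson finite_subset_image order_refl)
  have "\<exists>d0\<in>D. \<exists>k\<in>stab G {pt}. k d0 = d" if "d \<noteq> pt" for d
  proof -
    have "ty pt d \<in> ty pt ` D" using D(3) that by blast
    then obtain d0 where d0: "d0 \<in> D" "ty pt d0 = ty pt d" by (metis imageE)
    then obtain k where "k \<in> G" "k pt = pt" "k d0 = d" by (auto simp: ty_eq_iff)
    then show ?thesis using d0 by (auto simp: stab_def)
  qed
  then have "\<exists>D. finite D \<and> pt \<notin> D \<and> (\<forall>d. d \<noteq> pt \<longrightarrow> (\<exists>d0\<in>D. \<exists>k\<in>stab G {pt}. k d0 = d))"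
    using D by blast
  from someI_ex[OF this, folded reps_def]
  show "finite reps" "pt \<notin> reps" "d \<noteq> pt \<Longrightarrow> \<exists>d0\<in>reps. \<exists>k\<in>stab G {pt}. k d0 = d" by blast+
qed

text \<open>The almost sure statements are gathered for all points at once, so that what follows for
  a fixed \<open>x\<close> is deterministic. In the fourth clause the transporter \<open>g\<close>
  is quantified inside the premise: the points form a countable set, whereas \<open>G\<close> may be
  uncountable.\<close>

definition good :: "('a \<times> 'a \<Rightarrow> bool) \<Rightarrow> bool" where
  "good x \<longleftrightarrow> x \<in> LO \<and>
    (\<forall>a b c. a \<noteq> b \<longrightarrow> a \<noteq> c \<longrightarrow> b \<noteq> c \<longrightarrow> x (a, b) \<longrightarrow> \<eta> b c x \<le> \<eta> a c x) \<and>
    (\<forall>a b. a \<noteq> b \<longrightarrow> (\<exists>c. c \<noteq> a \<and> c \<noteq> b \<and> \<eta> a c x \<noteq> \<eta> b c x)) \<and>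
    (\<forall>a c d. (\<exists>g\<in>G. g pt = a \<and> g d = c) \<longrightarrow> \<eta> a c x = Y a x d) \<and>
    (\<forall>a b d d'. d \<noteq> pt \<longrightarrow> d' \<noteq> pt \<longrightarrow> \<not> (Y a x d > Y b x d \<and> Y a x d' < Y b x d'))"

lemma AE_good: "AE x in \<mu>. good x"
proof -
  have "AE x in \<mu>. \<forall>a b c. a \<noteq> b \<longrightarrow> a \<noteq> c \<longrightarrow> b \<noteq> c \<longrightarrow> x (a, b) \<longrightarrow> \<eta> b c x \<le> \<eta> a c x"
    unfolding AE_all_countable
  proof (intro allI)
    fix a b c
    show "AE x in \<mu>. a \<noteq> b \<longrightarrow> a \<noteq> c \<longrightarrow> b \<noteq> c \<longrightarrow> x (a, b) \<longrightarrow> \<eta> b c x \<le> \<eta> a c x"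
    proof (cases "a \<noteq> b \<and> a \<noteq> c \<and> b \<noteq> c")
      case True
      then show ?thesis using \<eta>_mono[of a b c] by simp
    qed auto
  qed
  moreover have "AE x in \<mu>. \<forall>a b. a \<noteq> b \<longrightarrow> (\<exists>c. c \<noteq> a \<and> c \<noteq> b \<and> \<eta> a c x \<noteq> \<eta> b c x)"
    unfolding AE_all_countable
  proof (intro allI)
    fix a b
    show "AE x in \<mu>. a \<noteq> b \<longrightarrow> (\<exists>c. c \<noteq> a \<and> c \<noteq> b \<and> \<eta> a c x \<noteq> \<eta> b c x)"
      using different_profiles[of a b] by (cases "a = b") simp_all
  qed
  moreover have "AE x in \<mu>. \<forall>a c d. (\<exists>g\<in>G. g pt = a \<and> g d = c) \<longrightarrow> \<eta> a c x = Y a x d"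
    unfolding AE_all_countable
  proof (intro allI)
    fix a c d
    show "AE x in \<mu>. (\<exists>g\<in>G. g pt = a \<and> g d = c) \<longrightarrow> \<eta> a c x = Y a x d"
    proof (cases "\<exists>g\<in>G. g pt = a \<and> g d = c")
      case True
      then obtain g where "g \<in> G" "g pt = a" "g d = c" by blast
      from \<eta>_eq_Y[OF this] show ?thesis by eventually_elim simp
    next
      case False
      then show ?thesis by (intro AE_I2) blast
    qed
  qed
  moreover have "AE x in \<mu>. \<forall>a b d d'. d \<noteq> pt \<longrightarrow> d' \<noteq> pt \<longrightarrow> \<not> (Y a x d > Y b x d \<and> Y a x d' < Y b x d')"
    unfolding AE_all_countable
  proof (intro allI)
    fix a b d d'
    show "AE x in \<mu>. d \<noteq> pt \<longrightarrow> d' \<noteq> pt \<longrightarrow> \<not> (Y a x d > Y b x d \<and> Y a x d' < Y b x d')"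
    proof (cases "d \<noteq> pt \<and> d' \<noteq> pt")
      case True
      then show ?thesis using comparable[of d d' b a] by simp
    qed auto
  qed
  ultimately show ?thesis using AE_space
    by eventually_elim (simp only: good_def space_\<mu> simp_thms)
qed

text \<open>For typical \<open>x\<close>, the relation \<open>a < b\<close> can be read off the profiles of \<open>a\<close> and \<open>b\<close>, in a way that
  depends only on the type of \<open>(a, b)\<close>.\<close>

definition rel :: "'a \<Rightarrow> 'a \<Rightarrow> ('a \<Rightarrow> real) \<Rightarrow> ('a \<Rightarrow> real) \<Rightarrow> bool" where
  "rel p q y y' \<longleftrightarrow> (\<exists>c. c \<noteq> p \<and> c \<noteq> q \<and> y (inv (\<gamma> p) c) > y' (inv (\<gamma> q) c))"

lemma inv_\<gamma>_pt: "c \<noteq> p \<Longrightarrow> inv (\<gamma> p) c \<noteq> pt"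
  using \<gamma>[of p] inv_eq_iff_G[of "\<gamma> p" c pt] by simp

context
  fixes x assumes good: "good x"
begin

lemmas good_LO = good[unfolded good_def, THEN conjunct1]
  and good_\<eta>_mono = good[unfolded good_def, THEN conjunct2, THEN conjunct1, rule_format]
  and good_profiles = good[unfolded good_def, THEN conjunct2, THEN conjunct2, THEN conjunct1, rule_format]
  and good_\<eta>_eq_Y' = good[unfolded good_def, THEN conjunct2, THEN conjunct2, THEN conjunct2, THEN conjunct1, rule_format]
  and good_comparable' = good[unfolded good_def, THEN conjunct2, THEN conjunct2, THEN conjunct2, THEN conjunct2, rule_format]

lemma good_\<eta>_eq_Y: "g \<in> G \<Longrightarrow> g pt = a \<Longrightarrow> g d = c \<Longrightarrow> \<eta> a c x = Y a x d"
  by (rule good_\<eta>_eq_Y') blast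

lemma good_comparable: "d \<noteq> pt \<Longrightarrow> d' \<noteq> pt \<Longrightarrow> Y a x d > Y b x d \<Longrightarrow> \<not> Y a x d' < Y b x d'"
  using good_comparable'[of d d' b a] by simp

lemma good_Y_stab:
  assumes k: "k \<in> stab G {pt}"
  shows "Y a x (k d) = Y a x d"
proof -
  have "\<eta> a (\<gamma> a (k d)) x = Y a x (k d)" by (rule good_\<eta>_eq_Y[OF \<gamma>(1)]) (auto simp: \<gamma>)
  moreover have "\<eta> a (\<gamma> a (k d)) x = Y a x d"
    by (rule good_\<eta>_eq_Y[OF comp_G[OF \<gamma>(1)[of a] stab_G[OF k]]]) (auto simp: \<gamma> stab_fix[OF k])
  ultimately show ?thesis by simp
qed

text \<open>By comparability, one coordinate in the wrong direction forces the weak wrong direction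
  at all others; moved to a representative, it makes the sums differ strictly in the wrong
  direction.\<close>

lemma good_Y_le:
  assumes "s a x \<le> s b x" "d \<noteq> pt"
  shows "Y a x d \<le> Y b x d"
proof (rule ccontr)
  assume "\<not> Y a x d \<le> Y b x d"
  then have gt: "Y a x d > Y b x d" by simp
  have ge: "Y a x d' \<ge> Y b x d'" if "d' \<noteq> pt" for d'
    using good_comparable[OF assms(2) that gt] by simp
  obtain d0 k where d0: "d0 \<in> reps" "k \<in> stab G {pt}" "k d0 = d" using reps(3)[OF assms(2)] by blast
  have "Y a x d0 > Y b x d0" using gt good_Y_stab[OF d0(2)] d0(3) by metis
  moreover have "Y a x e \<ge> Y b x e" if "e \<in> reps" for e using ge reps(2) that by metis
  ultimately have "s b x < s a x"
    unfolding s_def sc_def using d0(1) reps(1) by (intro sum_strict_mono_ex1) auto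
  then show False using assms by simp
qed

lemma good_less_iff:
  assumes "a \<noteq> b"
  shows "x (a, b) \<longleftrightarrow> rel a b (Y a x) (Y b x)"
proof -
  have Y: "Y p x (inv (\<gamma> p) c) = \<eta> p c x" for p c by (simp add: Y_def apply_inv[OF \<gamma>(1)])
  show ?thesis unfolding rel_def Y
  proof
    assume ab: "x (a, b)"
    obtain c where c: "c \<noteq> a" "c \<noteq> b" "\<eta> a c x \<noteq> \<eta> b c x"
      using good_profiles[OF assms] by blast
    then have "\<eta> b c x \<le> \<eta> a c x" using good_\<eta>_mono[of a b c] ab assms by blast
    with c show "\<exists>c. c \<noteq> a \<and> c \<noteq> b \<and> \<eta> b c x < \<eta> a c x" by (intro exI[of _ c]) simp
  next
    assume "\<exists>c. c \<noteq> a \<and> c \<noteq> b \<and> \<eta> b c x < \<eta> a c x"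
    then obtain c where c: "c \<noteq> a" "c \<noteq> b" "\<eta> b c x < \<eta> a c x" by blast
    have "\<not> x (b, a)" using good_\<eta>_mono[of b a c] c assms by auto
    then show "x (a, b)" using LO_total[OF good_LO assms] by blast
  qed
qed

text \<open>An element carrying \<open>(p, q)\<close> to \<open>(a, b)\<close> changes the
  base-point coordinates by elements of \<open>stab G {pt}\<close>, which typical profiles do not
  see. The points \<open>u\<close> and \<open>v\<close> supplying the profiles need not be related
  to either pair.\<close>

lemma good_rel_ty:
  assumes "ty p q = ty a b" "rel p q (Y u x) (Y v x)"
  shows "rel a b (Y u x) (Y v x)"
proof -
  obtain g where g: "g \<in> G" "g p = a" "g q = b" using assms(1) by (auto simp: ty_eq_iff)
  have eq: "Y u x (inv (\<gamma> (g p)) (g c)) = Y u x (inv (\<gamma> p) c)" for u p c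
  proof -
    define k where "k = inv (\<gamma> (g p)) \<circ> (g \<circ> \<gamma> p)"
    have "k \<in> G" unfolding k_def by (intro comp_G inv_G \<gamma> g)
    moreover have "k pt = pt" unfolding k_def using \<gamma>[of p] \<gamma>[of "g p"] by (simp add: inv_eq_iff_G)
    ultimately have "k \<in> stab G {pt}" by (simp add: stab_def)
    moreover have "k (inv (\<gamma> p) c) = inv (\<gamma> (g p)) (g c)" by (simp add: k_def apply_inv[OF \<gamma>(1)])
    ultimately show ?thesis using good_Y_stab by metis
  qed
  obtain c where c: "c \<noteq> p" "c \<noteq> q" "Y u x (inv (\<gamma> p) c) > Y v x (inv (\<gamma> q) c)"
    using assms(2) unfolding rel_def by blast
  then show ?thesis unfolding rel_def g(2,3)[symmetric]
    by (intro exI[of _ "g c"]) (simp add: eq apply_eq_iff_G[OF g(1)])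
qed

lemma good_rel_mono:
  assumes "rel p q (Y u x) (Y v x)" "s u x \<le> s u' x" "s v' x \<le> s v x"
  shows "rel p q (Y u' x) (Y v' x)"
proof -
  obtain c where c: "c \<noteq> p" "c \<noteq> q" "Y u x (inv (\<gamma> p) c) > Y v x (inv (\<gamma> q) c)"
    using assms(1) unfolding rel_def by blast
  have "Y u x (inv (\<gamma> p) c) \<le> Y u' x (inv (\<gamma> p) c)" by (rule good_Y_le[OF assms(2) inv_\<gamma>_pt[OF c(1)]])
  moreover have "Y v' x (inv (\<gamma> q) c) \<le> Y v x (inv (\<gamma> q) c)" by (rule good_Y_le[OF assms(3) inv_\<gamma>_pt[OF c(2)]])
  ultimately show ?thesis unfolding rel_def using c by (intro exI[of _ c]) simp
qed

text \<open>The use of scores in constructing invariant orders: coming first is inherited within a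
  type when the first score rises and the second falls, because higher scores mean coordinatewise
  higher profiles.\<close>

lemma good_less_mono:
  assumes "a \<noteq> b" "ty a b = ty a' b'" "x (a, b)" "s a x \<le> s a' x" "s b' x \<le> s b x"
  shows "x (a', b')"
proof -
  have "rel a b (Y a x) (Y b x)" using good_less_iff assms by blast
  then have "rel a b (Y a' x) (Y b' x)" by (rule good_rel_mono[OF _ assms(4,5)])
  then have "rel a' b' (Y a' x) (Y b' x)" by (rule good_rel_ty[OF assms(2)])
  then show ?thesis using good_less_iff ty_eq_neq[OF assms(2,1)] by blast
qed

end

subsection \<open>Exchangeability of the scores\<close>

abbreviation "Pn n \<equiv> PiM {..<n::nat} (\<lambda>_. borel :: ('a \<Rightarrow> real) measure)"

lemma coord_meas:
  assumes "i < n"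
  shows "(\<lambda>t. t i d) \<in> borel_measurable (Pn n)"
proof -
  have "(\<lambda>t. t i) \<in> measurable (Pn n) borel"
    by (rule measurable_component_singleton) (use assms in simp)
  then show ?thesis by (rule measurable_compose) (rule measurable_product_coordinates)
qed

lemma sc_meas: "i < n \<Longrightarrow> (\<lambda>t. sc (t i)) \<in> borel_measurable (Pn n)"
  unfolding sc_def by (intro borel_measurable_sum coord_meas)

lemma rel_meas:
  assumes "i < n" "j < n"
  shows "Measurable.pred (Pn n) (\<lambda>t. rel p q (t i) (t j))"
proof -
  have [measurable]: "Measurable.pred (Pn n) (\<lambda>t. t j e < t i d)" for d e
    unfolding pred_def by (rule borel_measurable_less[OF coord_meas[OF assms(2)] coord_meas[OF assms(1)]])
  show ?thesis unfolding rel_def by measurable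
qed

lemma s_meas [measurable]: "s a \<in> borel_measurable \<mu>"
proof -
  have "(\<lambda>x. Y a x d) \<in> borel_measurable \<mu>" for d
    unfolding Y_def by (rule \<eta>_meas)
  then show ?thesis unfolding s_def sc_def by (intro borel_measurable_sum)
qed

lemma tuple_apply: "i < n \<Longrightarrow> EF.tuple n a x i = Y (a i) x"
  by (simp add: EF.tuple_def)

lemma tuple_space: "EF.tuple n a x \<in> space (Pn n)"
  by (auto simp: EF.tuple_def space_PiM)

lemma AE_tuple_transfer:
  assumes Q: "Measurable.pred (Pn n) Q" and a: "inj_on a {..<n}" "inj_on a' {..<n}"
    and "AE x in \<mu>. \<not> Q (EF.tuple n a x)"
  shows "AE x in \<mu>. \<not> Q (EF.tuple n a' x)"
proof -
  define S where "S = {t \<in> space (Pn n). Q t}"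
  have S: "S \<in> sets (Pn n)" using Q unfolding S_def pred_def .
  have tS: "EF.tuple n a x \<in> S \<longleftrightarrow> Q (EF.tuple n a x)" for a x
    unfolding S_def using tuple_space by blast
  have *: "prob {x \<in> space \<mu>. EF.tuple n a x \<in> S} = 0 \<longleftrightarrow> (AE x in \<mu>. \<not> Q (EF.tuple n a x))" for a
  proof -
    have "prob {x \<in> space \<mu>. EF.tuple n a x \<in> S} = 0 \<longleftrightarrow> (AE x in \<mu>. x \<notin> {x \<in> space \<mu>. EF.tuple n a x \<in> S})"
      by (rule prob_eq_0[OF EF.tuple_event[OF S]])
    also have "\<dots> \<longleftrightarrow> (AE x in \<mu>. \<not> Q (EF.tuple n a x))"
      by (rule AE_cong) (simp only: mem_Collect_eq simp_thms tS)
    finally show ?thesis .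
  qed
  show ?thesis using *[of a] *[of a'] EF.prob_tuple_eq[OF a S] assms(4) by simp
qed

text \<open>Lists of indices are countable, so a pattern that is null at one tuple is excluded at
  all finite selections from \<open>c\<close> simultaneously. Ramsey and counting arguments may then
  choose the selection depending on \<open>x\<close>.\<close>

lemma AE_tuple_lists:
  fixes c :: "nat \<Rightarrow> 'a"
  assumes Q: "Measurable.pred (Pn n) Q" and a: "inj_on a {..<n}" and c: "inj c"
    and "AE x in \<mu>. \<not> Q (EF.tuple n a x)"
  shows "AE x in \<mu>. \<forall>l. distinct l \<longrightarrow> length l = n \<longrightarrow> \<not> Q (EF.tuple n (\<lambda>i. c (l ! i)) x)"
  unfolding AE_all_countable
proof
  fix l :: "nat list"
  show "AE x in \<mu>. distinct l \<longrightarrow> length l = n \<longrightarrow> \<not> Q (EF.tuple n (\<lambda>i. c (l ! i)) x)"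
  proof (cases "distinct l \<and> length l = n")
    case True
    have "inj_on (\<lambda>i. c (l ! i)) {..<n}"
    proof (rule inj_onI)
      fix i j assume "i \<in> {..<n}" "j \<in> {..<n}" "c (l ! i) = c (l ! j)"
      then show "i = j" using True injD[OF c, of "l ! i" "l ! j"] by (simp add: nth_eq_iff_index_eq)
    qed
    from AE_tuple_transfer[OF Q a this assms(4)] show ?thesis by eventually_elim blast
  next
    case False
    then show ?thesis by (intro AE_I2) blast
  qed
qed

text \<open>The passage from probability to combinatorics: a pattern of positive probability at one
  tuple is realised at any other, by an order to which the deterministic lemmas apply.\<close>

lemma ex_good_tuple:
  assumes Q: "Measurable.pred (Pn n) Q" and a: "inj_on a {..<n}" "inj_on b {..<n}"
    and "\<not> (AE x in \<mu>. \<not> Q (EF.tuple n a x))"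
  shows "\<exists>x. good x \<and> Q (EF.tuple n b x)"
proof (rule ccontr)
  assume *: "\<nexists>x. good x \<and> Q (EF.tuple n b x)"
  have "AE x in \<mu>. \<not> Q (EF.tuple n b x)" using AE_good by eventually_elim (metis *)
  from AE_tuple_transfer[OF Q a(2,1) this] show False using assms(4) by blast
qed

lemma ex_points:
  assumes "finite A"
  obtains c :: "nat \<Rightarrow> 'a" where "inj c" "\<And>i. c i \<notin> A"
proof -
  have "infinite (- A)" unfolding Compl_eq_Diff_UNIV using assms infinite_universe by (rule Diff_infinite_finite)
  then obtain c :: "nat \<Rightarrow> 'a" where "inj c" "range c \<subseteq> - A"
    using infinite_countable_subset by blast
  then show ?thesis using that[of c] by blast
qed

end

subsection \<open>The dichotomy\<close>

text \<open>The sum is the expected number of events that occur.\<close>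

lemma (in prob_space) sum_prob_le_multiplicity:
  assumes I: "finite I" and A: "\<And>j. j \<in> I \<Longrightarrow> A j \<in> events"
    and card: "AE x in M. card {j \<in> I. x \<in> A j} \<le> k"
  shows "(\<Sum>j\<in>I. prob (A j)) \<le> real k"
proof -
  have sum: "(\<Sum>j\<in>I. indicator (A j) x) = real (card {j \<in> I. x \<in> A j})" for x
    using I by (simp add: indicator_def sum.If_cases Int_def)
  have int: "integrable M (\<lambda>x. indicator (A j) x :: real)" if "j \<in> I" for j
    using A[OF that] by (simp add: emeasure_eq_measure)
  have "(\<Sum>j\<in>I. prob (A j)) = (\<Sum>j\<in>I. \<integral>x. indicator (A j) x \<partial>M)"
    using sets.sets_into_space[OF A] by (intro sum.cong) (simp_all add: Int_absorb2)
  also have "\<dots> = (\<integral>x. (\<Sum>j\<in>I. indicator (A j) x) \<partial>M)"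
    using int by (rule Bochner_Integration.integral_sum[symmetric])
  also have "\<dots> \<le> (\<integral>x. real k \<partial>M)"
  proof (rule integral_mono_AE)
    show "integrable M (\<lambda>x. \<Sum>j\<in>I. indicator (A j) x :: real)"
      using int by (rule Bochner_Integration.integrable_sum)
    show "AE x in M. (\<Sum>j\<in>I. indicator (A j) x) \<le> real k"
      using card unfolding sum by eventually_elim simp
  qed simp
  finally show ?thesis using prob_space by simp
qed

context LO_action
begin

text \<open>If \<open>k\<close> points almost surely never had a common score, fewer than
  \<open>k\<close> terms of a sequence would tie with its first term, although by exchangeability
  each does so with probability at least \<open>p\<close>. Hence every finite set carries a typical
  order with all its scores equal; there the score hypotheses of \<open>good_less_mono\<close> hold
  trivially and the order depends on types alone.\<close>

lemma invariant_order_if_ties: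
  assumes ab: "a \<noteq> b" and tie: "\<not> (AE x in \<mu>. s a x \<noteq> s b x)"
  shows "\<exists>x\<in>LO. \<forall>g\<in>G. lo_act g x = x"
proof (rule invariant_order_if_homogeneous[OF inj_to_nat])
  fix B :: "'a set" assume B: "finite B"
  define k where "k = card B"
  obtain h where h: "bij_betw h {..<k} B"
    using ex_bij_betw_nat_finite[OF B] unfolding k_def atLeast0LessThan by blast
  define Q where "Q t \<longleftrightarrow> (\<forall>i\<in>{..<k}. \<forall>j\<in>{..<k}. sc (t i) = sc (t j))" for t :: "nat \<Rightarrow> 'a \<Rightarrow> real"
  have Q: "Measurable.pred (Pn k) Q" unfolding Q_def
    by (intro pred_intros_finite finite_lessThan, unfold pred_def, intro borel_measurable_eq sc_meas) auto
  have ih: "inj_on h {..<k}" using h by (rule bij_betw_imp_inj_on)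
  have "\<not> (AE x in \<mu>. \<not> Q (EF.tuple k h x))"
  proof
    assume null: "AE x in \<mu>. \<not> Q (EF.tuple k h x)"
    obtain c :: "nat \<Rightarrow> 'a" where c: "inj c" using ex_points[of "{}"] by blast
    define p where "p = prob {x \<in> LO. s a x = s b x}"
    have ev: "{x \<in> LO. s u x = s v x} \<in> events" for u v
    proof -
      have "{x \<in> space \<mu>. s u x = s v x} \<in> events" by measurable
      then show ?thesis unfolding space_\<mu> .
    qed
    have "p \<noteq> 0"
    proof
      assume "p = 0"
      then have "AE x in \<mu>. x \<notin> {x \<in> LO. s a x = s b x}" unfolding p_def prob_eq_0[OF ev] .
      then have "AE x in \<mu>. s a x \<noteq> s b x" using AE_space by eventually_elim simp
      with tie show False by blast
    qed
    then have p: "p > 0" unfolding p_def using measure_nonneg by (simp add: order_less_le)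
    have pc: "prob {x \<in> LO. s (c 0) x = s (c j) x} \<ge> p" for j
    proof (cases "j = 0")
      case True
      have "{x \<in> LO. s (c 0) x = s (c 0) x} = space \<mu>" by simp
      then show ?thesis using True prob_space by (simp add: p_def)
    next
      case False
      define S where "S = {t \<in> space (Pn 2). sc (t 0) = sc (t 1)}"
      have S: "S \<in> sets (Pn 2)" unfolding S_def by (intro borel_measurable_eq sc_meas) auto
      have *: "{x \<in> space \<mu>. EF.tuple 2 (\<lambda>i. if i = 0 then u else v) x \<in> S} = {x \<in> LO. s u x = s v x}" for u v
        unfolding S_def using tuple_space by (simp add: tuple_apply s_def)
      have "prob {x \<in> space \<mu>. EF.tuple 2 (\<lambda>i. if i = 0 then a else b) x \<in> S}
          = prob {x \<in> space \<mu>. EF.tuple 2 (\<lambda>i. if i = 0 then c 0 else c j) x \<in> S}"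
      proof (rule EF.prob_tuple_eq[OF _ _ S])
        show "inj_on (\<lambda>i. if i = 0 then a else b) {..<2::nat}" using ab by (auto simp: inj_on_def split: if_splits)
        show "inj_on (\<lambda>i. if i = 0 then c 0 else c j) {..<2::nat}"
          using False injD[OF c, of 0 j] by (auto simp: inj_on_def split: if_splits)
      qed
      then show ?thesis unfolding * p_def by simp
    qed
    obtain N :: nat where N: "real k < real N * p"
      using reals_Archimedean3[OF p] by blast
    have "AE x in \<mu>. card {j \<in> {..<N}. x \<in> {x \<in> LO. s (c 0) x = s (c j) x}} \<le> k"
      using AE_tuple_lists[OF Q ih c null] AE_space
    proof eventually_elim
      case (elim x)
      define J where "J = {j \<in> {..<N}. s (c 0) x = s (c j) x}"
      have "card J < k"
      proof (rule ccontr)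
        assume "\<not> card J < k"
        then obtain J' where J': "J' \<subseteq> J" "card J' = k" by (meson not_less obtain_subset_with_card_n)
        have "finite J'" using J'(1) finite_subset[of J' "{..<N}"] by (auto simp: J_def)
        then obtain l where l: "set l = J'" "distinct l" using finite_distinct_list by blast
        then have len: "length l = k" using J' distinct_card by metis
        have "s (c (l ! i)) x = s (c 0) x" if "i < k" for i
        proof -
          have "l ! i \<in> J" using that len l J' by (metis nth_mem subsetD)
          then show ?thesis by (simp add: J_def)
        qed
        then have "Q (EF.tuple k (\<lambda>i. c (l ! i)) x)" by (simp add: Q_def tuple_apply s_def)
        then show False using elim(1) l(2) len by blast
      qed
      moreover have "{j \<in> {..<N}. x \<in> {x \<in> LO. s (c 0) x = s (c j) x}} = J"
        using elim(2) by (simp add: J_def)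
      ultimately show ?case by simp
    qed
    from sum_prob_le_multiplicity[OF finite_lessThan ev this]
    have "(\<Sum>j<N. prob {x \<in> LO. s (c 0) x = s (c j) x}) \<le> real k" .
    moreover have "real N * p \<le> (\<Sum>j<N. prob {x \<in> LO. s (c 0) x = s (c j) x})"
      using sum_mono[of "{..<N}" "\<lambda>_. p", OF pc] by simp
    ultimately show False using N by linarith
  qed
  from ex_good_tuple[OF Q ih ih this] obtain x where x: "good x" "Q (EF.tuple k h x)" by blast
  have eq: "s u x = s v x" if uv: "u \<in> B" "v \<in> B" for u v
  proof -
    obtain i j where ij: "i < k" "j < k" "u = h i" "v = h j"
      using uv h by (metis bij_betw_imp_surj_on imageE lessThan_iff)
    then have "sc (EF.tuple k h x i) = sc (EF.tuple k h x j)" using x(2) unfolding Q_def by blast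
    then show ?thesis unfolding s_def ij(3,4) tuple_apply[OF ij(1)] tuple_apply[OF ij(2)] .
  qed
  have "homogeneous x B" unfolding homogeneous_def
  proof (intro ballI impI)
    fix u v u' v' assume *: "u \<in> B" "v \<in> B" "u' \<in> B" "v' \<in> B" "ty u v = ty u' v'" "x (u, v)"
    show "x (u', v')"
      by (rule good_less_mono[OF x(1) LO_neq[OF good_LO[OF x(1)] *(6)] *(5,6)
            order_eq_refl[OF eq[OF *(1,3)]] order_eq_refl[OF eq[OF *(4,2)]]])
  qed
  then show "\<exists>x\<in>LO. homogeneous x B" using good_LO[OF x(1)] by blast
qed

text \<open>Among \<open>N + 1\<close> exchangeable points other than \<open>a\<close>, only one can be the immediate successor
  of \<open>a\<close>, so \<open>b\<close> is with probability at most \<open>1 / (N + 1)\<close>.\<close>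

lemma infinitely_many_between:
  fixes c :: "nat \<Rightarrow> 'a"
  assumes no_ties: "\<And>a b. a \<noteq> b \<Longrightarrow> AE x in \<mu>. s a x \<noteq> s b x"
    and c: "inj c" "\<And>i. c i \<notin> {a, b}" and ab: "a \<noteq> b"
  shows "AE x in \<mu>. s a x < s b x \<longrightarrow> infinite {i. s a x < s (c i) x \<and> s (c i) x < s b x}"
proof -
  have "AE x in \<mu>. s a x < s b x \<longrightarrow> (\<exists>i\<ge>m. s a x < s (c i) x \<and> s (c i) x < s b x)" for m
  proof -
    define X where "X = {x \<in> space \<mu>. s a x < s b x \<and> (\<forall>i. i \<ge> m \<longrightarrow> \<not> (s a x < s (c i) x \<and> s (c i) x < s b x))}"
    have X: "X \<in> events" unfolding X_def by measurable
    have "prob X \<le> 1 / real (Suc N)" for N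
    proof -
      \<comment> \<open>Position 0 holds \<open>a\<close>, position 1 holds \<open>b\<close>, and
        the other \<open>N\<close> positions hold terms of \<open>c\<close> from index
        \<open>m\<close> on. This leaves \<open>N + 1\<close> candidates for the successor of
        \<open>a\<close> in the order of scores; \<open>R j\<close> says that it is position
        \<open>j\<close>.\<close>
      define n where "n = N + 2"
      define e where "e i = (if i = 0 then a else if i = 1 then b else c (m + (i - 2)))" for i :: nat
      have e01: "e 0 = a" "e (Suc 0) = b" "e (Suc (Suc i)) = c (m + i)" for i by (simp_all add: e_def)
      have inj: "inj e"
      proof (rule injI)
        fix i j assume eq: "e i = e j"
        have cc: "c l \<noteq> a" "c l \<noteq> b" for l using c(2)[of l] by blast+
        show "i = j" using eq ab ab[symmetric]
          by (simp add: e_def cc cc[THEN not_sym] inj_eq[OF c(1)] split: if_splits)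
      qed
      define R where "R j t \<longleftrightarrow> sc (t 0) < sc (t j) \<and>
        (\<forall>l\<in>{1..<n}. l \<noteq> j \<longrightarrow> \<not> (sc (t 0) < sc (t l) \<and> sc (t l) < sc (t j)))" for j and t :: "nat \<Rightarrow> 'a \<Rightarrow> real"
      have R: "Measurable.pred (Pn n) (R j)" if "j \<in> {1..<n}" for j
      proof -
        have le [measurable]: "Measurable.pred (Pn n) (\<lambda>t. sc (t i) < sc (t l))" if "i < n" "l < n" for i l
          unfolding pred_def by (intro borel_measurable_less sc_meas that)
        have 0: "0 < n" "j < n" using that by (auto simp: n_def)
        show ?thesis unfolding R_def
          by (intro pred_intros_logic pred_intros_finite le 0) (use that in auto)
      qed
      define S where "S j = {t \<in> space (Pn n). R j t}" for j
      have S: "S j \<in> sets (Pn n)" if "j \<in> {1..<n}" for j using R[OF that] unfolding S_def pred_def .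
      define A where "A j = {x \<in> space \<mu>. EF.tuple n e x \<in> S j}" for j
      have A: "A j \<in> events" if "j \<in> {1..<n}" for j unfolding A_def by (rule EF.tuple_event[OF S[OF that]])
      have Aeq: "prob (A j) = prob (A 1)" if j: "j \<in> {1..<n}" for j
      proof -
        \<comment> \<open>The transposition swaps two candidates and keeps \<open>a\<close> at
          position 0.\<close>
        define \<pi> where "\<pi> = Transposition.transpose 1 j"
        have 1: "(1::nat) \<in> {1..<n}" by (simp add: n_def)
        have \<pi>n: "\<pi> i < n \<longleftrightarrow> i < n" for i using j 1 by (auto simp: \<pi>_def Transposition.transpose_def)
        have \<pi>1: "\<pi> i \<in> {1..<n} \<longleftrightarrow> i \<in> {1..<n}" for i using j 1 by (auto simp: \<pi>_def Transposition.transpose_def)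
        have \<pi>0: "\<pi> 0 = 0" "\<pi> 1 = j" "\<And>i. \<pi> (\<pi> i) = i" using j by (auto simp: \<pi>_def Transposition.transpose_def)
        have "R j (EF.tuple n e x) \<longleftrightarrow> R 1 (EF.tuple n (\<lambda>i. e (\<pi> i)) x)" for x
        proof -
          have t: "EF.tuple n (\<lambda>i. e (\<pi> i)) x i = EF.tuple n e x (\<pi> i)" if "i < n" for i
            using that \<pi>n by (simp add: tuple_apply)
          have 01: "0 < n" "1 < n" by (simp_all add: n_def)
          have "R 1 (EF.tuple n (\<lambda>i. e (\<pi> i)) x) \<longleftrightarrow> sc (EF.tuple n e x 0) < sc (EF.tuple n e x j) \<and>
            (\<forall>l\<in>{1..<n}. l \<noteq> 1 \<longrightarrow> \<not> (sc (EF.tuple n e x 0) < sc (EF.tuple n e x (\<pi> l)) \<and>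
              sc (EF.tuple n e x (\<pi> l)) < sc (EF.tuple n e x j)))"
            unfolding R_def using t 01 \<pi>0 by simp
          also have "\<dots> \<longleftrightarrow> R j (EF.tuple n e x)"
            unfolding R_def using \<pi>1 \<pi>0 by metis
          finally show ?thesis by simp
        qed
        then have "A j = {x \<in> space \<mu>. EF.tuple n (\<lambda>i. e (\<pi> i)) x \<in> S 1}"
          unfolding A_def S_def using tuple_space by simp
        also have "prob \<dots> = prob (A 1)" unfolding A_def
        proof (rule EF.prob_tuple_eq[OF _ _ S[OF 1]])
          show "inj_on (\<lambda>i. e (\<pi> i)) {..<n}" by (rule inj_onI) (metis injD[OF inj] \<pi>0(3))
          show "inj_on e {..<n}" using inj by (rule inj_on_subset) simp
        qed
        finally show ?thesis .
      qed
      have nt: "AE x in \<mu>. \<forall>i j. i \<noteq> j \<longrightarrow> s (e i) x \<noteq> s (e j) x"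
        unfolding AE_all_countable
      proof (intro allI)
        fix i j
        show "AE x in \<mu>. i \<noteq> j \<longrightarrow> s (e i) x \<noteq> s (e j) x"
          using no_ties[of "e i" "e j"] inj_eq[OF inj] by (cases "i = j") simp_all
      qed
      have "AE x in \<mu>. card {j \<in> {1..<n}. x \<in> A j} \<le> 1"
        using nt AE_space
      proof eventually_elim
        case (elim x)
        have uniq: "j = j'" if "j \<in> {1..<n}" "j' \<in> {1..<n}" "x \<in> A j" "x \<in> A j'" for j j'
        proof (rule ccontr)
          assume "j \<noteq> j'"
          have "R j (EF.tuple n e x)" "R j' (EF.tuple n e x)" using that by (simp_all add: A_def S_def)
          moreover have "sc (EF.tuple n e x j) \<noteq> sc (EF.tuple n e x j')"
            using elim(1) \<open>j \<noteq> j'\<close> that by (simp add: tuple_apply s_def)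
          ultimately show False using \<open>j \<noteq> j'\<close> that(1,2) unfolding R_def by (metis linorder_neqE_linordered_idom)
        qed
        then have "\<forall>i\<in>{j \<in> {1..<n}. x \<in> A j}. \<forall>j\<in>{j \<in> {1..<n}. x \<in> A j}. i = j" by blast
        then show ?case by (simp add: card_le_Suc0_iff_eq)
      qed
      from sum_prob_le_multiplicity[OF finite_atLeastLessThan A this]
      have "(\<Sum>j\<in>{1..<n}. prob (A j)) \<le> 1" by simp
      moreover have "(\<Sum>j\<in>{1..<n}. prob (A j)) = real (Suc N) * prob (A 1)"
      proof -
        have "(\<Sum>j\<in>{1..<n}. prob (A j)) = (\<Sum>j\<in>{1..<n}. prob (A 1))" by (rule sum.cong[OF refl Aeq])
        then show ?thesis by (simp add: n_def)
      qed
      ultimately have bound: "real (Suc N) * prob (A 1) \<le> 1" by simp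
      have "prob X \<le> prob (A 1)"
      proof (rule finite_measure_mono)
        show "A 1 \<in> events" by (rule A) (simp add: n_def)
        show "X \<subseteq> A 1"
        proof
          fix x assume x: "x \<in> X"
          have "R 1 (EF.tuple n e x)" unfolding R_def
          proof (intro conjI ballI impI)
            show "sc (EF.tuple n e x 0) < sc (EF.tuple n e x 1)"
              using x by (simp add: X_def tuple_apply n_def e_def s_def)
            fix l assume l: "l \<in> {1..<n}" "l \<noteq> 1"
            then obtain l' where "l = Suc (Suc l')" by (cases l; cases "l - 1") auto
            then show "\<not> (sc (EF.tuple n e x 0) < sc (EF.tuple n e x l) \<and> sc (EF.tuple n e x l) < sc (EF.tuple n e x 1))"
              using x l by (simp add: X_def tuple_apply n_def e01 s_def)
          qed
          then show "x \<in> A 1" using x tuple_space by (simp add: A_def S_def X_def)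
        qed
      qed
      then have "real (Suc N) * prob X \<le> real (Suc N) * prob (A 1)" by (intro mult_left_mono) simp_all
      with bound have "prob X * real (Suc N) \<le> 1" by (simp only: mult.commute)
      then show ?thesis by (subst pos_le_divide_eq) simp_all
    qed
    then have "prob X \<le> 0"
      using LIMSEQ_inverse_real_of_nat by (intro LIMSEQ_le_const) (auto simp: inverse_eq_divide)
    then have "prob X = 0" using measure_nonneg[of \<mu> X] by linarith
    then have "AE x in \<mu>. x \<notin> X" unfolding prob_eq_0[OF X] .
    then show ?thesis using AE_space by eventually_elim (simp add: X_def)
  qed
  then have "AE x in \<mu>. \<forall>m. s a x < s b x \<longrightarrow> (\<exists>i\<ge>m. s a x < s (c i) x \<and> s (c i) x < s b x)"
    unfolding AE_all_countable by blast
  then show ?thesis by eventually_elim (simp add: infinite_nat_iff_unbounded_le)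
qed

end

lemma ex_sorted_wrt:
  assumes "finite A" "\<And>a b c. a \<in> A \<Longrightarrow> b \<in> A \<Longrightarrow> c \<in> A \<Longrightarrow> r a b \<Longrightarrow> r b c \<Longrightarrow> r a c"
    and "\<And>a b. a \<in> A \<Longrightarrow> b \<in> A \<Longrightarrow> a \<noteq> b \<Longrightarrow> r a b \<or> r b a"
  shows "\<exists>l. distinct l \<and> set l = A \<and> sorted_wrt r l"
  using assms
proof (induction A rule: finite_induct)
  case (insert a A)
  then obtain l where l: "distinct l" "set l = A" "sorted_wrt r l" by blast
  define l1 l2 where "l1 = filter (\<lambda>b. r b a) l" and "l2 = filter (\<lambda>b. \<not> r b a) l"
  have 1: "set l1 = {b \<in> A. r b a}" "set l2 = {b \<in> A. \<not> r b a}" using l by (auto simp: l1_def l2_def)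
  have 2: "r a b" if "b \<in> set l2" for b
    using insert.prems(2)[of b a] insert.hyps that unfolding 1 by blast
  have 3: "r u v" if "u \<in> set l1" "v \<in> set l2" for u v
    using insert.prems(1)[of u a v] 2[OF that(2)] that unfolding 1 by blast
  have "sorted_wrt r (l1 @ a # l2)"
  proof -
    have 4: "r u a" if "u \<in> set l1" for u using that unfolding 1 by blast
    have "sorted_wrt r l1" "sorted_wrt r l2" unfolding l1_def l2_def by (intro sorted_wrt_filter l(3))+
    moreover have "\<forall>u\<in>set l1. \<forall>v\<in>set (a # l2). r u v" using 3 4 by (simp only: list.set) blast
    ultimately show ?thesis unfolding sorted_wrt_append sorted_wrt.simps using 2 by blast
  qed
  moreover have "distinct (l1 @ a # l2)" using l insert.hyps by (auto simp: l1_def l2_def)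
  moreover have "set (l1 @ a # l2) = insert a A" using 1 by auto
  ultimately show ?case by blast
qed simp

section \<open>Scores that disagree with the order\<close>

context LO_action
begin

text \<open>The relation \<open>rel a b\<close> survives when the profiles of \<open>a\<close> and
  \<open>b\<close> are replaced by those of two points with scores in between, the lower one first.
  Ramsey's theorem selects such points for which the set \<open>\<epsilon>\<close> of types
  \<open>ty p q\<close> with \<open>rel p q\<close> along increasing scores is constant.
  Exchangeability reproduces this pattern at every finite tuple, with the scores in any prescribed
  order, and this freedom shows that \<open>\<epsilon>\<close> contains exactly one of the two types
  of each pair.\<close>

lemma invariant_order_if_disagreement:
  assumes no_ties: "\<And>a b. a \<noteq> b \<Longrightarrow> AE x in \<mu>. s a x \<noteq> s b x"
    and ab: "a \<noteq> b" and dis: "\<not> (AE x in \<mu>. \<not> (x (a, b) \<and> s a x < s b x))"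
  shows "\<exists>x\<in>LO. \<forall>g\<in>G. lo_act g x = x"
proof -
  obtain c :: "nat \<Rightarrow> 'a" where c: "inj c" "\<And>i. c i \<notin> {a, b}" using ex_points[of "{a, b}"] by blast
  define Q where "Q \<epsilon> k t \<longleftrightarrow> (\<forall>i\<in>{..<k}. \<forall>j\<in>{..<k}. i < j \<longrightarrow> sc (t i) < sc (t j) \<and>
    (\<forall>p q. p \<noteq> q \<longrightarrow> (rel p q (t i) (t j) \<longleftrightarrow> ty p q \<in> \<epsilon>)))" for \<epsilon> k and t :: "nat \<Rightarrow> 'a \<Rightarrow> real"
  have Q: "Measurable.pred (Pn k) (Q \<epsilon> k)" for \<epsilon> k
  proof -
    have le: "Measurable.pred (Pn k) (\<lambda>t. sc (t i) < sc (t j))" if "i < k" "j < k" for i j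
      unfolding pred_def by (intro borel_measurable_less sc_meas that)
    show ?thesis unfolding Q_def
      by (intro pred_intros_logic pred_intros_finite pred_intros_countable le rel_meas) simp_all
  qed
  have ci: "inj_on c {..<k}" for k using c(1) by (rule inj_on_subset) simp
  \<comment> \<open>If every candidate \<open>\<epsilon>\<close> failed, each at some length
    \<open>K \<epsilon>\<close>, these finitely many failures would hold together off one null
    set.\<close>
  have "\<exists>\<epsilon>\<in>Pow types. ty a b \<in> \<epsilon> \<and> (\<forall>k. \<not> (AE x in \<mu>. \<not> Q \<epsilon> k (EF.tuple k c x)))"
  proof (rule ccontr)
    assume neg: "\<not> ?thesis"
    define K where "K \<epsilon> = (SOME k. AE x in \<mu>. \<not> Q \<epsilon> k (EF.tuple k c x))" for \<epsilon>
    have K: "AE x in \<mu>. \<not> Q \<epsilon> (K \<epsilon>) (EF.tuple (K \<epsilon>) c x)" if "\<epsilon> \<in> Pow types" "ty a b \<in> \<epsilon>" for \<epsilon>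
    proof -
      have "\<exists>k. AE x in \<mu>. \<not> Q \<epsilon> k (EF.tuple k c x)" using neg that by blast
      then show ?thesis unfolding K_def by (rule someI_ex)
    qed
    have null: "AE x in \<mu>. \<forall>\<epsilon>\<in>Pow types. ty a b \<in> \<epsilon> \<longrightarrow>
        (\<forall>l. distinct l \<longrightarrow> length l = K \<epsilon> \<longrightarrow> \<not> Q \<epsilon> (K \<epsilon>) (EF.tuple (K \<epsilon>) (\<lambda>i. c (l ! i)) x))"
    proof (rule AE_finite_allI[OF finite_types'(2)])
      fix \<epsilon> assume \<epsilon>: "\<epsilon> \<in> Pow types"
      show "AE x in \<mu>. ty a b \<in> \<epsilon> \<longrightarrow>
        (\<forall>l. distinct l \<longrightarrow> length l = K \<epsilon> \<longrightarrow> \<not> Q \<epsilon> (K \<epsilon>) (EF.tuple (K \<epsilon>) (\<lambda>i. c (l ! i)) x))"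
      proof (cases "ty a b \<in> \<epsilon>")
        case True
        from AE_tuple_lists[OF Q ci c(1) K[OF \<epsilon> True]] show ?thesis by eventually_elim blast
      next
        case False
        then show ?thesis by (intro AE_I2) blast
      qed
    qed
    have nt: "AE x in \<mu>. \<forall>u v. u \<noteq> v \<longrightarrow> s u x \<noteq> s v x"
      unfolding AE_all_countable
    proof (intro allI)
      fix u v
      show "AE x in \<mu>. u \<noteq> v \<longrightarrow> s u x \<noteq> s v x" using no_ties[of u v] by (cases "u = v") simp_all
    qed
    have between: "AE x in \<mu>. s a x < s b x \<longrightarrow> infinite {i. s a x < s (c i) x \<and> s (c i) x < s b x}"
      by (rule infinitely_many_between[OF no_ties c ab])
    have "AE x in \<mu>. \<not> (x (a, b) \<and> s a x < s b x)"
      using null nt AE_good between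
    proof eventually_elim
      case (elim x)
      note good = elim(3)
      show ?case
      proof
        assume xab: "x (a, b) \<and> s a x < s b x"
        define Z where "Z = {i. s a x < s (c i) x \<and> s (c i) x < s b x}"
        have infZ: "infinite Z" unfolding Z_def using elim(4) xab by blast
        define tp where "tp u v = {ty p q | p q. p \<noteq> q \<and> rel p q (Y u x) (Y v x)}" for u v
        have tp: "tp u v \<in> Pow types" for u v using ty_types by (force simp: tp_def)
        define y where "y i j = (if s (c i) x < s (c j) x then tp (c i) (c j) else tp (c j) (c i))" for i j
        have ysym: "y i j = y j i" for i j
        proof (cases "i = j")
          case False
          then have "c i \<noteq> c j" using inj_eq[OF c(1)] by simp
          then have "s (c i) x \<noteq> s (c j) x" using elim(2) by blast
          then show ?thesis by (simp add: y_def)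
        qed simp
        have y\<Phi>: "y i j \<in> Pow types" for i j using tp by (simp add: y_def)
        obtain H \<epsilon> where H: "H \<subseteq> Z" "infinite H" "\<And>i j. i \<in> H \<Longrightarrow> j \<in> H \<Longrightarrow> i \<noteq> j \<Longrightarrow> y i j = \<epsilon>"
          using Ramsey_pairs_nat[where y=y and Z=Z, OF finite_types'(2) y\<Phi> ysym infZ] by blast
        have sH: "s (c i) x \<noteq> s (c j) x" if "i \<noteq> j" for i j
          using elim(2) inj_eq[OF c(1)] that by simp
        have lt\<epsilon>: "tp (c i) (c j) = \<epsilon>" if "i \<in> H" "j \<in> H" "s (c i) x < s (c j) x" for i j
          using H(3)[OF that(1,2)] that(3) by (auto simp: y_def)
        obtain i j where ij: "i \<in> H" "j \<in> H" "i \<noteq> j"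
          using H(2) by (metis finite.emptyI finite_insert finite_subset insertCI subsetI)
        obtain i j where ij: "i \<in> H" "j \<in> H" "s (c i) x < s (c j) x"
          using ij sH[OF ij(3)] by (metis linorder_neqE_linordered_idom)
        have "rel a b (Y a x) (Y b x)" using good_less_iff[OF good ab] xab by blast
        moreover have "s a x \<le> s (c i) x" "s (c j) x \<le> s b x" using H(1) ij by (auto simp: Z_def)
        ultimately have "rel a b (Y (c i) x) (Y (c j) x)" by (rule good_rel_mono[OF good])
        then have \<epsilon>ab: "ty a b \<in> \<epsilon>" using lt\<epsilon>[OF ij] ab unfolding tp_def by blast
        have \<epsilon>: "\<epsilon> \<in> Pow types" using lt\<epsilon>[OF ij] tp by metis
        \<comment> \<open>The required length depends on the \<open>\<epsilon>\<close> that Ramsey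
          has just produced; the infinite homogeneous set accommodates it.\<close>
        obtain H' where H': "H' \<subseteq> H" "finite H'" "card H' = K \<epsilon>"
          using infinite_arbitrarily_large[OF H(2)] by blast
        have "\<exists>l. distinct l \<and> set l = H' \<and> sorted_wrt (\<lambda>i j. s (c i) x < s (c j) x) l"
          by (rule ex_sorted_wrt[OF H'(2)]) (use sH in \<open>auto simp: neq_iff\<close>)
        then obtain l where l: "distinct l" "set l = H'" "sorted_wrt (\<lambda>i j. s (c i) x < s (c j) x) l" by blast
        have len: "length l = K \<epsilon>" using l H' distinct_card by metis
        have "Q \<epsilon> (K \<epsilon>) (EF.tuple (K \<epsilon>) (\<lambda>i. c (l ! i)) x)" unfolding Q_def
        proof (intro ballI impI conjI allI)
          fix i j assume ij: "i \<in> {..<K \<epsilon>}" "j \<in> {..<K \<epsilon>}" "i < j"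
          have lt: "s (c (l ! i)) x < s (c (l ! j)) x"
            using l(3) ij len by (simp add: sorted_wrt_iff_nth_less)
          have t: "EF.tuple (K \<epsilon>) (\<lambda>i. c (l ! i)) x i = Y (c (l ! i)) x"
            "EF.tuple (K \<epsilon>) (\<lambda>i. c (l ! i)) x j = Y (c (l ! j)) x" using ij by (simp_all add: tuple_apply)
          show "sc (EF.tuple (K \<epsilon>) (\<lambda>i. c (l ! i)) x i) < sc (EF.tuple (K \<epsilon>) (\<lambda>i. c (l ! i)) x j)"
            unfolding t using lt by (simp add: s_def)
          have "l ! i \<in> H" "l ! j \<in> H" using ij len l(2) H'(1) nth_mem[of _ l] by auto
          then have eq: "tp (c (l ! i)) (c (l ! j)) = \<epsilon>" using lt\<epsilon> lt by blast
          fix p q :: 'a assume pq: "p \<noteq> q"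
          show "rel p q (EF.tuple (K \<epsilon>) (\<lambda>i. c (l ! i)) x i) (EF.tuple (K \<epsilon>) (\<lambda>i. c (l ! i)) x j) \<longleftrightarrow> ty p q \<in> \<epsilon>"
            unfolding t
          proof
            assume "rel p q (Y (c (l ! i)) x) (Y (c (l ! j)) x)"
            then have "ty p q \<in> tp (c (l ! i)) (c (l ! j))" using pq unfolding tp_def by blast
            then show "ty p q \<in> \<epsilon>" unfolding eq .
          next
            assume "ty p q \<in> \<epsilon>"
            then have "ty p q \<in> tp (c (l ! i)) (c (l ! j))" unfolding eq .
            then obtain p' q' where "ty p q = ty p' q'" "rel p' q' (Y (c (l ! i)) x) (Y (c (l ! j)) x)"
              unfolding tp_def by blast
            then show "rel p q (Y (c (l ! i)) x) (Y (c (l ! j)) x)" using good_rel_ty[OF good] by metis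
          qed
        qed
        then show False using elim(1) \<epsilon> \<epsilon>ab l(1) len by blast
      qed
    qed
    with dis show False by blast
  qed
  then obtain \<epsilon> where \<epsilon>: "ty a b \<in> \<epsilon>" "\<And>k. \<not> (AE x in \<mu>. \<not> Q \<epsilon> k (EF.tuple k c x))" by blast
  \<comment> \<open>The enumeration \<open>h\<close> prescribes the order of the scores, so the same
    points can be placed in whichever order suits the argument.\<close>
  have pattern: "\<exists>x. good x \<and> (\<forall>i j. i < j \<longrightarrow> j < k \<longrightarrow>
      s (h i) x < s (h j) x \<and> (x (h i, h j) \<longleftrightarrow> ty (h i) (h j) \<in> \<epsilon>))" if h: "inj_on h {..<k}" for h :: "nat \<Rightarrow> 'a" and k
  proof -
    obtain x where x: "good x" "Q \<epsilon> k (EF.tuple k h x)" using ex_good_tuple[OF Q ci h \<epsilon>(2)] by blast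
    have "s (h i) x < s (h j) x \<and> (x (h i, h j) \<longleftrightarrow> ty (h i) (h j) \<in> \<epsilon>)" if ij: "i < j" "j < k" for i j
    proof -
      have "i \<in> {..<k}" "j \<in> {..<k}" using ij by auto
      then have *: "sc (EF.tuple k h x i) < sc (EF.tuple k h x j) \<and>
        (\<forall>p q. p \<noteq> q \<longrightarrow> (rel p q (EF.tuple k h x i) (EF.tuple k h x j) \<longleftrightarrow> ty p q \<in> \<epsilon>))"
        using x(2) ij(1) unfolding Q_def by blast
      have t: "EF.tuple k h x i = Y (h i) x" "EF.tuple k h x j = Y (h j) x" using ij by (simp_all add: tuple_apply)
      have "h i \<noteq> h j" using inj_onD[OF h, of i j] ij by auto
      then show ?thesis using * good_less_iff[OF x(1), of "h i" "h j"] unfolding t s_def by blast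
    qed
    then show ?thesis using x(1) by blast
  qed
  \<comment> \<open>For distinct entries these are the pairs on which, in every pattern, the higher
    score comes first. The aim is to show that no such pair exists.\<close>
  define E where "E u v \<longleftrightarrow> u = v \<or> (ty u v \<notin> \<epsilon> \<and> ty v u \<notin> \<epsilon>)" for u v
  have E_trans_aux: "ty u w \<notin> \<epsilon>" if d: "u \<noteq> v" "v \<noteq> w" "u \<noteq> w" and E: "E u v" "E v w" for u v w
  proof
    assume uw: "ty u w \<in> \<epsilon>"
    \<comment> \<open>With scores increasing along \<open>u\<close>, \<open>v\<close>,
      \<open>w\<close>, the pattern gives \<open>w < v < u\<close>, while the type of
      \<open>(u, w)\<close> demands \<open>u < w\<close>.\<close>
    define h where "h i = (if i = 0 then u else if i = 1 then v else w)" for i :: nat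
    have "inj_on h {..<3}" using d by (auto simp: inj_on_def h_def split: if_splits)
    from pattern[OF this] obtain x where x: "good x"
      "\<And>i j. i < j \<Longrightarrow> j < 3 \<Longrightarrow> x (h i, h j) \<longleftrightarrow> ty (h i) (h j) \<in> \<epsilon>" by blast
    have "\<not> x (u, v)" "\<not> x (v, w)" "x (u, w)"
      using x(2)[of 0 1] x(2)[of 1 2] x(2)[of 0 2] E d uw by (auto simp: h_def E_def)
    then have "x (v, u)" "x (w, v)" using LO_total[OF good_LO[OF x(1)]] d by blast+
    then have "x (w, u)" using LO_trans[OF good_LO[OF x(1)]] by blast
    then show False using LO_asym[OF good_LO[OF x(1)]] \<open>x (u, w)\<close> by blast
  qed
  have Esym: "E v u" if "E u v" for u v using that by (auto simp: E_def)
  have Eq: "equivp E"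
  proof (rule equivpI)
    show "reflp E" by (rule reflpI) (simp add: E_def)
    show "symp E" by (rule sympI) (rule Esym)
    show "transp E"
    proof (rule transpI)
      fix u v w assume *: "E u v" "E v w"
      show "E u w"
      proof (cases "u = v \<or> v = w \<or> u = w")
        case False
        then have "ty u w \<notin> \<epsilon>" "ty w u \<notin> \<epsilon>"
          using E_trans_aux[of u v w] E_trans_aux[of w v u] * Esym by blast+
        then show ?thesis by (simp add: E_def)
      qed (use * in \<open>auto simp: E_def\<close>)
    qed
  qed
  have Einv: "E (g u) (g v)" if "g \<in> G" "E u v" for g u v
    using that ty_apply[OF that(1)] by (auto simp: E_def)
  have "ty u v \<in> \<epsilon> \<or> ty v u \<in> \<epsilon>" if "u \<noteq> v" for u v
  proof (rule ccontr)
    assume "\<not> ?thesis"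
    then have uv: "E u v" by (simp add: E_def)
    \<comment> \<open>Primitivity spreads one nontrivial \<open>E\<close>-pair to all pairs, but
      \<open>(a, b)\<close> is ruled out by the choice of \<open>\<epsilon>\<close>.\<close>
    have "E a b" by (rule primitive[where E=E and a=u and b=v, OF Eq _ uv that]) (rule Einv)
    then show False using ab \<epsilon>(1) by (simp add: E_def)
  qed
  moreover have "\<not> (ty u v \<in> \<epsilon> \<and> ty v u \<in> \<epsilon>)" if uv: "u \<noteq> v" for u v
  proof
    assume \<epsilon>uv: "ty u v \<in> \<epsilon> \<and> ty v u \<in> \<epsilon>"
    obtain g where g: "g \<in> stab G {}" "g ` ({u, v} - {}) \<inter> {u, v} = {}"
      using ex_stab_avoiding[of "{}" "{u, v}" "{u, v}"] by blast
    have gG: "g \<in> G" using g(1) by simp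
    have d: "g u \<noteq> u" "g u \<noteq> v" "g v \<noteq> u" "g v \<noteq> v" "g u \<noteq> g v"
      using g(2) apply_eq_iff_G[OF gG, of u v] uv by auto
    \<comment> \<open>Scores increase along \<open>u\<close>, \<open>g v\<close>,
      \<open>g u\<close>, \<open>v\<close>. The outer pair gives \<open>u < v\<close>; as
      \<open>g u\<close> scores above \<open>u\<close> and \<open>g v\<close> below
      \<open>v\<close>, monotonicity yields \<open>g u < g v\<close>. The inner pair, read in its
      own score order, gives \<open>g v < g u\<close>.\<close>
    define h where "h i = (if i = 0 then u else if i = 1 then g v else if i = 2 then g u else v)" for i :: nat
    have "inj_on h {..<4}" using d uv by (auto simp: inj_on_def h_def split: if_splits)
    from pattern[OF this] obtain x where x: "good x" "\<And>i j. i < j \<Longrightarrow> j < 4 \<Longrightarrow> s (h i) x < s (h j) x"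
      "\<And>i j. i < j \<Longrightarrow> j < 4 \<Longrightarrow> x (h i, h j) \<longleftrightarrow> ty (h i) (h j) \<in> \<epsilon>" by blast
    have "x (u, v)" using x(3)[of 0 3] \<epsilon>uv by (simp add: h_def)
    moreover have "s u x \<le> s (g u) x" "s (g v) x \<le> s v x"
      using x(2)[of 0 2] x(2)[of 1 3] by (simp_all add: h_def)
    ultimately have "x (g u, g v)"
      using good_less_mono[OF x(1) uv ty_apply[OF gG, symmetric]] by blast
    moreover have "x (g v, g u)" using x(3)[of 1 2] \<epsilon>uv ty_apply[OF gG, of v u] by (simp add: h_def)
    ultimately show False using LO_asym[OF good_LO[OF x(1)]] by blast
  qed
  ultimately have xor: "ty v u \<in> \<epsilon> \<longleftrightarrow> ty u v \<notin> \<epsilon>" if "u \<noteq> v" for u v using that by blast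
  show ?thesis
  proof (rule invariant_order_if_homogeneous[OF inj_to_nat])
    fix B :: "'a set" assume B: "finite B"
    define k where "k = card B"
    obtain h where h: "bij_betw h {..<k} B"
      using ex_bij_betw_nat_finite[OF B] unfolding k_def atLeast0LessThan by blast
    have hi: "inj_on h {..<k}" using h by (rule bij_betw_imp_inj_on)
    from pattern[OF hi] obtain x where x: "good x"
      "\<And>i j. i < j \<Longrightarrow> j < k \<Longrightarrow> x (h i, h j) \<longleftrightarrow> ty (h i) (h j) \<in> \<epsilon>" by blast
    have LOx: "x \<in> LO" using good_LO[OF x(1)] .
    \<comment> \<open>Scores no longer matter: as exactly one of the two types lies in
      \<open>\<epsilon>\<close>, the pair is decided by its type whichever entry has the larger
      score.\<close>
    have iff: "x (u, v) \<longleftrightarrow> ty u v \<in> \<epsilon>" if uv: "u \<in> B" "v \<in> B" "u \<noteq> v" for u v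
    proof -
      obtain i j where ij: "i < k" "j < k" "u = h i" "v = h j"
        using uv h by (metis bij_betw_imp_surj_on imageE lessThan_iff)
      consider "i < j" | "j < i" using ij uv(3) by (metis linorder_neqE_nat)
      then show ?thesis
      proof cases
        case 1
        then show ?thesis using x(2) ij by blast
      next
        case 2
        then have "x (v, u) \<longleftrightarrow> ty v u \<in> \<epsilon>" using x(2) ij by blast
        moreover have "x (v, u) \<longleftrightarrow> \<not> x (u, v)" using LO_total[OF LOx uv(3)] LO_asym[OF LOx] by blast
        ultimately show ?thesis using xor[OF uv(3)] by blast
      qed
    qed
    have "homogeneous x B" unfolding homogeneous_def
    proof (intro ballI impI)
      fix u v u' v' assume *: "u \<in> B" "v \<in> B" "u' \<in> B" "v' \<in> B" "ty u v = ty u' v'" "x (u, v)"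
      have "u \<noteq> v" using LO_neq[OF LOx *(6)] .
      then show "x (u', v')" using iff[OF *(1,2)] iff[OF *(3,4) ty_eq_neq[OF *(5)]] *(5,6) by simp
    qed
    then show "\<exists>x\<in>LO. homogeneous x B" using LOx by blast
  qed
qed

end

subsection \<open>The uniform measure\<close>

definition sorted_orders :: "'a list \<Rightarrow> ('a \<times> 'a \<Rightarrow> bool) set" where
  "sorted_orders as = {x \<in> LO. sorted_wrt (\<lambda>a b. x (a, b)) as}"

lemma sorted_ordersD:
  assumes "x \<in> sorted_orders as"
  shows "x \<in> LO" "sorted_wrt (\<lambda>a b. x (a, b)) as"
  using assms by (simp_all add: sorted_orders_def)

lemma sorted_orders_measurable: "sorted_orders as \<in> sets LO_borel"
proof -
  note [measurable] = pred_LO_borel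
  have "{x \<in> space LO_borel. \<forall>i j. i < j \<longrightarrow> j < length as \<longrightarrow> x (as ! i, as ! j)} \<in> sets LO_borel"
    by measurable
  then show ?thesis unfolding sorted_orders_def sorted_wrt_iff_nth_less space_LO_borel .
qed

lemma sorted_orders_unique:
  assumes "x \<in> sorted_orders as" "x \<in> sorted_orders bs" "set as = set bs" "distinct as" "distinct bs"
  shows "as = bs"
proof -
  note x = sorted_ordersD(1)[OF assms(1)]
  show ?thesis using sorted_ordersD(2)[OF assms(1)] sorted_ordersD(2)[OF assms(2)] assms(3-5)
  proof (induction as arbitrary: bs)
    case (Cons a as)
    then obtain b bs' where bs: "bs = b # bs'" by (cases bs) auto
    have "a = b"
    proof (rule ccontr)
      assume "a \<noteq> b"
      then have "a \<in> set bs'" "b \<in> set as" using Cons.prems(3) by (auto simp: bs)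
      then have "x (b, a)" "x (a, b)" using Cons.prems(1,2) by (auto simp: bs)
      then show False using LO_asym[OF x] by blast
    qed
    moreover have "set as = set bs'"
      using Cons.prems(3-5) \<open>a = b\<close> by (auto simp: bs)
    then have "as = bs'" using Cons.prems by (intro Cons.IH) (auto simp: bs)
    ultimately show ?case by (simp add: bs)
  qed simp
qed

lemma disjoint_sorted_orders:
  assumes "\<And>l. l \<in> L \<Longrightarrow> set l = A \<and> distinct l"
  shows "disjoint_family_on sorted_orders L"
  unfolding disjoint_family_on_def
proof (intro ballI impI)
  fix l l' assume l: "l \<in> L" "l' \<in> L" "l \<noteq> l'"
  show "sorted_orders l \<inter> sorted_orders l' = {}"
  proof (rule ccontr)
    assume "sorted_orders l \<inter> sorted_orders l' \<noteq> {}"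
    then obtain x where "x \<in> sorted_orders l" "x \<in> sorted_orders l'" by blast
    then have "l = l'" by (rule sorted_orders_unique) (use assms[OF l(1)] assms[OF l(2)] in simp_all)
    with l(3) show False by blast
  qed
qed

lemma ex_sorted_orders:
  assumes x: "x \<in> LO" and A: "finite A"
  obtains l where "distinct l" "set l = A" "x \<in> sorted_orders l"
proof -
  have "\<exists>l. distinct l \<and> set l = A \<and> sorted_wrt (\<lambda>a b. x (a, b)) l"
    using A LO_trans[OF x] LO_total[OF x] by (rule ex_sorted_wrt)
  then obtain l where "distinct l" "set l = A" "sorted_wrt (\<lambda>a b. x (a, b)) l" by blast
  then show ?thesis using that[of l] x by (simp add: sorted_orders_def)
qed

text \<open>The sorted arrangements of a finite set of size n cut \<open>LO\<close> into n! disjoint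
  pieces, and symmetry gives them equal mass.\<close>

lemma uniform_if_symmetric:
  assumes \<mu>: "borel_prob_LO \<mu>"
    and sym: "\<And>as bs. distinct as \<Longrightarrow> distinct bs \<Longrightarrow> length as = length bs \<Longrightarrow>
      measure \<mu> (sorted_orders as) = measure \<mu> (sorted_orders bs)"
  shows "uniform_measure_LO \<mu>"
  unfolding uniform_measure_LO_def sorted_orders_def[symmetric]
proof (intro conjI allI impI)
  interpret prob_space \<mu> using \<mu> by (simp add: borel_prob_LO_def)
  have sets: "sets \<mu> = sets LO_borel" and space: "space \<mu> = LO" using \<mu> by (simp_all add: borel_prob_LO_def)
  fix as :: "'a list" assume as: "distinct as"
  define \<P> where "\<P> = permutations_of_set (set as)"
  have \<P>: "finite \<P>" "card \<P> = fact (length as)"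
    using as by (simp_all add: \<P>_def distinct_card)
  have bs: "set bs = set as \<and> distinct bs" if "bs \<in> \<P>" for bs
    using that by (simp add: \<P>_def permutations_of_set_def)
  have len: "length bs = length as" if "bs \<in> \<P>" for bs
    using bs[OF that] as by (metis distinct_card)
  have "(\<Union>bs\<in>\<P>. sorted_orders bs) = LO"
  proof (rule antisym; rule subsetI)
    fix x :: "'a \<times> 'a \<Rightarrow> bool" assume x: "x \<in> LO"
    obtain l where "distinct l" "set l = set as" "x \<in> sorted_orders l"
      using ex_sorted_orders[OF x, of "set as"] by blast
    then show "x \<in> (\<Union>bs\<in>\<P>. sorted_orders bs)"
      by (intro UN_I[of l]) (simp_all add: \<P>_def permutations_of_set_def)
  next
    fix x assume "x \<in> (\<Union>bs\<in>\<P>. sorted_orders bs)"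
    then show "x \<in> LO" using sorted_ordersD(1) by blast
  qed
  then have "1 = prob (\<Union>bs\<in>\<P>. sorted_orders bs)" using prob_space space by simp
  also have "\<dots> = (\<Sum>bs\<in>\<P>. prob (sorted_orders bs))"
    by (rule finite_measure_finite_Union[OF \<P>(1) _ disjoint_sorted_orders[OF bs]])
      (use sets sorted_orders_measurable in auto)
  also have "\<dots> = (\<Sum>bs\<in>\<P>. prob (sorted_orders as))"
  proof (rule sum.cong[OF refl])
    fix bs assume "bs \<in> \<P>"
    then show "prob (sorted_orders bs) = prob (sorted_orders as)" using sym[of bs as] bs len as by blast
  qed
  finally show "measure \<mu> (sorted_orders as) = 1 / fact (length as)"
    using \<P>(2) by (simp add: field_simps)
qed (fact \<mu>)

text \<open>The generator consists of the sets of orders that are determined by the restriction of the order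
  to \<open>{a. to_nat a < n}\<close> for some \<open>n\<close>; these are finite disjoint unions of sets \<open>sorted_orders l\<close>.\<close>

lemma uniform_measure_unique:
  fixes \<mu> \<nu> :: "('a::countable \<times> 'a \<Rightarrow> bool) measure"
  assumes "uniform_measure_LO \<mu>" "uniform_measure_LO \<nu>"
  shows "\<mu> = \<nu>"
proof -
  have b: "borel_prob_LO \<mu>" "borel_prob_LO \<nu>" using assms by (auto simp: uniform_measure_LO_def)
  interpret M: prob_space \<mu> using b by (simp add: borel_prob_LO_def)
  interpret N: prob_space \<nu> using b by (simp add: borel_prob_LO_def)
  have sets: "sets \<mu> = sets LO_borel" "sets \<nu> = sets LO_borel" and space: "space \<mu> = LO" "space \<nu> = LO"
    using b by (simp_all add: borel_prob_LO_def)
  define B :: "nat \<Rightarrow> 'a set" where "B n = {a. to_nat a < n}" for n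
  define ag where "ag n x x' \<longleftrightarrow> (\<forall>a\<in>B n. \<forall>b\<in>B n. x (a, b) \<longleftrightarrow> x' (a, b))" for n and x x' :: "'a \<times> 'a \<Rightarrow> bool"
  define E where "E = {X. X \<subseteq> LO \<and> (\<exists>n. \<forall>x\<in>X. \<forall>x'\<in>LO. ag n x x' \<longrightarrow> x' \<in> X)}"
  have finB: "finite (B n)" for n
    unfolding B_def using finite_vimageI[OF finite_lessThan[of n] inj_to_nat] by (simp add: vimage_def)
  have ag_mono: "ag n x x'" if "ag m x x'" "n \<le> m" for n m x x'
    using that by (auto simp: ag_def B_def)
  have decomp: "\<exists>\<L>. finite \<L> \<and> disjoint_family_on sorted_orders \<L> \<and> (\<forall>l\<in>\<L>. distinct l) \<and>
      X = (\<Union>l\<in>\<L>. sorted_orders l)" if "X \<in> E" for X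
  proof -
    obtain n where X: "X \<subseteq> LO" and n: "\<And>x x'. x \<in> X \<Longrightarrow> x' \<in> LO \<Longrightarrow> ag n x x' \<Longrightarrow> x' \<in> X"
      using \<open>X \<in> E\<close> unfolding E_def by blast
    define \<L> where "\<L> = {l \<in> permutations_of_set (B n). \<exists>x\<in>X. x \<in> sorted_orders l}"
    have L: "set l = B n \<and> distinct l" if "l \<in> \<L>" for l using that by (simp add: \<L>_def permutations_of_set_def)
    have "finite \<L>" unfolding \<L>_def using finB by simp
    moreover have "disjoint_family_on sorted_orders \<L>" by (rule disjoint_sorted_orders[OF L])
    moreover have "X = (\<Union>l\<in>\<L>. sorted_orders l)"
    proof (rule antisym; rule subsetI)
      fix x assume x: "x \<in> X"
      obtain l where "distinct l" "set l = B n" "x \<in> sorted_orders l"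
        using ex_sorted_orders[OF subsetD[OF X x] finB] by blast
      then show "x \<in> (\<Union>l\<in>\<L>. sorted_orders l)" using x
        by (intro UN_I[of l]) (auto simp: \<L>_def permutations_of_set_def)
    next
      fix x assume "x \<in> (\<Union>l\<in>\<L>. sorted_orders l)"
      then obtain l where l: "l \<in> \<L>" "x \<in> sorted_orders l" by blast
      then obtain x' where x': "x' \<in> X" "x' \<in> sorted_orders l" unfolding \<L>_def by blast
      have iff: "y (l ! i, l ! j) \<longleftrightarrow> i < j" if y: "y \<in> sorted_orders l" and ij: "i < length l" "j < length l" for y i j
      proof -
        note LOy = sorted_ordersD(1)[OF y]
        have *: "y (l ! i, l ! j)" if "i < j" "j < length l" for i j
          using sorted_ordersD(2)[OF y] that by (simp add: sorted_wrt_iff_nth_less)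
        consider "i < j" | "i = j" | "j < i" by (rule linorder_cases)
        then show ?thesis
        proof cases
          case 1
          then show ?thesis using *[OF 1 ij(2)] by simp
        next
          case 2
          then show ?thesis using LO_irrefl[OF LOy] by simp
        next
          case 3
          then show ?thesis using LO_asym[OF LOy *[OF 3 ij(1)]] by simp
        qed
      qed
      have "ag n x' x" unfolding ag_def
      proof (intro ballI)
        fix a b assume ab: "a \<in> B n" "b \<in> B n"
        obtain i j where ij: "i < length l" "j < length l" "a = l ! i" "b = l ! j"
          using ab L[OF l(1)] by (metis in_set_conv_nth)
        show "x' (a, b) \<longleftrightarrow> x (a, b)" unfolding ij(3,4) iff[OF l(2) ij(1,2)] iff[OF x'(2) ij(1,2)] ..
      qed
      then show "x \<in> X" by (rule n[OF x'(1) sorted_ordersD(1)[OF l(2)]])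
    qed
    ultimately show ?thesis using L by blast
  qed
  have E_LO: "E \<subseteq> Pow LO" unfolding E_def by blast
  have E_coord: "{x \<in> LO. x (a, b)} \<in> E" for a b
  proof -
    have "a \<in> B (Suc (max (to_nat a) (to_nat b)))" "b \<in> B (Suc (max (to_nat a) (to_nat b)))"
      by (simp_all add: B_def)
    then show ?thesis unfolding E_def ag_def by blast
  qed
  have sE: "sets (sigma LO E) = sigma_sets LO E" "space (sigma LO E) = LO"
    using E_LO by (simp_all add: sets_measure_of space_measure_of)
  have "sets LO_borel = sigma_sets LO E"
  proof (rule antisym)
    have id: "id \<in> measurable (sigma LO E) LO_borel"
    proof (rule measurable_into_LO_borel)
      fix a b :: 'a
      have "{x \<in> space (sigma LO E). x (a, b)} \<in> sets (sigma LO E)"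
        unfolding sE using sigma_sets.Basic[OF E_coord] .
      then show "Measurable.pred (sigma LO E) (\<lambda>x. id x (a, b))" unfolding pred_def id_apply .
    qed (simp add: sE)
    show "sets LO_borel \<subseteq> sigma_sets LO E"
    proof
      fix X :: "('a \<times> 'a \<Rightarrow> bool) set" assume X: "X \<in> sets LO_borel"
      have "id -` X \<inter> space (sigma LO E) \<in> sets (sigma LO E)" using id X by (rule measurable_sets)
      moreover have "X \<subseteq> LO" using sets.sets_into_space[OF X] by simp
      ultimately show "X \<in> sigma_sets LO E" unfolding sE by (simp add: Int_absorb2)
    qed
    have "E \<subseteq> sets LO_borel"
    proof
      fix X assume "X \<in> E"
      from decomp[OF this] obtain \<L> where "finite \<L>" "X = (\<Union>l\<in>\<L>. sorted_orders l)" by blast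
      then show "X \<in> sets LO_borel" by (metis sets.finite_UN sorted_orders_measurable)
    qed
    then show "sigma_sets LO E \<subseteq> sets LO_borel" using sets.sigma_sets_subset[of E LO_borel] by simp
  qed
  then have sets': "sets \<mu> = sigma_sets LO E" "sets \<nu> = sigma_sets LO E" using sets by simp_all
  have "Int_stable E"
  proof (rule Int_stableI)
    fix X X' assume "X \<in> E" "X' \<in> E"
    then obtain n n' where X: "X \<subseteq> LO" "\<And>x x'. x \<in> X \<Longrightarrow> x' \<in> LO \<Longrightarrow> ag n x x' \<Longrightarrow> x' \<in> X"
      and X': "\<And>x x'. x \<in> X' \<Longrightarrow> x' \<in> LO \<Longrightarrow> ag n' x x' \<Longrightarrow> x' \<in> X'" unfolding E_def by blast
    have "x' \<in> X \<inter> X'" if "x \<in> X \<inter> X'" "x' \<in> LO" "ag (max n n') x x'" for x x'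
      using X(2)[of x x'] X'[of x x'] that ag_mono[OF that(3)] by simp
    then show "X \<inter> X' \<in> E" unfolding E_def using X(1) by blast
  qed
  then show ?thesis
  proof (rule measure_eqI_generator_eq[OF _ E_LO _ sets'])
    have "LO \<in> E" unfolding E_def by blast
    then show "range (\<lambda>_::nat. LO) \<subseteq> E" by blast
    show "emeasure \<mu> LO \<noteq> \<infinity>" by (simp add: M.emeasure_eq_measure)
    fix X assume "X \<in> E"
    from decomp[OF this] obtain \<L> where L: "finite \<L>" "disjoint_family_on sorted_orders \<L>" "\<forall>l\<in>\<L>. distinct l"
      "X = (\<Union>l\<in>\<L>. sorted_orders l)" by blast
    have "measure \<mu> X = (\<Sum>l\<in>\<L>. measure \<mu> (sorted_orders l))" unfolding L(4)
      by (rule M.finite_measure_finite_Union[OF L(1) _ L(2)]) (use sets sorted_orders_measurable in auto)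
    also have "\<dots> = (\<Sum>l\<in>\<L>. measure \<nu> (sorted_orders l))"
      using assms L(3) by (intro sum.cong) (simp_all add: uniform_measure_LO_def sorted_orders_def)
    also have "\<dots> = measure \<nu> X" unfolding L(4)
      by (rule N.finite_measure_finite_Union[symmetric, OF L(1) _ L(2)]) (use sets sorted_orders_measurable in auto)
    finally show "emeasure \<mu> X = emeasure \<nu> X" by (simp add: M.emeasure_eq_measure N.emeasure_eq_measure)
  qed simp
qed

lemma (in LO_action) uniform_if_no_invariant_order:
  assumes no_fix: "\<not> (\<exists>x\<in>LO. \<forall>g\<in>G. lo_act g x = x)"
  shows "uniform_measure_LO \<mu>"
proof (rule uniform_if_symmetric)
  show "borel_prob_LO \<mu>" using inv_\<mu> by (simp add: invariant_measure_def)
  have no_ties: "AE x in \<mu>. s a x \<noteq> s b x" if "a \<noteq> b" for a b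
    using invariant_order_if_ties[OF that] no_fix by blast
  have no_dis: "AE x in \<mu>. \<not> (x (a, b) \<and> s a x < s b x)" if "a \<noteq> b" for a b
    using invariant_order_if_disagreement[OF no_ties that] no_fix by blast
  \<comment> \<open>The direction is reversed: a point low in the order is more likely to lie below
    \<open>c\<close>, so a higher score means an earlier position.\<close>
  have agree: "AE x in \<mu>. x (a, b) \<longleftrightarrow> s b x < s a x" if "a \<noteq> b" for a b
    using no_dis[OF that] no_dis[OF that[symmetric]] no_ties[OF that] AE_space
  proof eventually_elim
    case (elim x)
    then have x: "x \<in> LO" by simp
    show ?case
      using elim(1-3) LO_total[OF x that] LO_asym[OF x, of a b] by (metis linorder_neqE_linordered_idom)
  qed
  fix as bs :: "'a list" assume as: "distinct as" and bs: "distinct bs" and len: "length as = length bs"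
  define n where "n = length as"
  define S where "S = {t \<in> space (Pn n). \<forall>i\<in>{..<n}. \<forall>j\<in>{..<n}. i < j \<longrightarrow> sc (t j) < sc (t i)}"
  have "Measurable.pred (Pn n) (\<lambda>t. \<forall>i\<in>{..<n}. \<forall>j\<in>{..<n}. i < j \<longrightarrow> sc (t j) < sc (t i))"
  proof -
    have "Measurable.pred (Pn n) (\<lambda>t. sc (t i) < sc (t j))" if "i < n" "j < n" for i j
      unfolding pred_def by (intro borel_measurable_less sc_meas that)
    then show ?thesis by (intro pred_intros_logic pred_intros_finite) simp_all
  qed
  then have S: "S \<in> sets (Pn n)" unfolding S_def pred_def .
  have eq: "prob (sorted_orders l) = prob {x \<in> space \<mu>. EF.tuple n ((!) l) x \<in> S}"
    if l: "distinct l" "length l = n" for l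
  proof (rule finite_measure_eq_AE)
    show "sorted_orders l \<in> events" using sorted_orders_measurable by simp
    show "{x \<in> space \<mu>. EF.tuple n ((!) l) x \<in> S} \<in> events" by (rule EF.tuple_event[OF S])
    have "AE x in \<mu>. \<forall>i j. i < j \<longrightarrow> j < n \<longrightarrow> (x (l ! i, l ! j) \<longleftrightarrow> s (l ! j) x < s (l ! i) x)"
      unfolding AE_all_countable
    proof (intro allI)
      fix i j
      show "AE x in \<mu>. i < j \<longrightarrow> j < n \<longrightarrow> (x (l ! i, l ! j) \<longleftrightarrow> s (l ! j) x < s (l ! i) x)"
      proof (cases "i < j \<and> j < n")
        case True
        then have "l ! i \<noteq> l ! j" using l by (simp add: nth_eq_iff_index_eq)
        from agree[OF this] show ?thesis by eventually_elim blast
      next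
        case False
        then show ?thesis by (intro AE_I2) blast
      qed
    qed
    then show "AE x in \<mu>. x \<in> sorted_orders l \<longleftrightarrow> x \<in> {x \<in> space \<mu>. EF.tuple n ((!) l) x \<in> S}"
      using AE_space
    proof eventually_elim
      case (elim x)
      have "x \<in> sorted_orders l \<longleftrightarrow> (\<forall>i j. i < j \<longrightarrow> j < n \<longrightarrow> x (l ! i, l ! j))"
        using elim(2) l(2) unfolding sorted_orders_def sorted_wrt_iff_nth_less space_\<mu> by blast
      also have "\<dots> \<longleftrightarrow> (\<forall>i j. i < j \<longrightarrow> j < n \<longrightarrow> s (l ! j) x < s (l ! i) x)"
        using elim(1) by blast
      also have "\<dots> \<longleftrightarrow> (\<forall>i\<in>{..<n}. \<forall>j\<in>{..<n}. i < j \<longrightarrow> s (l ! j) x < s (l ! i) x)"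
        by (meson lessThan_iff order.strict_trans)
      also have "\<dots> \<longleftrightarrow> EF.tuple n ((!) l) x \<in> S"
        unfolding S_def using tuple_space[of n "(!) l" x] by (simp add: tuple_apply s_def)
      finally show ?case using elim(2) by blast
    qed
  qed
  have "inj_on ((!) l) {..<n}" if "distinct l" "length l = n" for l :: "'a list"
    using that by (simp add: inj_on_nth)
  then have "prob {x \<in> space \<mu>. EF.tuple n ((!) as) x \<in> S} = prob {x \<in> space \<mu>. EF.tuple n ((!) bs) x \<in> S}"
    using as bs len by (intro EF.prob_tuple_eq[OF _ _ S]) (simp_all add: n_def)
  then show "prob (sorted_orders as) = prob (sorted_orders bs)"
    using eq[OF as] eq[OF bs] len by (simp add: n_def)
qed

text \<open>Independent uniform labels induce a random order. The joint law of the labels at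
  distinct points depends only on their number, which is the symmetry that
  \<open>uniform_if_symmetric\<close> asks for.\<close>

lemma ex_uniform_measure: "\<exists>\<mu> :: ('a::countable \<times> 'a \<Rightarrow> bool) measure. uniform_measure_LO \<mu>"
proof -
  define U where "U = uniform_measure lborel {0..1::real}"
  have sU [measurable_cong]: "sets U = sets borel" by (simp add: U_def)
  interpret U: prob_space U unfolding U_def by (rule prob_space_uniform_measure) simp_all
  define P where "P = PiM (UNIV :: 'a set) (\<lambda>_. U)"
  interpret P: prob_space P unfolding P_def by (rule prob_space_PiM) (rule U.prob_space_axioms)
  have comp [measurable]: "(\<lambda>\<omega>. \<omega> a) \<in> borel_measurable P" for a
  proof -
    have "(\<lambda>\<omega>. \<omega> a) \<in> measurable P U" unfolding P_def by (rule measurable_component_singleton) simp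
    then show ?thesis by (simp cong: measurable_cong_sets add: sU)
  qed
  have atom: "AE y in U. y \<noteq> z" for z
    unfolding U_def
  proof (rule AE_uniform_measureI)
    show "AE y in lborel. y \<in> {0..1} \<longrightarrow> y \<noteq> z"
      using AE_lborel_singleton[of z] by eventually_elim simp
  qed simp
  \<comment> \<open>Split off the coordinate \<open>a\<close>: for each fixed value of it, the
    coordinate \<open>b\<close> still has the atomless law \<open>U\<close>, so a tie is null in
    every section.\<close>
  have no_ties: "AE \<omega> in P. \<omega> a \<noteq> \<omega> b" if "a \<noteq> b" for a b
  proof -
    define P' where "P' = PiM (UNIV - {a}) (\<lambda>_. U)"
    interpret P': prob_space P' unfolding P'_def by (rule prob_space_PiM) (rule U.prob_space_axioms)
    interpret UP: pair_prob_space U P' ..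
    have b: "(\<lambda>X. X b) \<in> measurable P' U"
      unfolding P'_def by (rule measurable_component_singleton) (use that in simp)
    then have [measurable]: "(\<lambda>X. X b) \<in> borel_measurable P'" by (simp cong: measurable_cong_sets add: sU)
    have upd: "(\<lambda>(x, X). X(a := x)) \<in> measurable (U \<Otimes>\<^sub>M P') P"
    proof -
      have "(\<lambda>(x, X). X(a := x)) \<in> measurable (U \<Otimes>\<^sub>M P') (PiM (insert a (UNIV - {a})) (\<lambda>_. U))"
        unfolding P'_def by measurable
      then show ?thesis by (simp add: P_def insert_absorb)
    qed
    have P_eq: "P = distr (U \<Otimes>\<^sub>M P') P (\<lambda>(x, X). X(a := x))"
      using distr_pair_PiM_eq_PiM[of "UNIV - {a}" "\<lambda>_. U" a] U.prob_space_axioms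
      by (simp add: P_def P'_def insert_absorb)
    have "AE p in U \<Otimes>\<^sub>M P'. fst p \<noteq> snd p b"
    proof (rule UP.AE_pair_measure)
      show "{p \<in> space (U \<Otimes>\<^sub>M P'). fst p \<noteq> snd p b} \<in> sets (U \<Otimes>\<^sub>M P')" by measurable
      have "AE X in P'. X b \<noteq> x" for x
      proof (rule AE_distrD[OF b])
        have "distr P' U (\<lambda>X. X b) = U"
          unfolding P'_def by (rule distr_PiM_component) (use U.prob_space_axioms that in auto)
        then show "AE y in distr P' U (\<lambda>X. X b). y \<noteq> x" using atom[of x] by (simp only:)
      qed
      then have "AE X in P'. fst (x, X) \<noteq> snd (x, X) b" for x by (simp add: eq_commute)
      then show "AE x in U. AE X in P'. fst (x, X) \<noteq> snd (x, X) b" by (simp only: AE_I2)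
    qed
    then have "AE p in U \<Otimes>\<^sub>M P'. (case p of (x, X) \<Rightarrow> X(a := x)) a \<noteq> (case p of (x, X) \<Rightarrow> X(a := x)) b"
      by eventually_elim (use that in \<open>simp add: split_beta\<close>)
    then have "AE \<omega> in distr (U \<Otimes>\<^sub>M P') P (\<lambda>(x, X). X(a := x)). \<omega> a \<noteq> \<omega> b"
      by (subst AE_distr_iff[OF upd borel_measurable_neq[OF comp comp]])
    then show ?thesis unfolding P_eq[symmetric] .
  qed
  \<comment> \<open>Breaking ties by the enumeration makes \<open>Z \<omega>\<close> a linear order
    for every \<open>\<omega>\<close>; almost surely this clause is never reached.\<close>
  define Z :: "('a \<Rightarrow> real) \<Rightarrow> 'a \<times> 'a \<Rightarrow> bool" where
    "Z \<omega> = (\<lambda>(a, b). \<omega> a < \<omega> b \<or> \<omega> a = \<omega> b \<and> to_nat a < to_nat b)" for \<omega>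
  have Z_LO: "Z \<omega> \<in> LO" for \<omega>
    unfolding LO_def Z_def by (auto simp: not_less le_less)
  have Z: "Z \<in> measurable P LO_borel"
  proof (rule measurable_into_LO_borel[OF Z_LO])
    fix a b
    have [measurable]: "Measurable.pred P (\<lambda>\<omega>. \<omega> a < \<omega> b)" "Measurable.pred P (\<lambda>\<omega>. \<omega> a = \<omega> b)"
      unfolding pred_def by (rule borel_measurable_less borel_measurable_eq comp)+
    show "Measurable.pred P (\<lambda>\<omega>. Z \<omega> (a, b))" unfolding Z_def split by measurable
  qed
  define \<mu> where "\<mu> = distr P LO_borel Z"
  have "uniform_measure_LO \<mu>"
  proof (rule uniform_if_symmetric)
    show "borel_prob_LO \<mu>"
      unfolding borel_prob_LO_def \<mu>_def using P.prob_space_distr[OF Z] by simp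
    have eq: "measure \<mu> (sorted_orders l) =
        measure (PiM {..<length l} (\<lambda>_. U)) {t \<in> space (PiM {..<length l} (\<lambda>_. U)). \<forall>i j. i < j \<longrightarrow> j < length l \<longrightarrow> t i < t j}"
      if l: "distinct l" for l
    proof -
      define n where "n = length l"
      define S where "S = {t \<in> space (PiM {..<n} (\<lambda>_. U)). \<forall>i j. i < j \<longrightarrow> j < n \<longrightarrow> t i < t j}"
      define f where "f = (\<lambda>\<omega> :: 'a \<Rightarrow> real. \<lambda>i\<in>{..<n}. \<omega> (l ! i))"
      have S: "S \<in> sets (PiM {..<n} (\<lambda>_. U))"
      proof -
        have "Measurable.pred (PiM {..<n} (\<lambda>_. U)) (\<lambda>t. i < j \<longrightarrow> j < n \<longrightarrow> t i < t j)" for i j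
        proof (cases "i < j \<and> j < n")
          case True
          have "(\<lambda>t. t k) \<in> borel_measurable (PiM {..<n} (\<lambda>_. U))" if "k < n" for k
            using measurable_component_singleton[of k "{..<n}" "\<lambda>_. U"] that by (simp cong: measurable_cong_sets add: sU)
          then have "Measurable.pred (PiM {..<n} (\<lambda>_. U)) (\<lambda>t. t i < t j)"
            unfolding pred_def using True by (intro borel_measurable_less) simp_all
          then show ?thesis using True by simp
        next
          case False
          then have "(\<lambda>t :: nat \<Rightarrow> real. i < j \<longrightarrow> j < n \<longrightarrow> t i < t j) = (\<lambda>_. True)" by blast
          then show ?thesis by simp
        qed
        then have "Measurable.pred (PiM {..<n} (\<lambda>_. U)) (\<lambda>t. \<forall>i j. i < j \<longrightarrow> j < n \<longrightarrow> t i < t j)"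
          by (intro pred_intros_countable)
        then show ?thesis unfolding S_def pred_def .
      qed
      have inj: "inj_on ((!) l) {..<n}" using l by (simp add: inj_on_nth n_def)
      have f: "f \<in> measurable P (PiM {..<n} (\<lambda>_. U))"
        unfolding f_def P_def by (rule measurable_restrict) (rule measurable_component_singleton, simp)
      have "measure \<mu> (sorted_orders l) = P.prob (Z -` sorted_orders l \<inter> space P)"
        unfolding \<mu>_def by (rule measure_distr[OF Z sorted_orders_measurable])
      also have "\<dots> = P.prob (f -` S \<inter> space P)"
      proof (rule P.finite_measure_eq_AE)
        show "Z -` sorted_orders l \<inter> space P \<in> P.events" by (rule measurable_sets[OF Z sorted_orders_measurable])
        show "f -` S \<inter> space P \<in> P.events" by (rule measurable_sets[OF f S])
        have "AE \<omega> in P. \<forall>a b. a \<noteq> b \<longrightarrow> \<omega> a \<noteq> \<omega> b"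
          unfolding AE_all_countable
        proof (intro allI)
          show "AE \<omega> in P. a \<noteq> b \<longrightarrow> \<omega> a \<noteq> \<omega> b" for a b by (cases "a = b") (simp_all add: no_ties)
        qed
        then show "AE \<omega> in P. \<omega> \<in> Z -` sorted_orders l \<inter> space P \<longleftrightarrow> \<omega> \<in> f -` S \<inter> space P"
          using AE_space
        proof eventually_elim
          case (elim \<omega>)
          have "\<omega> \<in> Z -` sorted_orders l \<longleftrightarrow> (\<forall>i j. i < j \<longrightarrow> j < n \<longrightarrow> Z \<omega> (l ! i, l ! j))"
            using Z_LO by (simp add: sorted_orders_def sorted_wrt_iff_nth_less n_def)
          also have "\<dots> \<longleftrightarrow> (\<forall>i j. i < j \<longrightarrow> j < n \<longrightarrow> \<omega> (l ! i) < \<omega> (l ! j))"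
          proof -
            have "Z \<omega> (l ! i, l ! j) \<longleftrightarrow> \<omega> (l ! i) < \<omega> (l ! j)" if "i < j" "j < n" for i j
            proof -
              have "l ! i \<noteq> l ! j" using l that by (simp add: nth_eq_iff_index_eq n_def)
              then have "\<omega> (l ! i) \<noteq> \<omega> (l ! j)" using elim(1) by blast
              then show ?thesis by (simp add: Z_def)
            qed
            then show ?thesis by blast
          qed
          also have "\<dots> \<longleftrightarrow> \<omega> \<in> f -` S"
            using measurable_space[OF f elim(2)] by (auto simp: S_def f_def)
          finally show ?case by blast
        qed
      qed
      also have "\<dots> = measure (distr P (PiM {..<n} (\<lambda>_. U)) f) S" by (rule measure_distr[OF f S, symmetric])
      also have "distr P (PiM {..<n} (\<lambda>_. U)) f = PiM {..<n} (\<lambda>_. U)"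
        unfolding P_def f_def by (rule distr_PiM_reindex[of UNIV "\<lambda>_. U" "(!) l" "{..<n}"])
          (use U.prob_space_axioms inj in auto)
      finally show ?thesis unfolding S_def n_def .
    qed
    show "measure \<mu> (sorted_orders as) = measure \<mu> (sorted_orders bs)"
      if "distinct as" "distinct bs" "length as = length bs" for as bs
      unfolding eq[OF that(1)] eq[OF that(2)] that(3) ..
  qed
  then show ?thesis by blast
qed

lemma sorted_orders_lo_act:
  assumes "bij g"
  shows "lo_act g -` sorted_orders as \<inter> LO = sorted_orders (map (inv g) as)"
proof (rule set_eqI)
  fix x :: "'a \<times> 'a \<Rightarrow> bool"
  have "lo_act g x \<in> sorted_orders as \<longleftrightarrow> sorted_wrt (\<lambda>a b. x (a, b)) (map (inv g) as)" if "x \<in> LO"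
    using lo_act_LO[OF assms that] by (simp add: sorted_orders_def lo_act_apply sorted_wrt_map)
  then show "x \<in> lo_act g -` sorted_orders as \<inter> LO \<longleftrightarrow> x \<in> sorted_orders (map (inv g) as)"
    by (auto simp: sorted_orders_def)
qed

lemma uniform_measure_distr_lo_act:
  fixes \<mu> :: "('a::countable \<times> 'a \<Rightarrow> bool) measure"
  assumes \<mu>: "uniform_measure_LO \<mu>" and g: "bij g"
  shows "uniform_measure_LO (distr \<mu> \<mu> (lo_act g))"
  unfolding uniform_measure_LO_def sorted_orders_def[symmetric]
proof (intro conjI allI impI)
  have b: "prob_space \<mu>" "sets \<mu> = sets LO_borel" "space \<mu> = LO"
    using \<mu> by (auto simp: uniform_measure_LO_def borel_prob_LO_def)
  have m: "lo_act g \<in> measurable \<mu> \<mu>"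
    using lo_act_measurable[OF g] unfolding measurable_cong_sets[OF b(2) b(2)] .
  show "borel_prob_LO (distr \<mu> \<mu> (lo_act g))"
    unfolding borel_prob_LO_def using prob_space.prob_space_distr[OF b(1) m] b(2,3) by simp
  fix as :: "'a list" assume "distinct as"
  then have "distinct (map (inv g) as)"
    using g by (simp add: distinct_map bij_imp_bij_inv bij_is_inj inj_on_subset[OF _ subset_UNIV])
  then have "measure \<mu> (sorted_orders (map (inv g) as)) = 1 / fact (length as)"
    using \<mu> unfolding uniform_measure_LO_def sorted_orders_def[symmetric] by (metis length_map)
  moreover have "sorted_orders as \<in> sets \<mu>" using sorted_orders_measurable b(2) by blast
  ultimately show "measure (distr \<mu> \<mu> (lo_act g)) (sorted_orders as) = 1 / fact (length as)"
    using sorted_orders_lo_act[OF g, of as] by (simp add: measure_distr[OF m] b(3))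
qed

text \<open>A point mass takes only the values 0 and 1 on measurable sets, whereas two distinct
  points call for the value 1/2.\<close>

lemma uniform_measure_neq_return:
  fixes x :: "'a::countable \<times> 'a \<Rightarrow> bool"
  assumes "infinite (UNIV :: 'a set)"
  shows "\<not> uniform_measure_LO (return LO_borel x)"
proof
  obtain a b :: 'a where ab: "a \<noteq> b" using assms by (metis UNIV_eq_I finite.simps insertCI)
  assume "uniform_measure_LO (return LO_borel x)"
  then have "measure (return LO_borel x) (sorted_orders [a, b]) = 1 / fact (length [a, b])"
    using ab unfolding uniform_measure_LO_def sorted_orders_def[symmetric] by force
  then show False
    by (cases "x \<in> sorted_orders [a, b]") (simp_all add: measure_return[OF sorted_orders_measurable])
qed

text \<open>The equivalence with a negation expresses both exclusion and exhaustion. Exclusion comes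
  from the point mass at a fixed order, which is invariant but not uniform; exhaustion from
  \<open>uniform_if_no_invariant_order\<close>.\<close>

theorem theorem1p2:
  fixes R :: "'i \<Rightarrow> ('a::countable) list set"
  defines "G \<equiv> Aut R"
  assumes "transitive_on G"
    and "aleph0_categorical G"
    and "no_algebraicity G"
    and "weak_EI G"
  shows "(\<exists>x\<in>LO. \<forall>g\<in>G. lo_act g x = x) \<longleftrightarrow>
         \<not> (\<exists>\<mu>u. uniform_measure_LO \<mu>u \<and> (\<forall>\<mu>. invariant_measure G \<mu> \<longleftrightarrow> \<mu> = \<mu>u))"
proof -
  interpret tame_group G
    unfolding G_def tame_group_def tame_group_axioms_def
    using perm_group_Aut[of R] assms(2-5) unfolding G_def by blast
  show ?thesis
  proof
    assume "\<exists>x\<in>LO. \<forall>g\<in>G. lo_act g x = x"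
    then obtain x where x: "x \<in> LO" "\<And>g. g \<in> G \<Longrightarrow> lo_act g x = x" by blast
    have "distr (return LO_borel x) (return LO_borel x) (lo_act g) = return LO_borel x" if "g \<in> G" for g
    proof -
      have "distr (return LO_borel x) (return LO_borel x) (lo_act g) = distr (return LO_borel x) LO_borel (lo_act g)"
        by (rule distr_cong) simp_all
      also have "\<dots> = return LO_borel (lo_act g x)"
        by (rule distr_return[OF lo_act_measurable[OF bij_G[OF that]]]) (simp add: x(1))
      finally show ?thesis using x(2)[OF that] by simp
    qed
    then have "invariant_measure G (return LO_borel x)"
      unfolding invariant_measure_def borel_prob_LO_def using x(1) by (simp add: prob_space_return)
    then show "\<not> (\<exists>\<mu>u. uniform_measure_LO \<mu>u \<and> (\<forall>\<mu>. invariant_measure G \<mu> \<longleftrightarrow> \<mu> = \<mu>u))"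
      using uniform_measure_neq_return[OF infinite_universe, of x] by metis
  next
    assume nu: "\<not> (\<exists>\<mu>u. uniform_measure_LO \<mu>u \<and> (\<forall>\<mu>. invariant_measure G \<mu> \<longleftrightarrow> \<mu> = \<mu>u))"
    show "\<exists>x\<in>LO. \<forall>g\<in>G. lo_act g x = x"
    proof (rule ccontr)
      assume no_fix: "\<not> (\<exists>x\<in>LO. \<forall>g\<in>G. lo_act g x = x)"
      obtain \<mu>u :: "('a \<times> 'a \<Rightarrow> bool) measure" where u: "uniform_measure_LO \<mu>u"
        using ex_uniform_measure by blast
      have "\<mu> = \<mu>u" if "invariant_measure G \<mu>" for \<mu>
      proof -
        interpret LO_action G \<mu> by unfold_locales (rule that)
        show ?thesis by (rule uniform_measure_unique[OF uniform_if_no_invariant_order[OF no_fix] u])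
      qed
      \<comment> \<open>Invariance follows from uniqueness: a translate of the uniform measure is
        again uniform.\<close>
      moreover have "invariant_measure G \<mu>u"
        unfolding invariant_measure_def
      proof (intro conjI ballI)
        show "borel_prob_LO \<mu>u" using u by (simp add: uniform_measure_LO_def)
        show "distr \<mu>u \<mu>u (lo_act g) = \<mu>u" if "g \<in> G" for g
          by (rule uniform_measure_unique[OF uniform_measure_distr_lo_act[OF u bij_G[OF that]] u])
      qed
      ultimately have "\<forall>\<mu>. invariant_measure G \<mu> \<longleftrightarrow> \<mu> = \<mu>u" by metis
      with nu u show False by blast
    qed
  qed
qed

end
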